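(* Let $m\ge 1$ be an integer. Let $\Phi:\mathbf{R}_+^m\to\mathbf{R}_+$ be continuous, satisfy $\Phi(x_1,\dots,x_m)=0$ whenever $x_j=0$ for some $j$, and be strictly increasing in each variable separately (when the other variables are held fixed at positive values). Let $\mu$ be a weighted measure on the unit disc $\mathbf{U}$, and let $\nu_n=\mu\times\dots\times\mu$ ($n$ factors) on $\mathbf{U}^n$. Assume that $\Phi$ and $\mu$ satisfy condition $(\dag)$ with exponents $\tilde p_1,\dots,\tilde p_m\in(0,\infty)$: for every integer $n\ge 1$ and all $f_j\in H^{\tilde p_j}(\mathbf{U}^n)$ $(j=1,\dots,m)$, $$\Phi(|f_1|^{\tilde p_1},\dots,|f_m|^{\tilde p_m})\in L^1(\mathbf{U}^n,\nu_n)$$ and $$\int_{\mathbf{U}^n}\Phi(|f_1|^{\tilde p_1},\dots,|f_m|^{\tilde p_m})\,d\nu_n\le \Phi(\|f_1\|_{\tilde p_1}^{\tilde p_1},\dots,\|f_m\|_{\tilde p_m}^{\tilde p_m}).$$ Let $\mathcal{E}(\Phi,\nu_n)$ be the corresponding class of extremals (see context). Then for every integer $n\ge 1$, all $p_1,\dots,p_m\in(0,\infty)$ and all $f_j\in H^{p_j}(\mathbf{U}^n)$ $(j=1,\dots,m)$, $$\Phi(|f_1|^{p_1},\dots,|f_m|^{p_m})\in L^1(\mathbf{U}^n,\nu_n)$$ and $$\int_{\mathbf{U}^n}\Phi(|f_1(z)|^{p_1},\dots,|f_m(z)|^{p_m})\,d\nu_n(z)\le\Phi(\|f_1\|_{p_1}^{p_1},\dots,\|f_m\|_{p_m}^{p_m}).\qquad(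 * )$$ Moreover: (1) for every $(\Psi_1,\dots,\Psi_m)\in\mathcal{E}(\Phi,\nu_n)$, each $\Psi_j$ $(j=1,\dots,m)$ vanishes nowhere in $\mathbf{U}^n$; and (2) equality holds in $( * )$ if and only if either $\prod_{j=1}^m f_j\equiv 0$, or there is $(\Psi_1,\dots,\Psi_m)\in\mathcal{E}(\Phi,\nu_n)$ such that $f_j=\Psi_j^{\tilde p_j/p_j}$ on $\mathbf{U}^n$ (for some holomorphic branch of the power) for all $j=1,\dots,m$.
   Context: Notation: $\mathbf{R}_+=[0,\infty)$; $\mathbf{U}=\{z\in\mathbf{C}:|z|<1\}$; $\mathbf{U}^n$ is the unit polydisc and $\mathbf{T}^n$ the unit torus in $\mathbf{C}^n$; $m_n$ is the normalized Haar measure on $\mathbf{T}^n$; $dA$ is the area measure on $\mathbf{C}$. Weighted measure on $\mathbf{U}$: a measure of the form $d\mu(z)=g(z)\,dA(z)$ with $g$ measurable and $g(z)>0$ for all $z\in\mathbf{U}$. Hardy space: for $0<p<\infty$, $H^p(\mathbf{U}^n)$ is the set of analytic functions $f$ on $\mathbf{U}^n$ with $\|f\|_p=\sup_{0\le r<1}\left(\int_{\mathbf{T}^n}|f(r\zeta)|^p\,dm_n(\zeta)\right)^{1/p}<\infty$. Extremals: for the exponents $\tilde p_1,\dots,\tilde p_m$ of condition $(\dag)$, $\mathcal{E}(\Phi,\nu_n)$ denotes the set of all $m$-tuples $(\Psi_1,\dots,\Psi_m)$ with $\Psi_j\in H^{\tilde p_j}(\mathbf{U}^n)$, $\Psi_j\not\equiv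 0$ for every $j$, for which $$\int_{\mathbf{U}^n}\Phi(|\Psi_1|^{\tilde p_1},\dots,|\Psi_m|^{\tilde p_m})\,d\nu_n=\Phi(\|\Psi_1\|_{\tilde p_1}^{\tilde p_1},\dots,\|\Psi_m\|_{\tilde p_m}^{\tilde p_m}).$$ *)

theory Defs
  imports "HOL-Complex_Analysis.Complex_Analysis"
begin

text \<open>
  The dimension \<open>n\<close> is quantified inside the hypotheses, so \<open>\<complex>\<^sup>n\<close> is not a type here: its points are
  the extensional functions in \<open>{..<n} \<rightarrow>\<^sub>E UNIV\<close>, on which the product topology of
  \<open>nat \<Rightarrow> complex\<close> induces the Euclidean one. The values of a function on \<open>polydisc n\<close> outside that
  set never matter. The number \<open>m\<close> of functions is fixed and is the cardinality of the type \<open>'m\<close>.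
\<close>

definition polydisc :: "nat \<Rightarrow> (nat \<Rightarrow> complex) set" where
  "polydisc n = {..<n} \<rightarrow>\<^sub>E ball 0 1"

text \<open>The usual definition in several variables: continuous, and holomorphic in each variable.\<close>

definition analytic_polydisc :: "nat \<Rightarrow> ((nat \<Rightarrow> complex) \<Rightarrow> complex) \<Rightarrow> bool" where
  "analytic_polydisc n f \<longleftrightarrow>
     continuous_on (polydisc n) f \<and>
     (\<forall>z\<in>polydisc n. \<forall>k<n. (\<lambda>w. f (z(k := w))) holomorphic_on ball 0 1)"

text \<open>Normalized Haar measure on the circle is normalized arc length; its \<open>n\<close>-fold product is the
  normalized Haar measure on the torus.\<close>

definition circle_haar :: "complex measure" where
  "circle_haar =
     distr (uniform_measure lborel {0..<2 * pi}) (restrict_space borel (sphere 0 1)) cis"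

definition torus_haar :: "nat \<Rightarrow> (nat \<Rightarrow> complex) measure" where
  "torus_haar n = (\<Pi>\<^sub>M k\<in>{..<n}. circle_haar)"

definition hardy_mean :: "nat \<Rightarrow> real \<Rightarrow> ((nat \<Rightarrow> complex) \<Rightarrow> complex) \<Rightarrow> real \<Rightarrow> real" where
  "hardy_mean n p f r =
     (\<integral>\<zeta>. norm (f (\<lambda>k\<in>{..<n}. of_real r * \<zeta> k)) powr p \<partial>torus_haar n) powr (1 / p)"

definition hardy_space :: "nat \<Rightarrow> real \<Rightarrow> ((nat \<Rightarrow> complex) \<Rightarrow> complex) set" where
  "hardy_space n p = {f. analytic_polydisc n f \<and> bdd_above (hardy_mean n p f ` {0..<1})}"

text \<open>A conditionally complete supremum: meaningful for \<open>f\<close> in \<open>hardy_space n p\<close>.\<close>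

definition hardy_norm :: "nat \<Rightarrow> real \<Rightarrow> ((nat \<Rightarrow> complex) \<Rightarrow> complex) \<Rightarrow> real" where
  "hardy_norm n p f = (SUP r\<in>{0..<1}. hardy_mean n p f r)"

definition weighted_measure :: "complex measure \<Rightarrow> bool" where
  "weighted_measure \<mu> \<longleftrightarrow>
     (\<exists>g :: complex \<Rightarrow> real.
        g \<in> borel_measurable (restrict_space borel (ball 0 1)) \<and>
        (\<forall>z\<in>ball 0 1. g z > 0) \<and>
        \<mu> = density (restrict_space lborel (ball 0 1)) (\<lambda>z. ennreal (g z)))"

text \<open>As \<open>\<mu>\<close> has space \<open>ball 0 1\<close>, this measure has space \<open>polydisc n\<close>.\<close>

definition polydisc_measure :: "complex measure \<Rightarrow> nat \<Rightarrow> (nat \<Rightarrow> complex) measure" where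
  "polydisc_measure \<mu> n = (\<Pi>\<^sub>M k\<in>{..<n}. \<mu>)"

definition nonneg_orthant :: "(real ^ 'm) set" where
  "nonneg_orthant = {x. \<forall>j. 0 \<le> x $ j}"

definition admissible :: "(real ^ 'm \<Rightarrow> real) \<Rightarrow> bool" where
  "admissible \<Phi> \<longleftrightarrow>
     continuous_on nonneg_orthant \<Phi> \<and>
     (\<forall>x\<in>nonneg_orthant. 0 \<le> \<Phi> x) \<and>
     (\<forall>x\<in>nonneg_orthant. (\<exists>j. x $ j = 0) \<longrightarrow> \<Phi> x = 0) \<and>
     (\<forall>x j. (\<forall>i. i \<noteq> j \<longrightarrow> 0 < x $ i) \<longrightarrow>
        strict_mono_on {0..} (\<lambda>t. \<Phi> (\<chi> i. if i = j then t else x $ i)))"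

definition phi_mod ::
  "(real ^ 'm \<Rightarrow> real) \<Rightarrow> ('m \<Rightarrow> real) \<Rightarrow> ('m \<Rightarrow> (nat \<Rightarrow> complex) \<Rightarrow> complex)
     \<Rightarrow> (nat \<Rightarrow> complex) \<Rightarrow> real" where
  "phi_mod \<Phi> p f z = \<Phi> (\<chi> j. norm (f j z) powr p j)"

definition phi_norm ::
  "nat \<Rightarrow> (real ^ 'm \<Rightarrow> real) \<Rightarrow> ('m \<Rightarrow> real) \<Rightarrow> ('m \<Rightarrow> (nat \<Rightarrow> complex) \<Rightarrow> complex) \<Rightarrow> real" where
  "phi_norm n \<Phi> p f = \<Phi> (\<chi> j. hardy_norm n (p j) (f j) powr p j)"

definition dagger :: "(real ^ 'm \<Rightarrow> real) \<Rightarrow> complex measure \<Rightarrow> ('m \<Rightarrow> real) \<Rightarrow> bool" where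
  "dagger \<Phi> \<mu> p \<longleftrightarrow>
     (\<forall>n\<ge>1. \<forall>f. (\<forall>j. f j \<in> hardy_space n (p j)) \<longrightarrow>
        integrable (polydisc_measure \<mu> n) (phi_mod \<Phi> p f) \<and>
        (\<integral>z. phi_mod \<Phi> p f z \<partial>polydisc_measure \<mu> n) \<le> phi_norm n \<Phi> p f)"

definition extremals ::
  "(real ^ 'm \<Rightarrow> real) \<Rightarrow> complex measure \<Rightarrow> ('m \<Rightarrow> real) \<Rightarrow> nat
     \<Rightarrow> ('m \<Rightarrow> (nat \<Rightarrow> complex) \<Rightarrow> complex) set" where
  "extremals \<Phi> \<mu> p n =
     {\<Psi>. (\<forall>j. \<Psi> j \<in> hardy_space n (p j) \<and> (\<exists>z\<in>polydisc n. \<Psi> j z \<noteq> 0)) \<and>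
          (\<integral>z. phi_mod \<Phi> p \<Psi> z \<partial>polydisc_measure \<mu> n) = phi_norm n \<Phi> p \<Psi>}"

text \<open>\<open>h\<close> is a holomorphic branch of \<open>F\<^sup>c\<close>, that is \<open>exp (c L)\<close> for a holomorphic branch \<open>L\<close> of \<open>log F\<close>.\<close>

definition holomorphic_power_branch ::
  "nat \<Rightarrow> real \<Rightarrow> ((nat \<Rightarrow> complex) \<Rightarrow> complex) \<Rightarrow> ((nat \<Rightarrow> complex) \<Rightarrow> complex) \<Rightarrow> bool" where
  "holomorphic_power_branch n c F h \<longleftrightarrow>
     (\<exists>L. analytic_polydisc n L \<and>
        (\<forall>z\<in>polydisc n. exp (L z) = F z \<and> h z = exp (of_real c * L z)))"

end

theory Submission
  imports Defs "HOL-Probability.Probability_Measure"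
begin

text \<open>
  The proof reduces to one variable. On the disc, a function \<open>u\<close> with \<open>log u\<close> subharmonic is
  majorized by \<open>|exp P|\<close> for every entire \<open>P\<close> whose real part majorizes \<open>log u\<close> on the circle, and by the
  Stone-Weierstrass theorem \<open>Re P\<close> can be taken close to \<open>log u\<close> there. As \<open>exp P\<close> has roots of every order,
  the hypothesis for the exponents \<open>pt\<close> yields \<open>\<integral> \<Phi>(u\<^sub>1, \<dots>, u\<^sub>m) d\<mu> \<le> \<Phi>(\<integral> u\<^sub>1, \<dots>, \<integral> u\<^sub>m)\<close>, the inner
  integrals being circle means. Partial circle means of \<open>|f|\<^sup>p\<close> are again log-subharmonic in each remaining
  variable, so that the variables can be moved one after another from the disc to the circle.

  If equality holds, then for almost every choice of the other variables it holds in the variable \<open>k\<close>. There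
  a zero could be divided out by a Blaschke factor with a strict gain, so generic slices of \<open>f\<^sub>j\<close> have no zero.
  By Hurwitz's theorem every slice is zero-free or identically zero, and a zero of \<open>f\<^sub>j\<close> would spread from line to
  line over the whole polydisc. A zero-free function on the polydisc has a holomorphic logarithm.
\<close>

section \<open>The circle\<close>

text \<open>A power f^(p/q) exists only if f has no zero, and a circle mean of |f|^p is in general
  not a power of the modulus of a holomorphic function. The argument therefore runs on nonnegative
  real functions compared through outer majorants (\<open>log_majorized\<close>); holomorphic
  functions return only as \<open>exp (P / pt)\<close> when the hypothesis is applied. Radial limits
  on the torus are avoided: estimates are proved for dilates f(rz), continuous up to the torus, and
  pass to r -> 1 by Fatou's lemma. The integrals are nonnegative ones because integrability is part
  of the claim. Fatou's lemma gives one-sided bounds only, so in the equality case the gain from a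
  zero must be independent of r; for this the zeros of the dilates are kept away from the circle.
  \<Phi> increases strictly only where the other arguments are positive, so a strict gain needs an
  open set on which no f_j vanishes. Equality is inherited by almost every slice only, so a given
  line has to be reached as a limit of good ones.\<close>

lemma Re_poly_mult_cnj_poly_on_circle:
  "\<exists>s. \<forall>z\<in>sphere 0 1. Re (poly p z * cnj (poly q z)) = Re (poly s z)"
proof (induction p arbitrary: q)
  case 0
  then show ?case by (intro exI[of _ 0]) auto
next
  case (pCons a p)
  obtain b q' where q: "q = pCons b q'" by (cases q)
  obtain s where s: "\<forall>z\<in>sphere 0 1. Re (poly p z * cnj (poly q' z)) = Re (poly s z)"
    using pCons.IH by blast
  \<comment> \<open>On the circle \<open>z * cnj z = 1\<close>, so the two tails contribute
    \<open>poly p z * cnj (poly q' z)\<close>, which the induction hypothesis covers. The mixed term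
    with \<open>cnj (poly q' z)\<close> is antiholomorphic; its conjugate has the same real
    part.\<close>
  define S where "S = [:a * cnj b:] + smult (cnj a) (pCons 0 q') + smult (cnj b) (pCons 0 p) + s"
  have "Re (poly (pCons a p) z * cnj (poly q z)) = Re (poly S z)" if z: "z \<in> sphere 0 1" for z
  proof -
    have "z * cnj z = 1" using z by (simp add: complex_norm_square[symmetric])
    moreover have "poly (pCons a p) z * cnj (poly q z) =
        a * cnj b + cnj (cnj a * (z * poly q' z)) + cnj b * (z * poly p z)
          + (z * cnj z) * (poly p z * cnj (poly q' z))"
      unfolding q by (simp add: algebra_simps)
    ultimately have "poly (pCons a p) z * cnj (poly q z) =
        a * cnj b + cnj (cnj a * (z * poly q' z)) + cnj b * (z * poly p z) + poly p z * cnj (poly q' z)"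
      by simp
    then show ?thesis
      using s z unfolding S_def
      by (simp only: plus_complex.sel complex_cnj poly_add poly_smult poly_pCons poly_0 cnj.sel) simp
  qed
  then show ?case by blast
qed

text \<open>Stone-Weierstrass for the real parts of polynomials, that is, the real trigonometric
  polynomials. The approximant is the real part of an entire function P, so that
  \<open>exp P\<close> is zero-free and can serve as an outer function.\<close>

lemma Re_entire_approximates_on_circle:
  fixes \<phi> :: "complex \<Rightarrow> real"
  assumes "continuous_on (sphere 0 1) \<phi>" and "0 < e"
  obtains P where "P holomorphic_on UNIV" "\<And>z. z \<in> sphere 0 1 \<Longrightarrow> \<bar>\<phi> z - Re (P z)\<bar> < e"
proof -
  define T where "T f \<longleftrightarrow> (\<exists>p. \<forall>z\<in>sphere 0 1. f z = Re (poly p z))" for f :: "complex \<Rightarrow> real"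
  have "\<exists>g. T g \<and> (\<forall>z\<in>sphere 0 1. \<bar>\<phi> z - g z\<bar> < e)"
  proof (rule Stone_Weierstrass_HOL[OF compact_sphere, of T])
    show "T (\<lambda>x. c)" for c
      unfolding T_def by (intro exI[of _ "[:of_real c:]"]) auto
    show "continuous_on (sphere 0 1) f" if "T f" for f
    proof -
      obtain p where p: "\<forall>z\<in>sphere 0 1. f z = Re (poly p z)"
        using \<open>T f\<close> by (auto simp: T_def)
      have "continuous_on (sphere 0 1) (\<lambda>z. Re (poly p z))"
        by (intro continuous_intros)
      also have "?this \<longleftrightarrow> ?thesis" using p by (intro continuous_on_cong) auto
      finally show ?thesis .
    qed
    show "T (\<lambda>x. f x + g x)" if "T f \<and> T g" for f g
      using that unfolding T_def by (metis plus_complex.sel(1) poly_add)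
    show "T (\<lambda>x. f x * g x)" if fg: "T f \<and> T g" for f g
    proof -
      obtain p q where p: "\<forall>z\<in>sphere 0 1. f z = Re (poly p z)"
        and q: "\<forall>z\<in>sphere 0 1. g z = Re (poly q z)"
        using fg unfolding T_def by blast
      obtain s where s: "\<forall>z\<in>sphere 0 1. Re (poly p z * cnj (poly q z)) = Re (poly s z)"
        using Re_poly_mult_cnj_poly_on_circle by blast
      \<comment> \<open>\<open>Re a * Re b = Re (a * b + a * cnj b) / 2\<close>, and on the circle
        the second term is the real part of a polynomial as well.\<close>
      have "f z * g z = Re (poly (smult (1/2) (p * q + s)) z)" if z: "z \<in> sphere 0 1" for z
        using s[rule_format, OF z] p[rule_format, OF z] q[rule_format, OF z] by simp
      then show ?thesis unfolding T_def by blast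
    qed
    show "\<exists>f. T f \<and> f x \<noteq> f y" if "x \<in> sphere 0 1 \<and> y \<in> sphere 0 1 \<and> x \<noteq> y" for x y
    proof -
      have "T Re" unfolding T_def by (intro exI[of _ "[:0, 1:]"]) auto
      moreover have "T Im" unfolding T_def by (intro exI[of _ "[:0, -\<i>:]"]) auto
      ultimately show ?thesis using that complex_eqI by blast
    qed
  qed (use assms in auto)
  then obtain g p where "\<forall>z\<in>sphere 0 1. \<bar>\<phi> z - g z\<bar> < e" "\<forall>z\<in>sphere 0 1. g z = Re (poly p z)"
    by (auto simp: T_def)
  then show thesis
    by (intro that[of "poly p"] poly_holomorphic_on[THEN holomorphic_on_subset]) (auto simp: holomorphic_intros)
qed

lemma space_circle_haar [simp]: "space circle_haar = sphere 0 1"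
  by (simp add: circle_haar_def space_restrict_space)

lemma sets_circle_haar [measurable_cong]: "sets circle_haar = sets (restrict_space borel (sphere 0 1))"
  by (simp add: circle_haar_def)

lemma cis_measurable_circle:
  "cis \<in> measurable (uniform_measure lborel {0..<2 * pi}) (restrict_space borel (sphere 0 1))"
proof (intro measurable_restrict_space2)
  have "cis \<in> borel_measurable borel"
    by (intro borel_measurable_continuous_onI continuous_intros)
  then show "cis \<in> borel_measurable (uniform_measure lborel {0..<2 * pi})"
    by (simp cong: measurable_cong_sets)
qed auto

lemma prob_space_circle_haar: "prob_space circle_haar"
  unfolding circle_haar_def
  by (intro prob_space.prob_space_distr prob_space_uniform_measure cis_measurable_circle) auto

lemma continuous_imp_measurable_circle_haar:
  fixes f :: "complex \<Rightarrow> 'a::{topological_space}"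
  assumes "continuous_on (sphere 0 1) f"
  shows "f \<in> borel_measurable circle_haar"
  using borel_measurable_continuous_on_restrict[OF assms]
  by (simp add: measurable_cong_sets[OF sets_circle_haar refl])

lemma integral_circle_haar:
  fixes f :: "complex \<Rightarrow> 'a::euclidean_space"
  assumes f: "continuous_on (sphere 0 1) f"
  shows "(\<integral>\<zeta>. f \<zeta> \<partial>circle_haar) = integral {0..2 * pi} (\<lambda>t. f (cis t)) /\<^sub>R (2 * pi)"
proof -
  have fc: "continuous_on A (\<lambda>t. f (cis t))" for A
    by (rule continuous_on_compose2[OF f]) (auto intro!: continuous_intros)
  have "(\<integral>\<zeta>. f \<zeta> \<partial>circle_haar) = (\<integral>t. f (cis t) \<partial>uniform_measure lborel {0..<2 * pi})"
    unfolding circle_haar_def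
    by (intro integral_distr cis_measurable_circle borel_measurable_continuous_on_restrict f)
  also have "uniform_measure lborel {0..<2 * pi} =
      density lborel (\<lambda>t. ennreal (indicator {0..<2 * pi} t / (2 * pi)))"
    unfolding uniform_measure_def
    by (intro arg_cong[where f="density lborel"] ext)
       (auto split: split_indicator simp: divide_ennreal simp flip: ennreal_1)
  also have "(\<integral>t. f (cis t) \<partial>\<dots>) = (\<integral>t. (indicator {0..<2 * pi} t / (2 * pi)) *\<^sub>R f (cis t) \<partial>lborel)"
    by (intro integral_density) (auto intro!: borel_measurable_continuous_onI fc)
  also have "\<dots> = (\<integral>t. indicator {0..<2 * pi} t *\<^sub>R f (cis t) \<partial>lborel) /\<^sub>R (2 * pi)"
  proof -
    have "(\<integral>t. (indicator {0..<2 * pi} t / (2 * pi)) *\<^sub>R f (cis t) \<partial>lborel) =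
        (\<integral>t. inverse (2 * pi) *\<^sub>R (indicator {0..<2 * pi} t *\<^sub>R f (cis t)) \<partial>lborel)"
      by (rule Bochner_Integration.integral_cong[OF refl])
         (simp only: divide_inverse scaleR_scaleR mult.commute)
    also have "\<dots> = inverse (2 * pi) *\<^sub>R (\<integral>t. indicator {0..<2 * pi} t *\<^sub>R f (cis t) \<partial>lborel)"
      by (rule integral_scaleR_right)
    finally show ?thesis .
  qed
  also have "(\<integral>t. indicator {0..<2 * pi} t *\<^sub>R f (cis t) \<partial>lborel) =
       (\<integral>t. indicator {0..2 * pi} t *\<^sub>R f (cis t) \<partial>lborel)"
  proof (rule integral_cong_AE)
    have *: "(\<lambda>t. f (cis t)) \<in> borel_measurable borel"
      by (intro borel_measurable_continuous_onI fc)
    show "(\<lambda>t. indicator {0..<2 * pi} t *\<^sub>R f (cis t)) \<in> borel_measurable lborel"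
       "(\<lambda>t. indicator {0..2 * pi} t *\<^sub>R f (cis t)) \<in> borel_measurable lborel"
      using * by measurable
    show "AE t in lborel. indicator {0..<2 * pi} t *\<^sub>R f (cis t) = indicator {0..2 * pi} t *\<^sub>R f (cis t)"
      using AE_lborel_singleton[of "2 * pi"] by eventually_elim (auto simp: indicator_def)
  qed
  also have "\<dots> = integral {0..2 * pi} (\<lambda>t. f (cis t))"
    using set_borel_integral_eq_integral(2)[OF borel_integrable_atLeastAtMost'[OF fc[of "{0..2 * pi}"]]]
    by (simp add: set_lebesgue_integral_def)
  finally show ?thesis .
qed

lemma integrable_circle_haar:
  fixes f :: "complex \<Rightarrow> 'a::euclidean_space"
  assumes f: "continuous_on (sphere 0 1) f"
  shows "integrable circle_haar f"
proof -
  interpret prob_space circle_haar by (rule prob_space_circle_haar)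
  have "compact (f ` sphere 0 1)" by (intro compact_continuous_image f) auto
  then obtain B where "\<forall>x\<in>f ` sphere 0 1. norm x \<le> B"
    using compact_imp_bounded bounded_iff by blast
  then show ?thesis
    by (intro integrable_const_bound[of _ B] AE_I2 continuous_imp_measurable_circle_haar f) auto
qed

lemma circle_mean_value:
  assumes h: "h holomorphic_on cball 0 1"
  shows "(\<integral>\<zeta>. h \<zeta> \<partial>circle_haar) = h 0"
proof -
  have "((\<lambda>u. h u / (u - 0)) has_contour_integral 2 * of_real pi * \<i> * h 0) (part_circlepath 0 1 0 (2 * pi))"
    using Cauchy_integral_circlepath_simple[OF h, of 0] by (simp add: circlepath_def)
  then have "((\<lambda>t. h (cis t) / cis t * \<i> * cis t) has_integral 2 * of_real pi * \<i> * h 0) {0..2 * pi}"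
    by (subst (asm) has_contour_integral_part_circlepath_iff) auto
  from has_integral_mult_right[OF this, of "-\<i>"]
  have "((\<lambda>t. h (cis t)) has_integral 2 * of_real pi * h 0) {0..2 * pi}"
    by (simp add: algebra_simps)
  then have I: "integral {0..2 * pi} (\<lambda>t. h (cis t)) = 2 * of_real pi * h 0"
    by (rule integral_unique)
  have "continuous_on (sphere 0 1) h"
    using h holomorphic_on_imp_continuous_on continuous_on_subset by (metis sphere_cball)
  from integral_circle_haar[OF this] show ?thesis
    unfolding I by (simp add: scaleR_conv_of_real)
qed

text \<open>Invariance is read off the mean value property of entire functions, whose real parts are dense.\<close>

lemma circle_haar_rotation:
  fixes \<phi> :: "complex \<Rightarrow> real"
  assumes \<phi>: "continuous_on (sphere 0 1) \<phi>" and c: "norm c = 1"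
  shows "(\<integral>\<zeta>. \<phi> (c * \<zeta>) \<partial>circle_haar) = (\<integral>\<zeta>. \<phi> \<zeta> \<partial>circle_haar)"
proof -
  interpret prob_space circle_haar by (rule prob_space_circle_haar)
  \<comment> \<open>By the mean value property every rotate of Re P has mean Re (P 0), so all
    rotates of \<phi> have means within e of one number.\<close>
  have near: "\<bar>(\<integral>\<zeta>. \<phi> (d * \<zeta>) \<partial>circle_haar) - Re (P 0)\<bar> \<le> e"
    if d: "norm d = 1" and e: "0 < e" and P: "P holomorphic_on UNIV" 
      and app: "\<And>z. z \<in> sphere 0 1 \<Longrightarrow> \<bar>\<phi> z - Re (P z)\<bar> < e" for d e P
  proof -
    have cP: "continuous_on A P" for A
      using P holomorphic_on_imp_continuous_on continuous_on_subset by blast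
    have ds: "(\<lambda>\<zeta>. d * \<zeta>) ` sphere 0 1 \<subseteq> sphere 0 1" using d by (auto simp: norm_mult)
    have i1: "integrable circle_haar (\<lambda>\<zeta>. \<phi> (d * \<zeta>))"
      by (intro integrable_circle_haar continuous_on_compose2[OF \<phi> _ ds] continuous_intros)
    have i2: "integrable circle_haar (\<lambda>\<zeta>. P (d * \<zeta>))"
      by (intro integrable_circle_haar continuous_on_compose2[OF cP _ ds] continuous_intros)
    have "(\<lambda>\<zeta>. P (d * \<zeta>)) holomorphic_on UNIV"
      using holomorphic_on_compose[of "\<lambda>\<zeta>. d * \<zeta>" UNIV P] P
      by (auto simp: o_def intro!: holomorphic_intros holomorphic_on_subset[OF P])
    then have "(\<integral>\<zeta>. P (d * \<zeta>) \<partial>circle_haar) = P 0"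
      by (subst circle_mean_value) (auto intro: holomorphic_on_subset)
    then have "Re (P 0) = (\<integral>\<zeta>. Re (P (d * \<zeta>)) \<partial>circle_haar)"
      using i2 by simp
    then have "(\<integral>\<zeta>. \<phi> (d * \<zeta>) \<partial>circle_haar) - Re (P 0) =
        (\<integral>\<zeta>. \<phi> (d * \<zeta>) - Re (P (d * \<zeta>)) \<partial>circle_haar)"
      using i1 i2 by simp
    also have "\<bar>\<dots>\<bar> \<le> (\<integral>\<zeta>. \<bar>\<phi> (d * \<zeta>) - Re (P (d * \<zeta>))\<bar> \<partial>circle_haar)"
      by (rule integral_abs_bound)
    also have "\<dots> \<le> (\<integral>\<zeta>. e \<partial>circle_haar)"
    proof (rule integral_mono)
      show "integrable circle_haar (\<lambda>\<zeta>. \<bar>\<phi> (d * \<zeta>) - Re (P (d * \<zeta>))\<bar>)"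
        using i1 i2 by simp
    qed (use app d in \<open>auto simp: norm_mult intro!: less_imp_le\<close>)
    finally show ?thesis using prob_space by simp
  qed
  have "\<bar>(\<integral>\<zeta>. \<phi> (c * \<zeta>) \<partial>circle_haar) - (\<integral>\<zeta>. \<phi> (1 * \<zeta>) \<partial>circle_haar)\<bar> \<le> e" if "0 < e" for e
  proof -
    obtain P where P: "P holomorphic_on UNIV" "\<And>z. z \<in> sphere 0 1 \<Longrightarrow> \<bar>\<phi> z - Re (P z)\<bar> < e / 2"
      using Re_entire_approximates_on_circle[OF \<phi>, of "e / 2"] \<open>0 < e\<close> by (metis half_gt_zero)
    show ?thesis
      using near[OF c half_gt_zero[OF \<open>0 < e\<close>] P] near[OF norm_one half_gt_zero[OF \<open>0 < e\<close>] P] by linarith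
  qed
  then have "\<bar>(\<integral>\<zeta>. \<phi> (c * \<zeta>) \<partial>circle_haar) - (\<integral>\<zeta>. \<phi> (1 * \<zeta>) \<partial>circle_haar)\<bar> \<le> 0"
    by (rule field_le_epsilon) simp
  then show ?thesis by simp
qed

section \<open>Outer majorants and the maximum principle\<close>

text \<open>The function approximated is the logarithm of \<open>\<phi> + e / 2\<close>: the shift
  keeps it continuous where \<phi> vanishes and leaves room on both sides.\<close>

lemma outer_majorant_on_circle:
  fixes \<phi> :: "complex \<Rightarrow> real"
  assumes \<phi>: "continuous_on (sphere 0 1) \<phi>" and nn: "\<And>z. z \<in> sphere 0 1 \<Longrightarrow> 0 \<le> \<phi> z"
    and e: "0 < e"
  obtains P where "P holomorphic_on UNIV"
    "\<And>z. z \<in> sphere 0 1 \<Longrightarrow> \<phi> z \<le> exp (Re (P z))"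
    "\<And>z. z \<in> sphere 0 1 \<Longrightarrow> exp (Re (P z)) \<le> \<phi> z + e"
proof -
  have "compact (\<phi> ` sphere 0 1)" by (intro compact_continuous_image \<phi>) auto
  then obtain B where B: "\<And>z. z \<in> sphere 0 1 \<Longrightarrow> \<bar>\<phi> z\<bar> \<le> B"
    using compact_imp_bounded bounded_iff by (metis imageI real_norm_def)
  have "B \<ge> 0" using B[of 1] by auto
  \<comment> \<open>\<open>ln q\<close> is the error allowed in the logarithm: since \<phi> \<le> B,
    both \<phi> q \<le> \<phi> + e/2 and (\<phi> + e/2) q \<le> \<phi> + e hold.\<close>
  define q where "q = (B + e) / (B + e / 2)"
  have q1: "1 < q" unfolding q_def using \<open>B \<ge> 0\<close> e by (simp add: field_simps)
  have "continuous_on (sphere 0 1) (\<lambda>z. ln (\<phi> z + e / 2))"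
    using nn e by (intro continuous_intros \<phi>) (force simp: add_nonneg_eq_0_iff)
  then obtain P where P: "P holomorphic_on UNIV"
    and app: "\<And>z. z \<in> sphere 0 1 \<Longrightarrow> \<bar>ln (\<phi> z + e / 2) - Re (P z)\<bar> < ln q"
    using Re_entire_approximates_on_circle[of _ "ln q"] q1 by (metis ln_gt_zero)
  show thesis
  proof (rule that[OF P])
    fix z :: complex assume z: "z \<in> sphere 0 1"
    have pos: "0 < \<phi> z + e / 2" using nn[OF z] e by simp
    have "\<phi> z \<le> B" using B[OF z] by simp
    then have gap': "0 \<le> (B - \<phi> z) * (e / 2)" and gap: "0 \<le> (B - \<phi> z) * (e / 2) + e * e / 4"
      using e by simp_all
    have l: "ln ((\<phi> z + e / 2) / q) \<le> Re (P z)" "Re (P z) \<le> ln ((\<phi> z + e / 2) * q)"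
      using app[OF z] pos q1 by (simp_all add: ln_div ln_mult)
    have "\<phi> z \<le> (\<phi> z + e / 2) / q"
    proof -
      have "\<phi> z * (B + e) \<le> (\<phi> z + e / 2) * (B + e / 2)"
        using gap by (simp add: field_simps)
      then show ?thesis using \<open>B \<ge> 0\<close> e unfolding q_def by (simp add: field_simps)
    qed
    also have "\<dots> = exp (ln ((\<phi> z + e / 2) / q))" using pos q1 by (subst exp_ln) auto
    also have "\<dots> \<le> exp (Re (P z))" using l by simp
    finally show "\<phi> z \<le> exp (Re (P z))" .
    have "exp (Re (P z)) \<le> exp (ln ((\<phi> z + e / 2) * q))" using l by simp
    also have "\<dots> = (\<phi> z + e / 2) * q" using pos q1 by (subst exp_ln) auto
    also have "\<dots> \<le> \<phi> z + e"
    proof -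
      have "(\<phi> z + e / 2) * (B + e) \<le> (\<phi> z + e) * (B + e / 2)"
        using gap' by (simp add: field_simps)
      then show ?thesis using \<open>B \<ge> 0\<close> e unfolding q_def by (simp add: field_simps)
    qed
    finally show "exp (Re (P z)) \<le> \<phi> z + e" .
  qed
qed

lemma norm_exp_powr: "norm (exp z) powr p = exp (p * Re z)"
  by (simp add: powr_def)

lemma norm_mult_exp_powr:
  assumes "0 < p"
  shows "norm (a * exp (- (z / of_real p))) powr p = norm a powr p * exp (- Re z)"
  using assms by (simp add: norm_mult powr_mult) (simp add: powr_def)

text \<open>No zeros are factored out, and every p > 0 is treated alike: if exp P is an outer
  majorant of |F|^p, then F exp(-P/p) is bounded by 1 on the circle, hence at 0. This gives |F(0)|^p
  \<le> |exp P(0)|, and the mean value property of exp P leads back to the circle.\<close>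

lemma norm_powr_submean:
  fixes F :: "complex \<Rightarrow> complex"
  assumes cont: "continuous_on (cball 0 1) F" and hol: "F holomorphic_on ball 0 1" and p: "0 < p"
  shows "norm (F 0) powr p \<le> (\<integral>\<zeta>. norm (F \<zeta>) powr p \<partial>circle_haar)"
proof (rule field_le_epsilon)
  fix e :: real assume e: "0 < e"
  interpret prob_space circle_haar by (rule prob_space_circle_haar)
  have c: "continuous_on (sphere 0 1) (\<lambda>\<zeta>. norm (F \<zeta>) powr p)"
    using p by (intro continuous_on_powr' continuous_intros continuous_on_subset[OF cont]) auto
  obtain P where P: "P holomorphic_on UNIV"
    and lo: "\<And>z. z \<in> sphere 0 1 \<Longrightarrow> norm (F z) powr p \<le> exp (Re (P z))"
    and up: "\<And>z. z \<in> sphere 0 1 \<Longrightarrow> exp (Re (P z)) \<le> norm (F z) powr p + e"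
    using outer_majorant_on_circle[OF c powr_ge_zero e] by metis
  have hP: "P holomorphic_on A" for A by (rule holomorphic_on_subset[OF P]) simp
  have cP: "continuous_on A P" for A by (rule holomorphic_on_imp_continuous_on[OF hP])
  define h where "h z = F z * exp (- (P z / of_real p))" for z
  have "norm (h 0) \<le> 1"
  proof (rule maximum_modulus_frontier[of h "cball 0 1"])
    show "h holomorphic_on interior (cball 0 1)"
      unfolding h_def using p by (auto intro!: holomorphic_intros hol hP)
    show "continuous_on (closure (cball 0 1)) h"
      unfolding h_def using p by (auto intro!: continuous_intros cont cP)
    show "norm (h z) \<le> 1" if "z \<in> frontier (cball 0 1)" for z
    proof -
      have z: "z \<in> sphere 0 1" using that by simp
      have "norm (h z) powr p \<le> exp (Re (P z)) * exp (- Re (P z))"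
        unfolding h_def norm_mult_exp_powr[OF p] using lo[OF z] by simp
      also have "\<dots> = 1 powr p" by (simp flip: exp_add)
      finally show ?thesis using p powr_less_mono2[of p 1 "norm (h z)"] by (meson linorder_not_less zero_le_one)
    qed
  qed auto
  then have "norm (h 0) powr p \<le> 1" using p powr_mono2[of p "norm (h 0)" 1] by simp
  then have "norm (F 0) powr p * exp (- Re (P 0)) \<le> 1"
    unfolding h_def norm_mult_exp_powr[OF p] .
  then have "norm (F 0) powr p \<le> exp (Re (P 0))" by (simp add: exp_minus field_simps)
  also have "\<dots> = norm (exp (P 0))" by simp
  also have "exp (P 0) = (\<integral>\<zeta>. exp (P \<zeta>) \<partial>circle_haar)"
    by (rule circle_mean_value[symmetric]) (intro holomorphic_intros hP)
  also have "norm \<dots> \<le> (\<integral>\<zeta>. norm (exp (P \<zeta>)) \<partial>circle_haar)"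
    by (rule integral_norm_bound)
  also have "\<dots> \<le> (\<integral>\<zeta>. norm (F \<zeta>) powr p + e \<partial>circle_haar)"
    using up by (intro integral_mono integrable_circle_haar continuous_intros cP c) auto
  also have "\<dots> = (\<integral>\<zeta>. norm (F \<zeta>) powr p \<partial>circle_haar) + e"
    using integrable_circle_haar[OF c] prob_space by simp
  finally show "norm (F 0) powr p \<le> (\<integral>\<zeta>. norm (F \<zeta>) powr p \<partial>circle_haar) + e" .
qed

lemma continuous_on_integral_norm_powr:
  fixes F :: "complex \<Rightarrow> 'x \<Rightarrow> complex"
  assumes "finite_measure M" and p: "0 < p"
    and meas: "\<And>w. w \<in> S \<Longrightarrow> F w \<in> borel_measurable M"
    and cont: "\<And>x. x \<in> space M \<Longrightarrow> continuous_on S (\<lambda>w. F w x)"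
    and bound: "\<And>w x. w \<in> S \<Longrightarrow> x \<in> space M \<Longrightarrow> norm (F w x) \<le> C"
  shows "continuous_on S (\<lambda>w. \<integral>x. norm (F w x) powr p \<partial>M)"
proof -
  interpret finite_measure M by fact
  show ?thesis
    unfolding continuous_on_sequentially comp_def
  proof (intro allI ballI impI, elim conjE)
    fix s a assume a: "a \<in> S" and s: "\<forall>n. s n \<in> S" and lim: "s \<longlonglongrightarrow> a"
    show "(\<lambda>n. \<integral>x. norm (F (s n) x) powr p \<partial>M) \<longlonglongrightarrow> (\<integral>x. norm (F a x) powr p \<partial>M)"
    proof (rule integral_dominated_convergence[where w="\<lambda>_. C powr p"])
      show "AE x in M. (\<lambda>n. norm (F (s n) x) powr p) \<longlonglongrightarrow> norm (F a x) powr p"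
      proof (rule AE_I2)
        fix x assume "x \<in> space M"
        have "(\<lambda>n. F (s n) x) \<longlonglongrightarrow> F a x"
          using continuous_on_tendsto_compose[OF cont[OF \<open>x \<in> space M\<close>] lim a] s by simp
        then show "(\<lambda>n. norm (F (s n) x) powr p) \<longlonglongrightarrow> norm (F a x) powr p"
          using p by (intro tendsto_powr2 tendsto_norm tendsto_const) auto
      qed
      show "AE x in M. norm (norm (F (s n) x) powr p) \<le> C powr p" for n
        using bound s p by (intro AE_I2) (auto intro!: powr_mono2)
    qed (use meas a s in \<open>auto intro!: borel_measurable_norm\<close>)
  qed
qed

text \<open>A circle internally tangent to the unit circle carries a boundary value to an interior maximum.\<close>

lemma integral_norm_powr_max_principle:
  fixes F :: "complex \<Rightarrow> 'x \<Rightarrow> complex"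
  assumes "finite_measure M" and p: "0 < p"
    and meas[measurable]: "case_prod F \<in> borel_measurable (borel \<Otimes>\<^sub>M M)"
    and cont: "\<And>x. x \<in> space M \<Longrightarrow> continuous_on (cball 0 1) (\<lambda>w. F w x)"
    and hol: "\<And>x. x \<in> space M \<Longrightarrow> (\<lambda>w. F w x) holomorphic_on ball 0 1"
    and bound: "\<And>w x. w \<in> cball 0 1 \<Longrightarrow> x \<in> space M \<Longrightarrow> norm (F w x) \<le> C"
    and bdry: "\<And>w. w \<in> sphere 0 1 \<Longrightarrow> (\<integral>x. norm (F w x) powr p \<partial>M) \<le> B"
    and w: "w \<in> cball 0 1"
  shows "(\<integral>x. norm (F w x) powr p \<partial>M) \<le> B"
proof -
  interpret M: finite_measure M by fact
  interpret T: prob_space circle_haar by (rule prob_space_circle_haar)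
  interpret P: pair_sigma_finite circle_haar M ..
  have Fw[measurable]: "F w \<in> borel_measurable M" for w
  proof -
    have "(\<lambda>x. case_prod F (w, x)) \<in> borel_measurable M" by measurable
    then show ?thesis by simp
  qed
  define v where "v w = (\<integral>x. norm (F w x) powr p \<partial>M)" for w
  have vc: "continuous_on (cball 0 1) v"
    unfolding v_def by (rule continuous_on_integral_norm_powr[OF \<open>finite_measure M\<close> p Fw cont bound])
  obtain a where a: "a \<in> cball 0 1" and mx: "\<And>w. w \<in> cball 0 1 \<Longrightarrow> v w \<le> v a"
    using continuous_attains_sup[OF _ _ vc] by auto
  have "v a \<le> B"
  proof (cases "norm a = 1")
    case True
    then show ?thesis using bdry[of a] by (simp add: v_def)
  next
    case False
    define r where "r = 1 - norm a"
    have r: "0 < r" using a False by (simp add: r_def)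
    have inb: "a + of_real r * \<zeta> \<in> cball 0 1" if "\<zeta> \<in> cball 0 1" for \<zeta>
    proof -
      have "norm (a + of_real r * \<zeta>) \<le> norm a + r * norm \<zeta>"
        using norm_triangle_ineq[of a "of_real r * \<zeta>"] r by (simp add: norm_mult)
      also have "\<dots> \<le> norm a + r * 1"
        using r that by (intro add_left_mono mult_left_mono) auto
      finally show ?thesis by (simp add: r_def)
    qed
    have inb': "a + of_real r * \<zeta> \<in> ball 0 1" if "\<zeta> \<in> ball 0 1" for \<zeta>
    proof -
      have "norm (a + of_real r * \<zeta>) \<le> norm a + r * norm \<zeta>"
        using norm_triangle_ineq[of a "of_real r * \<zeta>"] r by (simp add: norm_mult)
      also have "\<dots> < norm a + r * 1"
        using r that by (intro add_strict_left_mono mult_strict_left_mono) auto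
      finally show ?thesis by (simp add: r_def)
    qed
    have vrc: "continuous_on (sphere 0 1) (\<lambda>\<zeta>. v (a + of_real r * \<zeta>))"
      by (rule continuous_on_compose2[OF vc]) (use inb in \<open>auto intro!: continuous_intros\<close>)
    have int: "integrable M (\<lambda>x. norm (F w x) powr p)" if "w \<in> cball 0 1" for w
      using bound[OF that] p
      by (intro M.integrable_const_bound[of _ "C powr p"] AE_I2) (auto intro!: powr_mono2)
    have idm: "(\<lambda>w. w) \<in> measurable circle_haar borel"
      by (intro continuous_imp_measurable_circle_haar continuous_intros)
    have "finite_measure (circle_haar \<Otimes>\<^sub>M M)"
      by (intro finite_measure_pair_measure T.finite_measure_axioms M.finite_measure_axioms)
    then interpret PF: finite_measure "circle_haar \<Otimes>\<^sub>M M" .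
    have [measurable]: "(\<lambda>(\<zeta>, x). F (a + of_real r * \<zeta>) x) \<in> borel_measurable (circle_haar \<Otimes>\<^sub>M M)"
    proof -
      have "(\<lambda>y. (a + of_real r * fst y, snd y)) \<in> measurable (circle_haar \<Otimes>\<^sub>M M) (borel \<Otimes>\<^sub>M M)"
        using measurable_compose[OF measurable_fst idm] by measurable
      from measurable_compose[OF this meas] show ?thesis by (simp add: case_prod_beta')
    qed
    have ip: "integrable (circle_haar \<Otimes>\<^sub>M M) (\<lambda>(\<zeta>, x). norm (F (a + of_real r * \<zeta>) x) powr p)"
    proof (rule PF.integrable_const_bound[of _ "C powr p"])
      show "AE y in circle_haar \<Otimes>\<^sub>M M. norm (case y of (\<zeta>, x) \<Rightarrow> norm (F (a + of_real r * \<zeta>) x) powr p) \<le> C powr p"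
      proof (rule AE_I2)
        fix y assume y: "y \<in> space (circle_haar \<Otimes>\<^sub>M M)"
        have "norm (F (a + of_real r * fst y) (snd y)) \<le> C"
          using y by (intro bound inb) (auto simp: space_pair_measure)
        then show "norm (case y of (\<zeta>, x) \<Rightarrow> norm (F (a + of_real r * \<zeta>) x) powr p) \<le> C powr p"
          using p by (auto simp: case_prod_beta' intro!: powr_mono2)
      qed
    qed measurable
    \<comment> \<open>The submean property for each \<open>x\<close> is integrated over
      \<open>M\<close>; Fubini's theorem turns it into the submean property of
      \<open>v\<close>.\<close>
    have "v a \<le> (\<integral>x. (\<integral>\<zeta>. norm (F (a + of_real r * \<zeta>) x) powr p \<partial>circle_haar) \<partial>M)"
      unfolding v_def
    proof (rule integral_mono)
      show "integrable M (\<lambda>x. norm (F a x) powr p)" using int a by simp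
      show "integrable M (\<lambda>x. \<integral>\<zeta>. norm (F (a + of_real r * \<zeta>) x) powr p \<partial>circle_haar)"
        using P.integrable_snd[of "\<lambda>\<zeta> x. norm (F (a + of_real r * \<zeta>) x) powr p"] ip by simp
      fix x assume x: "x \<in> space M"
      have "(\<lambda>\<zeta>. a + of_real r * \<zeta>) ` ball 0 1 \<subseteq> ball 0 1" using inb' by auto
      then have "(\<lambda>\<zeta>. F (a + of_real r * \<zeta>) x) holomorphic_on ball 0 1"
        using holomorphic_on_compose_gen[OF _ hol[OF x], of "\<lambda>\<zeta>. a + of_real r * \<zeta>" "ball 0 1"]
        by (simp add: o_def holomorphic_intros)
      moreover have "continuous_on (cball 0 1) (\<lambda>\<zeta>. F (a + of_real r * \<zeta>) x)"
        by (rule continuous_on_compose2[OF cont[OF x]]) (use inb in \<open>auto intro!: continuous_intros\<close>)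
      ultimately show "norm (F a x) powr p \<le> (\<integral>\<zeta>. norm (F (a + of_real r * \<zeta>) x) powr p \<partial>circle_haar)"
        using norm_powr_submean[of "\<lambda>\<zeta>. F (a + of_real r * \<zeta>) x" p] p by simp
    qed
    also have "\<dots> = (\<integral>\<zeta>. v (a + of_real r * \<zeta>) \<partial>circle_haar)"
      unfolding v_def by (rule P.Fubini_integral[OF ip])
    finally have mean: "v a \<le> (\<integral>\<zeta>. v (a + of_real r * \<zeta>) \<partial>circle_haar)" .
    \<comment> \<open>\<open>g\<close> is continuous and nonnegative on the circle with mean at most
      0, so it vanishes identically; at the point of tangency this equates \<open>v a\<close> with a
      boundary value of \<open>v\<close>.\<close>
    define g where "g \<zeta> = v a - v (a + of_real r * \<zeta>)" for \<zeta>
    have gc: "continuous_on (sphere 0 1) g" unfolding g_def by (intro continuous_intros vrc)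
    have g0: "0 \<le> g \<zeta>" if "\<zeta> \<in> sphere 0 1" for \<zeta>
      using mx[OF inb, of \<zeta>] that by (simp add: g_def)
    have "(\<integral>\<zeta>. g \<zeta> \<partial>circle_haar) \<le> 0"
      unfolding g_def using mean integrable_circle_haar[OF vrc] T.prob_space by simp
    then have le: "integral {0..2 * pi} (\<lambda>t. g (cis t)) \<le> 0"
      using pi_gt_zero unfolding integral_circle_haar[OF gc] by (auto simp: mult_le_0_iff zero_le_mult_iff)
    have gcc: "continuous_on {0..2 * pi} (\<lambda>t. g (cis t))"
      by (rule continuous_on_compose2[OF gc]) (auto intro!: continuous_intros)
    have "integral {0..2 * pi} (\<lambda>t. g (cis t)) = 0"
      using le Henstock_Kurzweil_Integration.integral_nonneg[OF integrable_continuous_real[OF gcc]] g0 by force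
    then have z: "g (cis t) = 0" if "t \<in> {0..2 * pi}" for t
      using integral_eq_0_iff[OF gcc] g0 that by auto
    obtain t where t: "0 \<le> t" "t < 2 * pi" "a = of_real (norm a) * cis t"
    proof (cases "a = 0")
      case True
      then show thesis using that[of 0] by auto
    next
      case False
      then show thesis using that[of "Arg2pi a"] Arg2pi[of a] by (simp add: is_Arg_def cis_conv_exp)
    qed
    have "a + of_real r * cis t = cis t"
      using t(3) by (simp add: r_def algebra_simps)
    then have "v a = v (cis t)" using z[of t] t by (simp add: g_def)
    then show ?thesis using bdry[of "cis t"] by (simp add: v_def)
  qed
  then show ?thesis using mx[OF w] by (simp add: v_def)
qed

text \<open>The factor exp(-P/p) is holomorphic in \<open>w\<close> and independent of
  \<open>x\<close>, so it can be absorbed into \<open>F\<close>, and the maximum principle with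
  bound 1 applies. This is log-subharmonicity of the mean, in the form used later.\<close>

lemma integral_norm_powr_majorant:
  fixes F :: "complex \<Rightarrow> 'x \<Rightarrow> complex"
  assumes fin: "finite_measure M" and p: "0 < p"
    and meas[measurable]: "case_prod F \<in> borel_measurable (borel \<Otimes>\<^sub>M M)"
    and cont: "\<And>x. x \<in> space M \<Longrightarrow> continuous_on (cball 0 1) (\<lambda>w. F w x)"
    and hol: "\<And>x. x \<in> space M \<Longrightarrow> (\<lambda>w. F w x) holomorphic_on ball 0 1"
    and bound: "\<And>w x. w \<in> cball 0 1 \<Longrightarrow> x \<in> space M \<Longrightarrow> norm (F w x) \<le> C"
    and P: "P holomorphic_on UNIV"
    and bdry: "\<And>w. w \<in> sphere 0 1 \<Longrightarrow> (\<integral>x. norm (F w x) powr p \<partial>M) \<le> exp (Re (P w))"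
    and w: "w \<in> cball 0 1"
  shows "(\<integral>x. norm (F w x) powr p \<partial>M) \<le> exp (Re (P w))"
proof -
  have hP: "P holomorphic_on A" for A by (rule holomorphic_on_subset[OF P]) simp
  have cP: "continuous_on A P" for A by (rule holomorphic_on_imp_continuous_on[OF hP])
  have [measurable]: "P \<in> borel_measurable borel"
    by (intro borel_measurable_continuous_onI cP)
  have cE: "continuous_on A (\<lambda>w. exp (- (P w / of_real p)))" for A
    using p by (intro continuous_intros cP) auto
  obtain D where D: "\<And>w. w \<in> cball 0 1 \<Longrightarrow> norm (exp (- (P w / of_real p))) \<le> D"
    using continuous_on_compact_bound[OF compact_cball cE] by metis
  have eq: "(\<integral>x. norm (F w x * exp (- (P w / of_real p))) powr p \<partial>M) =
      (\<integral>x. norm (F w x) powr p \<partial>M) * exp (- Re (P w))" for w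
    unfolding norm_mult_exp_powr[OF p] by simp
  have "(\<integral>x. norm (F w x * exp (- (P w / of_real p))) powr p \<partial>M) \<le> 1"
  proof (rule integral_norm_powr_max_principle[OF fin p, where F="\<lambda>w x. F w x * exp (- (P w / of_real p))" and C="C * D"])
    show "(\<lambda>(w, x). F w x * exp (- (P w / of_real p))) \<in> borel_measurable (borel \<Otimes>\<^sub>M M)"
      by measurable
    show "continuous_on (cball 0 1) (\<lambda>w. F w x * exp (- (P w / of_real p)))" if "x \<in> space M" for x
      by (intro continuous_on_mult cont cE that)
    show "(\<lambda>w. F w x * exp (- (P w / of_real p))) holomorphic_on ball 0 1" if "x \<in> space M" for x
      using p by (intro holomorphic_intros hol hP that) auto
    show "norm (F w x * exp (- (P w / of_real p))) \<le> C * D" if "w \<in> cball 0 1" "x \<in> space M" for w x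
      unfolding norm_mult using bound[OF that] D[OF that(1)]
      by (intro mult_mono) (auto intro: order_trans[OF norm_ge_zero])
    show "(\<integral>x. norm (F w x * exp (- (P w / of_real p))) powr p \<partial>M) \<le> 1" if "w \<in> sphere 0 1" for w
      unfolding eq using bdry[OF that] by (simp add: exp_minus field_simps)
  qed (rule w)
  then show ?thesis unfolding eq by (simp add: exp_minus field_simps)
qed

text \<open>The mean of \<open>exp (P (w * \<zeta>))\<close> over \<zeta> is constant for
  \<open>w\<close> on the unit circle by rotation invariance, so the maximum principle with \<zeta>
  as the parameter gives the bound at \<open>w = r\<close>.\<close>

lemma circle_mean_exp_Re_mono:
  assumes P: "P holomorphic_on UNIV" and r: "0 \<le> r" "r \<le> 1"
  shows "(\<integral>\<zeta>. exp (Re (P (of_real r * \<zeta>))) \<partial>circle_haar) \<le> (\<integral>\<zeta>. exp (Re (P \<zeta>)) \<partial>circle_haar)"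
proof -
  interpret T: prob_space circle_haar by (rule prob_space_circle_haar)
  have hP: "P holomorphic_on A" for A by (rule holomorphic_on_subset[OF P]) simp
  have cP: "continuous_on A P" for A by (rule holomorphic_on_imp_continuous_on[OF hP])
  have [measurable]: "P \<in> borel_measurable borel"
    by (intro borel_measurable_continuous_onI cP)
  have idm[measurable]: "(\<lambda>w. w) \<in> measurable circle_haar borel"
    by (intro continuous_imp_measurable_circle_haar continuous_intros)
  obtain D where D: "\<And>w. w \<in> cball 0 1 \<Longrightarrow> norm (exp (P w)) \<le> D"
    using continuous_on_compact_bound[OF compact_cball continuous_on_exp[OF cP]] by metis
  have eq: "exp (Re (P w)) = norm (exp (P w)) powr 1" for w by simp
  show ?thesis
    unfolding eq
  proof (rule integral_norm_powr_max_principle[OF T.finite_measure_axioms, where F="\<lambda>w \<zeta>. exp (P (w * \<zeta>))" and C=D])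
    have "(\<lambda>y. fst y * snd y) \<in> borel_measurable (borel \<Otimes>\<^sub>M circle_haar)"
      using measurable_compose[OF measurable_snd idm] by measurable
    then show "(\<lambda>(w, \<zeta>). exp (P (w * \<zeta>))) \<in> borel_measurable (borel \<Otimes>\<^sub>M circle_haar)"
      unfolding case_prod_beta' by measurable
    show "continuous_on (cball 0 1) (\<lambda>w. exp (P (w * \<zeta>)))" for \<zeta>
      by (intro continuous_intros continuous_on_compose2[OF cP[of UNIV]]) auto
    have "(\<lambda>w. P (w * \<zeta>)) holomorphic_on UNIV" for \<zeta>
      using holomorphic_on_compose[OF _ hP, of "\<lambda>w. w * \<zeta>" UNIV]
      by (simp add: o_def holomorphic_intros)
    then show "(\<lambda>w. exp (P (w * \<zeta>))) holomorphic_on ball 0 1" for \<zeta>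
      by (intro holomorphic_intros) (auto intro: holomorphic_on_subset)
    show "norm (exp (P (w * \<zeta>))) \<le> D" if "w \<in> cball 0 1" "\<zeta> \<in> space circle_haar" for w \<zeta>
      using that by (intro D) (auto simp: norm_mult)
    show "(\<integral>\<zeta>. norm (exp (P (w * \<zeta>))) powr 1 \<partial>circle_haar) \<le> (\<integral>\<zeta>. norm (exp (P \<zeta>)) powr 1 \<partial>circle_haar)"
      if "w \<in> sphere 0 1" for w
      using that
      by (intro eq_refl circle_haar_rotation[where \<phi>="\<lambda>\<zeta>. norm (exp (P \<zeta>)) powr 1"])
         (auto intro!: continuous_intros cP)
  qed (use r in auto)
qed

section \<open>The inequality in one variable\<close>

lemma nonneg_orthant_iff [simp]: "(\<chi> j. x j) \<in> nonneg_orthant \<longleftrightarrow> (\<forall>j. 0 \<le> x j)"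
  by (simp add: nonneg_orthant_def)

lemma admissible_nonneg: "admissible \<Phi> \<Longrightarrow> (\<And>j. 0 \<le> x j) \<Longrightarrow> 0 \<le> \<Phi> (\<chi> j. x j)"
  by (auto simp: admissible_def)

lemma admissible_zero:
  assumes "admissible \<Phi>" and "\<And>j. 0 \<le> x j" and "x k = 0"
  shows "\<Phi> (\<chi> j. x j) = 0"
proof -
  have "(\<chi> j. x j) \<in> nonneg_orthant" "(\<chi> j. x j) $ k = 0" using assms by simp_all
  then show ?thesis using assms(1) unfolding admissible_def by blast
qed

lemma admissible_update_less:
  assumes "admissible \<Phi>" and "\<And>i. i \<noteq> k \<Longrightarrow> 0 < x i" and "0 \<le> x k" and "x k < t"
  shows "\<Phi> (\<chi> j. x j) < \<Phi> (\<chi> j. (x(k := t)) j)"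
proof -
  have "\<forall>x j. (\<forall>i. i \<noteq> j \<longrightarrow> 0 < x $ i) \<longrightarrow>
      strict_mono_on {0..} (\<lambda>t. \<Phi> (\<chi> i. if i = j then t else x $ i))"
    using assms(1) by (simp add: admissible_def)
  from this[rule_format, of k "\<chi> j. x j"]
  have "strict_mono_on {0..} (\<lambda>t. \<Phi> (\<chi> i. if i = k then t else x i))"
    using assms(2) unfolding vec_lambda_beta by simp
  then have "\<Phi> (\<chi> i. if i = k then x k else x i) < \<Phi> (\<chi> i. if i = k then t else x i)"
    using assms by (simp add: strict_mono_on_def)
  moreover have "(\<lambda>i. if i = k then x k else x i) = x" by auto
  moreover have "(\<lambda>i. if i = k then t else x i) = x(k := t)" by auto
  ultimately show ?thesis by simp
qed

text \<open>Coordinates are raised one at a time; all intermediate vectors stay positive, as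
  separate monotonicity requires.\<close>

lemma admissible_mono_pos:
  fixes x y :: "'m::finite \<Rightarrow> real"
  assumes \<Phi>: "admissible \<Phi>" and x: "\<And>j. 0 < x j" and xy: "\<And>j. x j \<le> y j"
  shows "\<Phi> (\<chi> j. x j) \<le> \<Phi> (\<chi> j. y j)"
proof -
  have "\<Phi> (\<chi> j. x j) \<le> \<Phi> (\<chi> j. if j \<in> A then y j else x j)" if "finite A" for A
    using that
  proof induction
    case (insert k A)
    let ?z = "\<lambda>j. if j \<in> A then y j else x j"
    have upd: "(\<lambda>j. if j \<in> insert k A then y j else x j) = ?z(k := y k)" by auto
    have z: "0 < ?z j" for j using x xy by (auto intro: less_le_trans)
    have "\<Phi> (\<chi> j. ?z j) \<le> \<Phi> (\<chi> j. (?z(k := y k)) j)"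
    proof (cases "x k = y k")
      case True
      then have "?z(k := y k) = ?z" by auto
      then show ?thesis by simp
    next
      case False
      then have "?z k < y k" using insert.hyps xy[of k] by simp
      then show ?thesis using admissible_update_less[OF \<Phi>, of k ?z "y k"] z by (simp add: less_imp_le)
    qed
    then show ?case using insert.IH unfolding upd by linarith
  qed simp
  from this[of UNIV] show ?thesis by simp
qed

text \<open>A zero coordinate makes the left-hand value 0, which leaves only positive vectors for
  the coordinatewise argument.\<close>

lemma admissible_mono:
  fixes x y :: "'m::finite \<Rightarrow> real"
  assumes \<Phi>: "admissible \<Phi>" and x: "\<And>j. 0 \<le> x j" and xy: "\<And>j. x j \<le> y j"
  shows "\<Phi> (\<chi> j. x j) \<le> \<Phi> (\<chi> j. y j)"
proof (cases "\<exists>k. x k = 0")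
  case True
  then obtain k where "x k = 0" by blast
  have "0 \<le> \<Phi> (\<chi> j. y j)" by (rule admissible_nonneg[OF \<Phi>]) (use x xy order_trans in blast)
  then show ?thesis using admissible_zero[of \<Phi> x k] \<Phi> x \<open>x k = 0\<close> by simp
next
  case False
  then show ?thesis using x by (intro admissible_mono_pos \<Phi> xy) (metis order_le_less)
qed

lemma admissible_strict_mono:
  fixes x y :: "'m::finite \<Rightarrow> real"
  assumes \<Phi>: "admissible \<Phi>" and x: "\<And>j. 0 < x j" and xy: "\<And>j. x j \<le> y j" and k: "x k < y k"
  shows "\<Phi> (\<chi> j. x j) < \<Phi> (\<chi> j. y j)"
proof -
  have "\<Phi> (\<chi> j. x j) < \<Phi> (\<chi> j. (x(k := y k)) j)"
    using x k by (intro admissible_update_less \<Phi>) (auto intro: less_imp_le)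
  also have "\<dots> \<le> \<Phi> (\<chi> j. y j)"
    using x xy k less_le_trans[OF x[of k] xy[of k]] by (intro admissible_mono_pos \<Phi>) auto
  finally show ?thesis .
qed

lemma admissible_tendsto:
  fixes x :: "'m::finite \<Rightarrow> real"
  assumes \<Phi>: "admissible \<Phi>" and lim: "\<And>j. ((\<lambda>n. s n j) \<longlongrightarrow> x j) F"
    and s: "\<And>n j. 0 \<le> s n j" and x: "\<And>j. 0 \<le> x j"
  shows "((\<lambda>n. \<Phi> (\<chi> j. s n j)) \<longlongrightarrow> \<Phi> (\<chi> j. x j)) F"
proof (rule continuous_on_tendsto_compose[of nonneg_orthant \<Phi>])
  show "continuous_on nonneg_orthant \<Phi>" using \<Phi> by (simp add: admissible_def)
  show "((\<lambda>n. \<chi> j. s n j) \<longlongrightarrow> (\<chi> j. x j)) F"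
    by (intro vec_tendstoI) (simp add: lim)
qed (use s x in auto)

lemma admissible_continuous_on:
  fixes g :: "'m::finite \<Rightarrow> 'a::topological_space \<Rightarrow> real"
  assumes \<Phi>: "admissible \<Phi>" and g: "\<And>j. continuous_on S (g j)" "\<And>j x. x \<in> S \<Longrightarrow> 0 \<le> g j x"
  shows "continuous_on S (\<lambda>x. \<Phi> (\<chi> j. g j x))"
  by (rule continuous_on_compose2[of nonneg_orthant \<Phi>])
     (use \<Phi> g in \<open>auto simp: admissible_def intro!: continuous_intros\<close>)

text \<open>\<Phi> is controlled only on the orthant; composition with \<open>max 0\<close> in each
  coordinate is continuous on the whole space and agrees with it there.\<close>

lemma admissible_measurable:
  fixes g :: "'m::finite \<Rightarrow> 'a \<Rightarrow> real"
  assumes \<Phi>: "admissible \<Phi>" and g: "\<And>j. g j \<in> borel_measurable M"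
    and nn: "\<And>j x. x \<in> space M \<Longrightarrow> 0 \<le> g j x"
  shows "(\<lambda>x. \<Phi> (\<chi> j. g j x)) \<in> borel_measurable M"
proof -
  have vec: "(\<lambda>x. \<chi> j. max 0 (g j x)) \<in> borel_measurable M"
  proof -
    have "(\<lambda>x. \<chi> j. max 0 (g j x)) = (\<lambda>x. \<Sum>j\<in>UNIV. max 0 (g j x) *\<^sub>R axis j (1::real))"
      by (rule ext) (simp add: vec_eq_iff axis_def if_distrib cong: if_cong)
    also have "\<dots> \<in> borel_measurable M"
      using g by measurable
    finally show ?thesis .
  qed
  have "continuous_on UNIV (\<lambda>v. \<Phi> (\<chi> j. max 0 (v $ j)))"
    by (intro admissible_continuous_on[OF \<Phi>] continuous_intros) auto
  then have "(\<lambda>v. \<Phi> (\<chi> j. max 0 (v $ j))) \<in> borel_measurable borel"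
    by (rule borel_measurable_continuous_onI)
  from measurable_compose[OF vec this]
  have "(\<lambda>x. \<Phi> (\<chi> j. max 0 (g j x))) \<in> borel_measurable M"
    by (simp only: vec_lambda_beta max.left_idem)
  also have "?this \<longleftrightarrow> ?thesis"
  proof (rule measurable_cong)
    fix x assume "x \<in> space M"
    then have "(\<lambda>j. max 0 (g j x)) = (\<lambda>j. g j x)" using nn by (auto simp: max_def)
    then show "\<Phi> (\<chi> j. max 0 (g j x)) = \<Phi> (\<chi> j. g j x)" by simp
  qed
  finally show ?thesis .
qed

section \<open>Weighted measures on the disc\<close>

lemma space_weighted: "weighted_measure \<mu> \<Longrightarrow> space \<mu> = ball 0 1"
  by (auto simp: weighted_measure_def space_restrict_space)

lemma sets_weighted: "weighted_measure \<mu> \<Longrightarrow> sets \<mu> = sets (restrict_space borel (ball 0 1))"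
  by (auto simp: weighted_measure_def sets_restrict_space)

lemma sigma_finite_weighted:
  assumes "weighted_measure \<mu>"
  shows "sigma_finite_measure \<mu>"
proof -
  obtain g where g: "g \<in> borel_measurable (restrict_space borel (ball 0 1))"
    "\<mu> = density (restrict_space lborel (ball 0 1)) (\<lambda>z. ennreal (g z))"
    using assms by (auto simp: weighted_measure_def)
  interpret R: sigma_finite_measure "restrict_space lborel (ball (0::complex) 1)"
    by (rule sigma_finite_measure_restrict_space) (auto intro: lborel.sigma_finite_measure_axioms)
  have gm: "(\<lambda>z. ennreal (g z)) \<in> borel_measurable (restrict_space lborel (ball 0 1))"
    using g(1) by (intro measurable_compose[OF _ measurable_ennreal])
       (simp add: measurable_def space_restrict_space sets_restrict_space)
  show ?thesis
    unfolding g(2) by (subst R.sigma_finite_iff_density_finite'[OF gm]) auto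
qed

text \<open>Positivity of the density enters here. It lets a statement that holds almost everywhere
  be tested at some point of any nonempty open set.\<close>

lemma weighted_open_pos:
  assumes \<mu>: "weighted_measure \<mu>" and V: "open V" "V \<subseteq> ball 0 1" "V \<noteq> {}"
  shows "V \<in> sets \<mu>" "0 < emeasure \<mu> V"
proof -
  obtain g where g: "g \<in> borel_measurable (restrict_space borel (ball 0 1))"
    "\<And>z. z \<in> ball 0 1 \<Longrightarrow> 0 < g z"
    "\<mu> = density (restrict_space lborel (ball 0 1)) (\<lambda>z. ennreal (g z))"
    using \<mu> by (auto simp: weighted_measure_def)
  let ?R = "restrict_space lborel (ball (0::complex) 1)"
  have gm: "(\<lambda>z. ennreal (g z)) \<in> borel_measurable ?R"
    using g(1) by (intro measurable_compose[OF _ measurable_ennreal])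
       (simp add: measurable_def space_restrict_space sets_restrict_space)
  have VR: "V \<in> sets ?R" using V by (auto simp: sets_restrict_space_iff)
  then show Vs: "V \<in> sets \<mu>" by (simp add: g(3))
  have "emeasure \<mu> V \<noteq> 0"
  proof
    assume "emeasure \<mu> V = 0"
    then have "V \<in> null_sets \<mu>" using Vs by auto
    then have "AE z in ?R. z \<in> V \<longrightarrow> ennreal (g z) = 0"
      unfolding g(3) null_sets_density_iff[OF gm] by simp
    moreover have "AE z in ?R. z \<in> ball 0 1" by (rule AE_I2) (simp add: space_restrict_space)
    ultimately have "AE z in ?R. z \<notin> V"
      by eventually_elim (use g(2) in \<open>force simp: ennreal_eq_0_iff\<close>)
    then have "emeasure ?R V = 0"
      using AE_iff_null_sets[OF VR] by auto
    then have "emeasure lborel V = 0"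
      using V by (subst (asm) emeasure_restrict_space) auto
    then have "negligible V" using V(1)
      by (simp add: negligible_iff_null_sets null_sets_def)
    then show False using V open_not_negligible by blast
  qed
  then show "0 < emeasure \<mu> V" by (simp add: zero_less_iff_neq_zero)
qed

section \<open>Zero-free test functions and the one-variable inequality\<close>

lemma norm_exp_divide_powr: "0 < p \<Longrightarrow> norm (exp (z / of_real p)) powr p = exp (Re z)"
  by (simp add: powr_def)

lemma torus_haar_1_integral:
  fixes h :: "complex \<Rightarrow> real"
  assumes "continuous_on (sphere 0 1) h"
  shows "(\<integral>\<zeta>. h (\<zeta> 0) \<partial>torus_haar 1) = (\<integral>\<zeta>. h \<zeta> \<partial>circle_haar)"
proof -
  interpret T: prob_space circle_haar by (rule prob_space_circle_haar)
  interpret product_sigma_finite "\<lambda>_::nat. circle_haar" by standard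
  have "{..<1::nat} = {0}" by auto
  then show ?thesis
    using product_integral_singleton[of h 0] continuous_imp_measurable_circle_haar[OF assms]
    by (simp add: torus_haar_def)
qed

text \<open>Supplies the test functions for the hypothesis in dimension one. Their radial means are
  bounded by the boundary mean, so the power of the Hardy norm is bounded by a circle integral in
  which p no longer occurs.\<close>

lemma entire_exp_in_hardy_space:
  assumes P: "P holomorphic_on UNIV" and p: "0 < p"
  shows "(\<lambda>z. exp (P (z 0) / of_real p)) \<in> hardy_space 1 p" (is "?g \<in> _")
    and "hardy_norm 1 p (\<lambda>z. exp (P (z 0) / of_real p)) powr p \<le> (\<integral>\<zeta>. exp (Re (P \<zeta>)) \<partial>circle_haar)"
proof -
  have hP: "P holomorphic_on A" for A by (rule holomorphic_on_subset[OF P]) simp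
  have cP: "continuous_on A P" for A by (rule holomorphic_on_imp_continuous_on[OF hP])
  let ?I = "\<integral>\<zeta>. exp (Re (P \<zeta>)) \<partial>circle_haar"
  have mean: "hardy_mean 1 p ?g r \<le> ?I powr (1 / p)" if r: "r \<in> {0..<1}" for r
  proof -
    have "hardy_mean 1 p ?g r = (\<integral>\<zeta>. exp (Re (P (of_real r * \<zeta> 0))) \<partial>torus_haar 1) powr (1 / p)"
      by (simp add: hardy_mean_def norm_exp_divide_powr[OF p] del: norm_exp_eq_Re)
    also have "(\<integral>\<zeta>. exp (Re (P (of_real r * \<zeta> 0))) \<partial>torus_haar 1) =
        (\<integral>\<zeta>. exp (Re (P (of_real r * \<zeta>))) \<partial>circle_haar)"
      by (rule torus_haar_1_integral)
         (intro continuous_intros continuous_on_compose2[OF cP[of UNIV]], auto)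
    also have "\<dots> powr (1 / p) \<le> ?I powr (1 / p)"
      using circle_mean_exp_Re_mono[OF P, of r] r p
      by (intro powr_mono2 integral_nonneg_AE) auto
    finally show ?thesis .
  qed
  have bdd: "bdd_above (hardy_mean 1 p ?g ` {0..<1})" by (rule bdd_aboveI2[OF mean])
  have "continuous_on (polydisc 1) ?g"
    using p by (intro continuous_intros continuous_on_compose2[OF cP[of UNIV]]
      continuous_on_subset[OF continuous_on_product_coordinates]) auto
  moreover have "(\<lambda>w. ?g (z(k := w))) holomorphic_on ball 0 1" if "k < 1" for z and k :: nat
    using that p by (auto intro!: holomorphic_intros hP)
  ultimately show "?g \<in> hardy_space 1 p"
    using bdd by (auto simp: hardy_space_def analytic_polydisc_def)
  have "hardy_norm 1 p ?g \<le> ?I powr (1 / p)"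
    unfolding hardy_norm_def using mean by (intro cSUP_least) auto
  moreover have "0 \<le> hardy_norm 1 p ?g"
  proof -
    have "0 \<le> hardy_mean 1 p ?g 0" by (simp add: hardy_mean_def)
    also have "\<dots> \<le> hardy_norm 1 p ?g"
      unfolding hardy_norm_def using bdd by (intro cSUP_upper) auto
    finally show ?thesis .
  qed
  ultimately have "hardy_norm 1 p ?g powr p \<le> (?I powr (1 / p)) powr p"
    using p by (intro powr_mono2) auto
  also have "\<dots> = ?I"
    using p by (simp add: powr_powr integral_nonneg_AE)
  finally show "hardy_norm 1 p ?g powr p \<le> ?I" .
qed

text \<open>
  Here \<open>u\<close> plays the role of a log-subharmonic function on the disc and \<open>v\<close> that of its boundary values.
  The exponent has disappeared, because \<open>exp \<circ> P\<close> has roots of every order.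
\<close>

definition log_majorized :: "(complex \<Rightarrow> real) \<Rightarrow> (complex \<Rightarrow> real) \<Rightarrow> bool" where
  "log_majorized v u \<longleftrightarrow>
     (\<forall>P. P holomorphic_on UNIV \<and> (\<forall>\<zeta>\<in>sphere 0 1. v \<zeta> \<le> exp (Re (P \<zeta>))) \<longrightarrow>
        (\<forall>w\<in>ball 0 1. u w \<le> exp (Re (P w))))"

text \<open>Outer majorants \<open>exp (P j)\<close> of the \<open>v j\<close> with error
  \<open>e\<close> dominate the \<open>u j\<close> in the disc. \<open>dagger\<close> with n = 1 is
  applied to \<open>exp (P j / pt j)\<close>, for which the modulus to the power \<open>pt j\<close>
  is \<open>exp (Re (P j))\<close>. Continuity of \<Phi> then removes \<open>e\<close>.\<close>

lemma one_variable_inequality: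
  fixes \<Phi> :: "real ^ 'm \<Rightarrow> real"
  assumes \<Phi>: "admissible \<Phi>" and \<mu>: "weighted_measure \<mu>" and pt: "\<And>j. 0 < pt j"
    and dag: "dagger \<Phi> \<mu> pt"
    and vc: "\<And>j. continuous_on (sphere 0 1) (v j)"
    and v0: "\<And>j \<zeta>. \<zeta> \<in> sphere 0 1 \<Longrightarrow> 0 \<le> v j \<zeta>"
    and u0: "\<And>j w. w \<in> ball 0 1 \<Longrightarrow> 0 \<le> u j w"
    and maj: "\<And>j. log_majorized (v j) (u j)"
  shows "(\<integral>\<^sup>+w. ennreal (\<Phi> (\<chi> j. u j w)) \<partial>\<mu>) \<le> ennreal (\<Phi> (\<chi> j. \<integral>\<zeta>. v j \<zeta> \<partial>circle_haar))"
proof -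
  interpret T: prob_space circle_haar by (rule prob_space_circle_haar)
  interpret M: sigma_finite_measure \<mu> by (rule sigma_finite_weighted[OF \<mu>])
  interpret MP: product_sigma_finite "\<lambda>_::nat. \<mu>" by standard
  let ?I = "\<lambda>j. \<integral>\<zeta>. v j \<zeta> \<partial>circle_haar"
  have I0: "0 \<le> ?I j" for j using v0 by (intro integral_nonneg_AE AE_I2) auto
  have step: "(\<integral>\<^sup>+w. ennreal (\<Phi> (\<chi> j. u j w)) \<partial>\<mu>) \<le> ennreal (\<Phi> (\<chi> j. ?I j + e))"
    if e: "0 < e" for e
  proof -
    have "\<exists>P. \<forall>j. P j holomorphic_on UNIV \<and>
        (\<forall>z\<in>sphere 0 1. v j z \<le> exp (Re (P j z)) \<and> exp (Re (P j z)) \<le> v j z + e)"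
      by (rule choice) (metis outer_majorant_on_circle[OF vc v0 e])
    then obtain P where P: "\<And>j. P j holomorphic_on UNIV"
      and lo: "\<And>j z. z \<in> sphere 0 1 \<Longrightarrow> v j z \<le> exp (Re (P j z))"
      and up: "\<And>j z. z \<in> sphere 0 1 \<Longrightarrow> exp (Re (P j z)) \<le> v j z + e"
      by blast
    have hP: "P j holomorphic_on A" for j A by (rule holomorphic_on_subset[OF P]) simp
    have cP: "continuous_on A (P j)" for j A by (rule holomorphic_on_imp_continuous_on[OF hP])
    define g where "g j z = exp (P j (z 0) / of_real (pt j))" for j and z :: "nat \<Rightarrow> complex"
    have gH: "g j \<in> hardy_space 1 (pt j)" for j
      unfolding g_def by (rule entire_exp_in_hardy_space[OF P pt])
    have pg: "phi_mod \<Phi> pt g z = \<Phi> (\<chi> j. exp (Re (P j (z 0))))" for z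
      by (simp add: phi_mod_def g_def norm_exp_divide_powr[OF pt] del: norm_exp_eq_Re)
    have cE: "continuous_on A (\<lambda>w. \<Phi> (\<chi> j. exp (Re (P j w))))" for A
      by (intro admissible_continuous_on[OF \<Phi>] continuous_intros cP) auto
    have Em: "(\<lambda>w. ennreal (\<Phi> (\<chi> j. exp (Re (P j w))))) \<in> borel_measurable \<mu>"
      by (subst measurable_cong_sets[OF sets_weighted[OF \<mu>] refl])
         (intro measurable_compose[OF _ measurable_ennreal] borel_measurable_continuous_on_restrict cE)
    have "(\<integral>\<^sup>+w. ennreal (\<Phi> (\<chi> j. u j w)) \<partial>\<mu>) \<le> (\<integral>\<^sup>+w. ennreal (\<Phi> (\<chi> j. exp (Re (P j w)))) \<partial>\<mu>)"
    proof (intro nn_integral_mono ennreal_leI admissible_mono[OF \<Phi>])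
      fix w j assume "w \<in> space \<mu>"
      then have w: "w \<in> ball 0 1" using space_weighted[OF \<mu>] by simp
      show "0 \<le> u j w" using u0 w by simp
      show "u j w \<le> exp (Re (P j w))"
        using maj[of j] P lo w unfolding log_majorized_def by blast
    qed
    also have "\<dots> = (\<integral>\<^sup>+z. ennreal (phi_mod \<Phi> pt g z) \<partial>polydisc_measure \<mu> 1)"
    proof -
      have "{..<1::nat} = {0}" by auto
      then show ?thesis
        using MP.product_nn_integral_singleton[OF Em, of 0] by (simp add: pg polydisc_measure_def)
    qed
    also have "\<dots> = ennreal (\<integral>z. phi_mod \<Phi> pt g z \<partial>polydisc_measure \<mu> 1)"
    proof (rule nn_integral_eq_integral)
      show "integrable (polydisc_measure \<mu> 1) (phi_mod \<Phi> pt g)"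
        using dag gH unfolding dagger_def by blast
      show "AE z in polydisc_measure \<mu> 1. 0 \<le> phi_mod \<Phi> pt g z"
        unfolding pg by (intro AE_I2 admissible_nonneg[OF \<Phi>]) auto
    qed
    also have "(\<integral>z. phi_mod \<Phi> pt g z \<partial>polydisc_measure \<mu> 1) \<le> phi_norm 1 \<Phi> pt g"
      using dag gH unfolding dagger_def by blast
    also have "phi_norm 1 \<Phi> pt g \<le> \<Phi> (\<chi> j. ?I j + e)"
      unfolding phi_norm_def
    proof (rule admissible_mono[OF \<Phi>])
      fix j
      have "hardy_norm 1 (pt j) (g j) powr pt j \<le> (\<integral>\<zeta>. exp (Re (P j \<zeta>)) \<partial>circle_haar)"
        unfolding g_def by (rule entire_exp_in_hardy_space[OF P pt])
      also have "\<dots> \<le> (\<integral>\<zeta>. v j \<zeta> + e \<partial>circle_haar)"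
        using up by (intro integral_mono integrable_circle_haar continuous_intros cP vc) auto
      also have "\<dots> = ?I j + e"
        using integrable_circle_haar[OF vc] T.prob_space by simp
      finally show "hardy_norm 1 (pt j) (g j) powr pt j \<le> ?I j + e" .
    qed simp
    finally show ?thesis by (simp add: ennreal_leI)
  qed
  have "(\<lambda>n. ennreal (\<Phi> (\<chi> j. ?I j + inverse (real (Suc n))))) \<longlonglongrightarrow> ennreal (\<Phi> (\<chi> j. ?I j))"
  proof (intro tendsto_ennrealI admissible_tendsto[OF \<Phi>])
    show "(\<lambda>n. ?I j + inverse (real (Suc n))) \<longlonglongrightarrow> ?I j" for j
      using tendsto_add[OF tendsto_const LIMSEQ_inverse_real_of_nat, of "?I j"] by simp
  qed (use I0 in \<open>auto intro: add_nonneg_nonneg\<close>)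
  then show ?thesis
    by (rule LIMSEQ_le_const) (use step in auto)
qed

text \<open>A zero in \<open>cball 0 \<rho>\<close> makes the bound given by the boundary values strict, with a factor depending only on \<open>\<rho>\<close>:
  for the Blaschke factor \<open>b\<close> one has \<open>1 - |b w|\<^sup>2 = (1 - |\<beta>|\<^sup>2) (1 - |w|\<^sup>2) / |1 - cnj \<beta> w|\<^sup>2\<close>.\<close>

definition zero_gain :: "real \<Rightarrow> complex \<Rightarrow> real" where
  "zero_gain \<rho> w = sqrt (1 - (1 - \<rho>\<^sup>2) * (1 - (norm w)\<^sup>2) / 4)"

lemma zero_gain_bounds:
  assumes "0 \<le> \<rho>" "\<rho> < 1" "w \<in> ball 0 1"
  shows "0 < zero_gain \<rho> w" "zero_gain \<rho> w < 1"
proof -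
  have 1: "0 < 1 - \<rho>\<^sup>2" "1 - \<rho>\<^sup>2 \<le> 1" using assms by (auto simp: power2_less_1_iff abs_square_less_1)
  have 2: "0 < 1 - (norm w)\<^sup>2" "1 - (norm w)\<^sup>2 \<le> 1" using assms by (auto simp: abs_square_less_1)
  have "(1 - \<rho>\<^sup>2) * (1 - (norm w)\<^sup>2) \<le> 1 * 1" using 1 2 by (intro mult_mono) auto
  moreover have "0 < (1 - \<rho>\<^sup>2) * (1 - (norm w)\<^sup>2)" using 1 2 by simp
  ultimately show "0 < zero_gain \<rho> w" "zero_gain \<rho> w < 1" by (auto simp: zero_gain_def)
qed

lemma blaschke_norm_identity:
  "(norm (1 - cnj b * w))\<^sup>2 - (norm (w - b))\<^sup>2 = (1 - (norm b)\<^sup>2) * (1 - (norm w)\<^sup>2)"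
  unfolding cmod_power2 by (simp add: algebra_simps power2_eq_square)

text \<open>Multiplying F by (1 - cnj b z) / (z - b) keeps its modulus on the circle, so the same
  outer majorants bound the product inside; there the modulus has grown by at least the factor
  \<open>1 / zero_gain \<rho> w\<close>.\<close>

lemma log_majorized_zero_gain:
  assumes cont: "continuous_on (cball 0 1) F" and hol: "F holomorphic_on ball 0 1"
    and b: "norm b \<le> \<rho>" "\<rho> < 1" "F b = 0" and p: "0 < p"
  shows "log_majorized (\<lambda>\<zeta>. norm (F \<zeta>) powr p) (\<lambda>w. (norm (F w) / zero_gain \<rho> w) powr p)"
  unfolding log_majorized_def
proof (intro allI impI ballI, elim conjE)
  fix P :: "complex \<Rightarrow> complex" and w :: complex
  assume P: "P holomorphic_on UNIV" and bd: "\<forall>\<zeta>\<in>sphere 0 1. norm (F \<zeta>) powr p \<le> exp (Re (P \<zeta>))"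
    and w: "w \<in> ball 0 1"
  have hP: "P holomorphic_on A" for A by (rule holomorphic_on_subset[OF P]) simp
  have cP: "continuous_on A P" for A by (rule holomorphic_on_imp_continuous_on[OF hP])
  have \<rho>: "0 \<le> \<rho>" using b norm_ge_zero order_trans by blast
  have bb: "norm b < 1" using b by simp
  \<comment> \<open>The quotient F(z) / (z - b) with its removable singularity filled in. Continuity
    up to the circle is glued from the part away from \<open>b\<close> and the open disc.\<close>
  define K where "K z = (if z = b then deriv F b else F z / (z - b))" for z
  have hK: "K holomorphic_on ball 0 1"
    unfolding K_def
    by (rule pole_theorem_open_0[OF hol]) (use b in auto)
  have cK: "continuous_on (cball 0 1) K"
  proof -
    have "continuous_on (cball 0 1 - {b}) (\<lambda>z. F z / (z - b))"
      by (intro continuous_intros continuous_on_subset[OF cont]) auto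
    then have "continuous_on (cball 0 1 - {b}) K"
      by (rule continuous_on_eq) (auto simp: K_def)
    moreover have "continuous_on (ball 0 1) K" by (rule holomorphic_on_imp_continuous_on[OF hK])
    ultimately have "continuous_on ((cball 0 1 - {b}) \<union> ball 0 1) K"
    proof (intro continuous_on_Un_local_open)
      have "cball 0 1 - {b} \<union> ball 0 1 = cball 0 1" using bb by auto
      then show "openin (top_of_set (cball 0 1 - {b} \<union> ball 0 1)) (cball 0 1 - {b})"
        "openin (top_of_set (cball 0 1 - {b} \<union> ball 0 1)) (ball 0 1)"
        by (simp_all add: openin_delete open_subset ball_subset_cball)
    qed
    moreover have "(cball 0 1 - {b}) \<union> ball 0 1 = cball 0 1" using bb by auto
    ultimately show ?thesis by simp
  qed
  have den: "1 - cnj b * z \<noteq> 0" if "z \<in> cball 0 1" for z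
  proof
    assume "1 - cnj b * z = 0"
    then have "norm (cnj b * z) = 1" by (metis eq_iff_diff_eq_0 norm_one)
    moreover have "norm (cnj b * z) \<le> norm b * 1"
      using that by (simp add: norm_mult mult_left_le)
    ultimately show False using bb by simp
  qed
  have F: "F z = K z * (z - b)" for z using b by (simp add: K_def)
  define h where "h z = K z * (1 - cnj b * z) * exp (- (P z / of_real p))" for z
  have "norm (h w) \<le> 1"
  proof (rule maximum_modulus_frontier[of h "cball 0 1"])
    show "h holomorphic_on interior (cball 0 1)"
      unfolding h_def using p by (auto intro!: holomorphic_intros hK hP)
    show "continuous_on (closure (cball 0 1)) h"
      unfolding h_def using p by (auto intro!: continuous_intros cK cP)
    show "norm (h z) \<le> 1" if "z \<in> frontier (cball 0 1)" for z
    proof -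
      have z: "z \<in> sphere 0 1" using that by simp
      have "(norm (1 - cnj b * z))\<^sup>2 = (norm (z - b))\<^sup>2"
        using blaschke_norm_identity[of b z] z by simp
      then have "norm (1 - cnj b * z) = norm (z - b)" by (simp add: power2_eq_iff_nonneg)
      then have "norm (h z) = norm (F z * exp (- (P z / of_real p)))"
        by (simp add: h_def F norm_mult)
      then have "norm (h z) powr p \<le> exp (Re (P z)) * exp (- Re (P z))"
        using bd[rule_format, OF z] by (simp only: norm_mult_exp_powr[OF p]) simp
      also have "\<dots> = 1 powr p" by (simp flip: exp_add)
      finally show ?thesis using p powr_less_mono2[of p 1 "norm (h z)"] by (meson linorder_not_less zero_le_one)
    qed
  qed (use w in auto)
  have q: "0 < zero_gain \<rho> w" using zero_gain_bounds(1) \<rho> b w by blast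
  have ratio: "norm (w - b) \<le> zero_gain \<rho> w * norm (1 - cnj b * w)"
  proof (rule power2_le_imp_le)
    \<comment> \<open>The origin of the 4 in \<open>zero_gain\<close>: both terms of
      \<open>1 - cnj b * w\<close> have modulus at most 1.\<close>
    have n4: "(norm (1 - cnj b * w))\<^sup>2 \<le> 4"
    proof -
      have "norm (1 - cnj b * w) \<le> norm (1::complex) + norm (cnj b * w)" by (rule norm_triangle_ineq4)
      also have "norm (cnj b * w) \<le> 1 * 1" unfolding norm_mult using bb w by (intro mult_mono) auto
      finally have "(norm (1 - cnj b * w))\<^sup>2 \<le> 2\<^sup>2" by (intro power_mono) auto
      then show ?thesis by simp
    qed
    have w1: "0 \<le> 1 - (norm w)\<^sup>2" and r1: "0 \<le> 1 - \<rho>\<^sup>2"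
      using w b \<rho> by (auto simp: abs_square_le_1)
    have "(1 - \<rho>\<^sup>2) * (1 - (norm w)\<^sup>2) / 4 * (norm (1 - cnj b * w))\<^sup>2 \<le> (1 - \<rho>\<^sup>2) * (1 - (norm w)\<^sup>2) / 4 * 4"
      using n4 w1 r1 by (intro mult_left_mono) auto
    also have "\<dots> \<le> (1 - (norm b)\<^sup>2) * (1 - (norm w)\<^sup>2)"
      using w1 b power_mono[of "norm b" \<rho> 2] by (auto intro!: mult_right_mono)
    also have "\<dots> = (norm (1 - cnj b * w))\<^sup>2 - (norm (w - b))\<^sup>2" by (simp only: blaschke_norm_identity)
    finally have "(norm (w - b))\<^sup>2 \<le> (1 - (1 - \<rho>\<^sup>2) * (1 - (norm w)\<^sup>2) / 4) * (norm (1 - cnj b * w))\<^sup>2"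
      by (simp add: algebra_simps)
    also have "1 - (1 - \<rho>\<^sup>2) * (1 - (norm w)\<^sup>2) / 4 = (zero_gain \<rho> w)\<^sup>2"
      using q unfolding zero_gain_def by simp
    finally show "(norm (w - b))\<^sup>2 \<le> (zero_gain \<rho> w * norm (1 - cnj b * w))\<^sup>2"
      by (simp add: power_mult_distrib)
  qed (use q in auto)
  have "norm (F w) / zero_gain \<rho> w \<le> norm (K w * (1 - cnj b * w))"
    using mult_left_mono[OF ratio norm_ge_zero[of "K w"]] q
    by (simp add: F norm_mult pos_divide_le_eq mult.commute mult.left_commute)
  then have "(norm (F w) / zero_gain \<rho> w) powr p \<le> norm (K w * (1 - cnj b * w)) powr p"
    using q p by (intro powr_mono2) auto
  moreover have "norm (K w * (1 - cnj b * w)) powr p * exp (- Re (P w)) \<le> 1"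
    using powr_mono2[OF less_imp_le[OF p] norm_ge_zero \<open>norm (h w) \<le> 1\<close>]
    unfolding h_def norm_mult_exp_powr[OF p] by simp
  ultimately show "(norm (F w) / zero_gain \<rho> w) powr p \<le> exp (Re (P w))"
    by (simp add: exp_minus field_simps)
qed

section \<open>Moving the variables to the torus\<close>

definition disc_proj :: "complex \<Rightarrow> complex" where
  "disc_proj w = w /\<^sub>R max 1 (norm w)"

lemma norm_disc_proj_le: "norm (disc_proj w) \<le> 1"
  by (auto simp: disc_proj_def max_def field_simps)

lemma disc_proj_eq [simp]: "norm w \<le> 1 \<Longrightarrow> disc_proj w = w"
  by (simp add: disc_proj_def max_absorb1)

lemma continuous_on_disc_proj [continuous_intros]:
  "continuous_on S g \<Longrightarrow> continuous_on S (\<lambda>x. disc_proj (g x))"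
  unfolding disc_proj_def by (intro continuous_intros) (auto simp: max_def)

text \<open>Projecting the arguments to the closed disc makes a dilate a bounded continuous function of
  all of \<open>nat \<Rightarrow> complex\<close>, so that no domain has to be carried through Fubini's theorem.\<close>

definition dilate :: "nat \<Rightarrow> real \<Rightarrow> ((nat \<Rightarrow> complex) \<Rightarrow> complex) \<Rightarrow> (nat \<Rightarrow> complex) \<Rightarrow> complex" where
  "dilate n r f z = f (\<lambda>k\<in>{..<n}. of_real r * disc_proj (z k))"

text \<open>Holomorphy is asked for in the open disc only, because \<open>disc_proj\<close> is not
  holomorphic beyond it; continuity and the bound are global and supply measurability and
  integrability.\<close>

definition slicewise_holomorphic :: "nat set \<Rightarrow> ((nat \<Rightarrow> complex) \<Rightarrow> complex) \<Rightarrow> bool" where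
  "slicewise_holomorphic I F \<longleftrightarrow>
     continuous_on UNIV F \<and> (\<exists>C. \<forall>z. norm (F z) \<le> C) \<and>
     (\<forall>z. \<forall>k\<in>I. (\<lambda>w. F (z(k := w))) holomorphic_on ball 0 1)"

text \<open>Tychonoff's theorem, for infinitely many coordinates since points of the type have that
  many.\<close>

lemma compact_product_cball: "compact (UNIV \<rightarrow>\<^sub>E cball (0::complex) 1 :: (nat \<Rightarrow> complex) set)"
proof -
  have "compactin (product_topology (\<lambda>i. euclidean) UNIV) (UNIV \<rightarrow>\<^sub>E cball (0::complex) 1 :: (nat \<Rightarrow> complex) set)"
    by (simp add: compactin_PiE)
  then show ?thesis by (simp add: euclidean_product_topology)
qed

lemma continuous_on_fun_upd:
  fixes z :: "nat \<Rightarrow> complex"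
  shows "continuous_on S (\<lambda>w. z(k := w))"
proof (rule continuous_on_coordinatewise_then_product)
  show "continuous_on S (\<lambda>w. (z(k := w)) i)" for i
    by (cases "i = k") (auto intro: continuous_intros)
qed

lemma dilate_arg_in_polydisc:
  assumes "0 \<le> r" "r < 1"
  shows "(\<lambda>k\<in>{..<n}. of_real r * disc_proj (z k)) \<in> polydisc n"
proof -
  have "r * norm (disc_proj w) < 1" for w
    using mult_left_le[OF norm_disc_proj_le \<open>0 \<le> r\<close>, of w] \<open>r < 1\<close> by linarith
  then show ?thesis using assms by (simp add: polydisc_def norm_mult)
qed

lemma slicewise_holomorphic_dilate:
  assumes f: "analytic_polydisc n f" and r: "0 \<le> r" "r < 1"
  shows "slicewise_holomorphic {..<n} (dilate n r f)"
proof -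
  let ?T = "\<lambda>z. \<lambda>k\<in>{..<n}. of_real r * disc_proj (z k)"
  have Tc: "continuous_on UNIV ?T"
  proof (rule continuous_on_coordinatewise_then_product)
    show "continuous_on UNIV (\<lambda>z. ?T z i)" for i
      by (cases "i < n") (auto intro!: continuous_intros)
  qed
  have c: "continuous_on UNIV (dilate n r f)"
    unfolding dilate_def
    by (rule continuous_on_compose2[OF _ Tc])
       (use f dilate_arg_in_polydisc[OF r] in \<open>auto simp: analytic_polydisc_def\<close>)
  obtain C where C: "\<And>z. z \<in> UNIV \<rightarrow>\<^sub>E cball 0 1 \<Longrightarrow> norm (dilate n r f z) \<le> C"
    using continuous_on_compact_bound[OF compact_product_cball continuous_on_subset[OF c subset_UNIV]] by metis
  \<comment> \<open>\<open>dilate\<close> sees projected coordinates only, so its values on the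
    compact product of closed discs are all its values.\<close>
  have "norm (dilate n r f z) \<le> C" for z
  proof -
    have "dilate n r f z = dilate n r f (\<lambda>k. disc_proj (z k))"
      by (simp add: dilate_def norm_disc_proj_le)
    also have "norm \<dots> \<le> C" by (rule C) (simp add: PiE_iff norm_disc_proj_le)
    finally show ?thesis .
  qed
  moreover have "(\<lambda>w. dilate n r f (z(k := w))) holomorphic_on ball 0 1" if k: "k < n" for z k
  proof -
    have "(\<lambda>w. f ((?T z)(k := w))) holomorphic_on ball 0 1"
      using f k dilate_arg_in_polydisc[OF r] unfolding analytic_polydisc_def by blast
    moreover have "(\<lambda>w. of_real r * w) ` ball 0 1 \<subseteq> ball (0::complex) 1"
    proof -
      have "r * norm w < 1" if "norm w < 1" for w :: complex
        using mult_left_le_one_le[OF norm_ge_zero r(1) less_imp_le[OF r(2)], of w] that by linarith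
      then show ?thesis using r by (auto simp: norm_mult)
    qed
    moreover have "(\<lambda>w. of_real r * w) holomorphic_on ball 0 1" by (intro holomorphic_intros)
    ultimately have "(\<lambda>w. f ((?T z)(k := of_real r * w))) holomorphic_on ball 0 1"
      using holomorphic_on_compose_gen[of "\<lambda>w. of_real r * w" "ball 0 1" "\<lambda>w. f ((?T z)(k := w))" "ball 0 1"]
      by (simp add: o_def)
    moreover have "dilate n r f (z(k := w)) = f ((?T z)(k := of_real r * w))" if "w \<in> ball 0 1" for w
      unfolding dilate_def using that k by (intro arg_cong[of _ _ f]) auto
    ultimately show ?thesis by (rule holomorphic_transform[OF _ sym])
  qed
  ultimately show ?thesis using c by (auto simp: slicewise_holomorphic_def)
qed

lemma dilate_on_closed:
  assumes "\<And>k. k < n \<Longrightarrow> norm (z k) \<le> 1"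
  shows "dilate n r f z = f (\<lambda>k\<in>{..<n}. of_real r * z k)"
  unfolding dilate_def using assms by (intro arg_cong[of _ _ f]) auto

lemma dilate_tendsto:
  assumes f: "continuous_on (polydisc n) f" and z: "z \<in> polydisc n"
    and s: "s \<longlonglongrightarrow> 1" "\<And>i. 0 \<le> s i" "\<And>i. s i < 1"
  shows "(\<lambda>i. dilate n (s i) f z) \<longlonglongrightarrow> f z"
proof -
  let ?T = "\<lambda>r. \<lambda>k\<in>{..<n}. complex_of_real r * z k"
  have zk: "norm (z k) < 1" if "k < n" for k using z that by (auto simp: polydisc_def PiE_iff)
  have "continuous_on {0..1} ?T"
  proof (rule continuous_on_coordinatewise_then_product)
    show "continuous_on {0..1} (\<lambda>r. ?T r i)" for i
      by (cases "i < n") (auto intro!: continuous_intros)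
  qed
  moreover have T: "?T r \<in> polydisc n" if "r \<in> {0..1}" for r
  proof -
    have "r * norm (z k) < 1" if "k < n" for k
      using zk[OF that] \<open>r \<in> {0..1}\<close> mult_left_le_one_le[of "norm (z k)" r] by (auto intro: le_less_trans)
    then show ?thesis using that by (auto simp: polydisc_def norm_mult)
  qed
  ultimately have "continuous_on {0..1} (\<lambda>r. f (?T r))"
    by (intro continuous_on_compose2[OF f]) auto
  then have "(\<lambda>i. f (?T (s i))) \<longlonglongrightarrow> f (?T 1)"
    by (rule continuous_on_tendsto_compose[OF _ s(1)]) (use s in \<open>auto simp: less_imp_le\<close>)
  moreover have "?T 1 = z" using z by (auto simp: polydisc_def PiE_iff extensional_def)
  moreover have "dilate n (s i) f z = f (?T (s i))" for i
    by (rule dilate_on_closed) (use zk in \<open>auto intro: less_imp_le\<close>)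
  ultimately show ?thesis by simp
qed

lemma product_sigma_finite_circle: "product_sigma_finite (\<lambda>_::nat. circle_haar)"
proof -
  interpret T: prob_space circle_haar by (rule prob_space_circle_haar)
  show ?thesis by standard
qed

lemma product_sigma_finite_weighted: "weighted_measure \<mu> \<Longrightarrow> product_sigma_finite (\<lambda>_::nat. \<mu>)"
  by (simp add: product_sigma_finite_def sigma_finite_weighted)

lemma finite_measure_torus:
  assumes "finite B"
  shows "finite_measure (\<Pi>\<^sub>M k\<in>B. circle_haar :: (nat \<Rightarrow> complex) measure)"
proof -
  interpret T: prob_space circle_haar by (rule prob_space_circle_haar)
  interpret finite_product_prob_space "\<lambda>_::nat. circle_haar" B
    by standard (rule assms)
  show ?thesis by (rule finite_measure_axioms)
qed

lemma ident_measurable_circle [measurable]: "(\<lambda>w. w) \<in> measurable circle_haar borel"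
  by (intro continuous_imp_measurable_circle_haar continuous_intros)

lemma ident_measurable_weighted: "weighted_measure \<mu> \<Longrightarrow> (\<lambda>w. w) \<in> measurable \<mu> borel"
  by (subst measurable_cong_sets[OF sets_weighted refl]) (auto intro: borel_measurable_continuous_on_restrict continuous_intros)

text \<open>For \<open>i \<notin> A\<close> the coordinate is the constant \<open>undefined\<close>.\<close>

lemma coordinate_measurable:
  assumes "(\<lambda>w. w) \<in> measurable M (borel :: complex measure)"
  shows "(\<lambda>z. z i) \<in> borel_measurable (\<Pi>\<^sub>M k\<in>A. M)"
proof (cases "i \<in> A")
  case True
  then show ?thesis
    using measurable_compose[OF measurable_component_singleton[OF True, of "\<lambda>_. M"] assms] by simp
next
  case False
  have "(\<lambda>z. z i) \<in> borel_measurable (\<Pi>\<^sub>M k\<in>A. M) \<longleftrightarrow>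
      (\<lambda>z. undefined :: complex) \<in> borel_measurable (\<Pi>\<^sub>M k\<in>A. M)"
    using False by (intro measurable_cong) (auto simp: space_PiM PiE_iff extensional_def)
  then show ?thesis by simp
qed

lemma override_on_measurable:
  assumes M: "(\<lambda>w. w) \<in> measurable M (borel :: complex measure)"
    and N: "(\<lambda>w. w) \<in> measurable N (borel :: complex measure)"
  shows "(\<lambda>x. override_on (snd x) (fst x) A :: nat \<Rightarrow> complex)
    \<in> borel_measurable ((\<Pi>\<^sub>M k\<in>A. M) \<Otimes>\<^sub>M (\<Pi>\<^sub>M k\<in>B. N))"
proof (rule measurable_coordinatewise_then_product)
  fix i
  show "(\<lambda>x. override_on (snd x) (fst x) A i) \<in> borel_measurable ((\<Pi>\<^sub>M k\<in>A. M) \<Otimes>\<^sub>M (\<Pi>\<^sub>M k\<in>B. N))"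
    using measurable_compose[OF measurable_fst coordinate_measurable[OF M, of i A]]
      measurable_compose[OF measurable_snd coordinate_measurable[OF N, of i B]]
    by (cases "i \<in> A") (auto simp: override_on_def)
qed

text \<open>A mixed mean: coordinates in \<open>A\<close> are disc variables read from
  \<open>z\<close>, those in \<open>B\<close> are averaged over the torus. All others are
  \<open>undefined\<close>, since \<zeta> is extensional on \<open>B\<close>; a dilate in n
  variables ignores them once \<open>A\<close> and \<open>B\<close> together exhaust
  \<open>{..<n}\<close>.\<close>

definition partial_mean ::
  "nat set \<Rightarrow> nat set \<Rightarrow> real \<Rightarrow> ((nat \<Rightarrow> complex) \<Rightarrow> complex) \<Rightarrow> (nat \<Rightarrow> complex) \<Rightarrow> real" where
  "partial_mean A B p F z = (\<integral>\<zeta>. norm (F (override_on \<zeta> z A)) powr p \<partial>(\<Pi>\<^sub>M k\<in>B. circle_haar))"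

lemma partial_mean_nonneg: "0 \<le> partial_mean A B p F z"
  by (simp add: partial_mean_def)

lemma partial_mean_measurable:
  assumes F: "continuous_on UNIV F" and \<mu>: "weighted_measure \<mu>" and B: "finite B"
  shows "partial_mean A B p F \<in> borel_measurable (\<Pi>\<^sub>M k\<in>A. \<mu>)"
proof -
  interpret TB: finite_measure "\<Pi>\<^sub>M k\<in>B. circle_haar :: (nat \<Rightarrow> complex) measure"
    by (rule finite_measure_torus[OF B])
  have "(\<lambda>x. norm (F (override_on (snd x) (fst x) A)) powr p)
      \<in> borel_measurable ((\<Pi>\<^sub>M k\<in>A. \<mu>) \<Otimes>\<^sub>M (\<Pi>\<^sub>M k\<in>B. circle_haar))"
    using measurable_compose[OF override_on_measurable[OF ident_measurable_weighted[OF \<mu>] ident_measurable_circle]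
        borel_measurable_continuous_onI[OF F]]
    by simp
  then show ?thesis
    unfolding partial_mean_def[abs_def]
    by (intro TB.borel_measurable_lebesgue_integral) (simp add: case_prod_beta')
qed

text \<open>What the one-variable inequality needs in the direction \<open>k\<close>, with the slice
  as both u and v. The torus over \<open>B\<close> is only a parameter space, so the majorization of
  means applies; the last claim is Fubini's theorem, which moves \<open>k\<close> from
  \<open>A\<close> to \<open>B\<close>.\<close>

lemma partial_mean_slice:
  fixes F :: "(nat \<Rightarrow> complex) \<Rightarrow> complex"
  assumes F: "slicewise_holomorphic I F" and k: "k \<in> I" "k \<notin> A" "k \<notin> B" and B: "finite B" and p: "0 < p"
  shows "continuous_on (cball 0 1) (\<lambda>w. partial_mean (insert k A) B p F (z(k := w)))"
    and "log_majorized (\<lambda>w. partial_mean (insert k A) B p F (z(k := w)))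
           (\<lambda>w. partial_mean (insert k A) B p F (z(k := w)))"
    and "(\<integral>w. partial_mean (insert k A) B p F (z(k := w)) \<partial>circle_haar) = partial_mean A (insert k B) p F z"
proof -
  interpret T: prob_space circle_haar by (rule prob_space_circle_haar)
  interpret PT: product_sigma_finite "\<lambda>_::nat. circle_haar" by (rule product_sigma_finite_circle)
  let ?M = "\<Pi>\<^sub>M k\<in>B. circle_haar :: (nat \<Rightarrow> complex) measure"
  interpret TB: finite_measure ?M by (rule finite_measure_torus[OF B])
  interpret P: pair_sigma_finite ?M circle_haar ..
  define G where "G w \<zeta> = F ((override_on \<zeta> z A)(k := w))" for w \<zeta>
  have Fc: "continuous_on UNIV F" and Fh: "\<And>z. (\<lambda>w. F (z(k := w))) holomorphic_on ball 0 1"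
    using F k by (auto simp: slicewise_holomorphic_def)
  obtain C where C: "\<And>z. norm (F z) \<le> C" using F by (auto simp: slicewise_holomorphic_def)
  have ov: "override_on \<zeta> (z(k := w)) (insert k A) = (override_on \<zeta> z A)(k := w)" for \<zeta> w
    using k by (auto simp: override_on_def fun_eq_iff)
  have pm: "partial_mean (insert k A) B p F (z(k := w)) = (\<integral>\<zeta>. norm (G w \<zeta>) powr p \<partial>?M)" for w
    by (simp add: partial_mean_def ov G_def)
  have Gc: "continuous_on S (\<lambda>w. G w \<zeta>)" for S \<zeta>
    unfolding G_def by (rule continuous_on_compose2[OF Fc continuous_on_fun_upd]) simp
  have GH: "(\<lambda>w. G w \<zeta>) holomorphic_on ball 0 1" and GC: "norm (G w \<zeta>) \<le> C" for w \<zeta>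
    unfolding G_def by (rule Fh, rule C)
  note coord = coordinate_measurable[OF ident_measurable_circle]
  have Gm: "(\<lambda>(w, \<zeta>). G w \<zeta>) \<in> borel_measurable (borel \<Otimes>\<^sub>M ?M)"
  proof -
    have "(\<lambda>x. (override_on (snd x) z A)(k := fst x)) \<in> borel_measurable (borel \<Otimes>\<^sub>M ?M)"
    proof (rule measurable_coordinatewise_then_product)
      fix i
      show "(\<lambda>x. ((override_on (snd x) z A)(k := fst x)) i) \<in> borel_measurable (borel \<Otimes>\<^sub>M ?M)"
        using measurable_compose[OF measurable_snd coord[of i B]]
        by (cases "i = k"; cases "i \<in> A") (auto simp: override_on_def)
    qed
    from measurable_compose[OF this borel_measurable_continuous_onI[OF Fc]]
    show ?thesis by (simp add: G_def case_prod_beta')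
  qed
  have Gw: "G w \<in> borel_measurable ?M" for w
    using measurable_compose[OF measurable_Pair1'[of w borel] Gm] by simp
  show "continuous_on (cball 0 1) (\<lambda>w. partial_mean (insert k A) B p F (z(k := w)))"
    unfolding pm
    by (rule continuous_on_integral_norm_powr[OF TB.finite_measure_axioms p Gw Gc])
       (use C in \<open>auto simp: G_def\<close>)
  show "log_majorized (\<lambda>w. partial_mean (insert k A) B p F (z(k := w)))
      (\<lambda>w. partial_mean (insert k A) B p F (z(k := w)))"
    unfolding pm log_majorized_def
  proof (intro allI impI ballI, elim conjE)
    fix P :: "complex \<Rightarrow> complex" and w :: complex
    assume P: "P holomorphic_on UNIV"
      and bd: "\<forall>w\<in>sphere 0 1. (\<integral>\<zeta>. norm (G w \<zeta>) powr p \<partial>?M) \<le> exp (Re (P w))" and w: "w \<in> ball 0 1"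
    show "(\<integral>\<zeta>. norm (G w \<zeta>) powr p \<partial>?M) \<le> exp (Re (P w))"
      by (rule integral_norm_powr_majorant[OF TB.finite_measure_axioms p, where F=G and C=C])
         (use Gm Gc GH GC P bd w in auto)
  qed
  have ip: "integrable (\<Pi>\<^sub>M k\<in>insert k B. circle_haar) (\<lambda>\<zeta>. norm (F (override_on \<zeta> z A)) powr p)"
  proof -
    interpret TK: finite_measure "\<Pi>\<^sub>M k\<in>insert k B. circle_haar :: (nat \<Rightarrow> complex) measure"
      by (rule finite_measure_torus) (simp add: B)
    have "(\<lambda>\<zeta>. override_on \<zeta> z A) \<in> borel_measurable (\<Pi>\<^sub>M k\<in>insert k B. circle_haar)"
    proof (rule measurable_coordinatewise_then_product)
      fix i
      show "(\<lambda>\<zeta>. override_on \<zeta> z A i) \<in> borel_measurable (\<Pi>\<^sub>M k\<in>insert k B. circle_haar)"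
        using coord[of i "insert k B"] by (cases "i \<in> A") (auto simp: override_on_def)
    qed
    from measurable_compose[OF this borel_measurable_continuous_onI[OF Fc]]
    show ?thesis
      using C p by (intro TK.integrable_const_bound[of _ "C powr p"] AE_I2) (auto intro!: powr_mono2)
  qed
  have "partial_mean A (insert k B) p F z =
      (\<integral>\<zeta>. (\<integral>w. norm (F (override_on (\<zeta>(k := w)) z A)) powr p \<partial>circle_haar) \<partial>?M)"
    unfolding partial_mean_def by (rule PT.product_integral_insert[OF B k(3) ip])
  also have "\<dots> = (\<integral>\<zeta>. (\<integral>w. norm (G w \<zeta>) powr p \<partial>circle_haar) \<partial>?M)"
  proof -
    have "override_on (\<zeta>(k := w)) z A = (override_on \<zeta> z A)(k := w)" for \<zeta> w
      using k by (auto simp: override_on_def fun_eq_iff)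
    then show ?thesis by (simp add: G_def)
  qed
  also have "\<dots> = (\<integral>w. (\<integral>\<zeta>. norm (G w \<zeta>) powr p \<partial>?M) \<partial>circle_haar)"
  proof (rule P.Fubini_integral[symmetric])
    interpret PF: finite_measure "?M \<Otimes>\<^sub>M circle_haar"
      by (intro finite_measure_pair_measure TB.finite_measure_axioms T.finite_measure_axioms)
    have "(\<lambda>x. (snd x, fst x)) \<in> measurable (?M \<Otimes>\<^sub>M circle_haar) (borel \<Otimes>\<^sub>M ?M)"
      using measurable_compose[OF measurable_snd ident_measurable_circle, of ?M] by measurable
    from measurable_compose[OF this Gm]
    have "(\<lambda>(\<zeta>, w). norm (G w \<zeta>) powr p) \<in> borel_measurable (?M \<Otimes>\<^sub>M circle_haar)"
      by (simp add: case_prod_beta')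
    then show "integrable (?M \<Otimes>\<^sub>M circle_haar) (\<lambda>(\<zeta>, w). norm (G w \<zeta>) powr p)"
      using C p by (intro PF.integrable_const_bound[of _ "C powr p"] AE_I2)
        (auto simp: G_def intro!: powr_mono2)
  qed
  finally show "(\<integral>w. partial_mean (insert k A) B p F (z(k := w)) \<partial>circle_haar) = partial_mean A (insert k B) p F z"
    unfolding pm by simp
qed

lemma partial_mean_phi_measurable:
  assumes \<Phi>: "admissible \<Phi>" and \<mu>: "weighted_measure \<mu>"
    and F: "\<And>j. slicewise_holomorphic I (F j)" and B: "finite B"
  shows "(\<lambda>z. ennreal (\<Phi> (\<chi> j. partial_mean A B (p j) (F j) z))) \<in> borel_measurable (\<Pi>\<^sub>M k\<in>A. \<mu>)"
  using F by (intro measurable_compose[OF _ measurable_ennreal] admissible_measurable[OF \<Phi>] partial_mean_measurable \<mu> B)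
    (auto simp: partial_mean_nonneg slicewise_holomorphic_def)

text \<open>Induction on the set of disc variables. The variable \<open>k\<close> is integrated
  innermost and passes from \<open>A\<close> to \<open>B\<close> by the one-variable inequality, so
  \<open>B\<close> has to stay arbitrary.\<close>

lemma partial_mean_inequality:
  fixes \<Phi> :: "real ^ 'm \<Rightarrow> real"
  assumes \<Phi>: "admissible \<Phi>" and \<mu>: "weighted_measure \<mu>" and pt: "\<And>j. 0 < pt j"
    and dag: "dagger \<Phi> \<mu> pt" and F: "\<And>j. slicewise_holomorphic I (F j)" and p: "\<And>j. 0 < p j"
    and AB: "finite A" "finite B" "A \<inter> B = {}" "A \<union> B \<subseteq> I"
  shows "(\<integral>\<^sup>+z. ennreal (\<Phi> (\<chi> j. partial_mean A B (p j) (F j) z)) \<partial>(\<Pi>\<^sub>M k\<in>A. \<mu>))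
      \<le> ennreal (\<Phi> (\<chi> j. partial_mean {} (A \<union> B) (p j) (F j) (\<lambda>_. undefined)))"
  using AB
proof (induction A arbitrary: B)
  case empty
  interpret PM: product_sigma_finite "\<lambda>_::nat. \<mu>" by (rule product_sigma_finite_weighted[OF \<mu>])
  \<comment> \<open>The empty product measure is a unit mass at
    \<open>\<lambda>_. undefined\<close>.\<close>
  show ?case by (simp add: PM.nn_integral_empty)
next
  case (insert k A)
  interpret PM: product_sigma_finite "\<lambda>_::nat. \<mu>" by (rule product_sigma_finite_weighted[OF \<mu>])
  have k: "k \<in> I" "k \<notin> A" "k \<notin> B" using insert by auto
  have "(\<integral>\<^sup>+z. ennreal (\<Phi> (\<chi> j. partial_mean (insert k A) B (p j) (F j) z)) \<partial>(\<Pi>\<^sub>M k\<in>insert k A. \<mu>)) =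
      (\<integral>\<^sup>+z. (\<integral>\<^sup>+w. ennreal (\<Phi> (\<chi> j. partial_mean (insert k A) B (p j) (F j) (z(k := w)))) \<partial>\<mu>) \<partial>(\<Pi>\<^sub>M k\<in>A. \<mu>))"
    using insert.hyps insert.prems
    by (intro PM.product_nn_integral_insert partial_mean_phi_measurable[OF \<Phi> \<mu> F]) auto
  also have "\<dots> \<le> (\<integral>\<^sup>+z. ennreal (\<Phi> (\<chi> j. partial_mean A (insert k B) (p j) (F j) z)) \<partial>(\<Pi>\<^sub>M k\<in>A. \<mu>))"
  proof (rule nn_integral_mono)
    fix z
    note sl = partial_mean_slice[OF F k insert.prems(1) p, of _ _ z]
    show "(\<integral>\<^sup>+w. ennreal (\<Phi> (\<chi> j. partial_mean (insert k A) B (p j) (F j) (z(k := w)))) \<partial>\<mu>)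
        \<le> ennreal (\<Phi> (\<chi> j. partial_mean A (insert k B) (p j) (F j) z))"
      using one_variable_inequality[OF \<Phi> \<mu> pt dag continuous_on_subset[OF sl(1) sphere_cball] _ _ sl(2)]
      by (simp add: sl(3) partial_mean_nonneg)
  qed
  also have "\<dots> \<le> ennreal (\<Phi> (\<chi> j. partial_mean {} (A \<union> insert k B) (p j) (F j) (\<lambda>_. undefined)))"
    by (rule insert.IH) (use insert k in auto)
  finally show ?case by simp
qed

lemma hardy_integral_le:
  assumes f: "f \<in> hardy_space n p" and p: "0 < p" and r: "0 \<le> r" "r < 1"
  shows "partial_mean {} {..<n} p (dilate n r f) z \<le> hardy_norm n p f powr p"
proof -
  have "partial_mean {} {..<n} p (dilate n r f) z = hardy_mean n p f r powr p"
  proof -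
    have "partial_mean {} {..<n} p (dilate n r f) z =
        (\<integral>\<zeta>. norm (f (\<lambda>k\<in>{..<n}. of_real r * \<zeta> k)) powr p \<partial>torus_haar n)"
      unfolding partial_mean_def torus_haar_def
      by (intro Bochner_Integration.integral_cong refl)
         (auto simp: space_PiM PiE_iff dilate_on_closed)
    then show ?thesis using p by (simp add: hardy_mean_def powr_powr)
  qed
  also have "\<dots> \<le> hardy_norm n p f powr p"
    unfolding hardy_norm_def using f r p
    by (intro powr_mono2 cSUP_upper) (auto simp: hardy_space_def hardy_mean_def)
  finally show ?thesis .
qed

section \<open>Zeros and logarithms on polydiscs\<close>

lemma holomorphic_eq_0_on_disc:
  assumes g: "g holomorphic_on ball 0 1" and a: "a \<in> ball 0 1" and d: "0 < \<delta>"
    and zero: "\<And>w. w \<in> ball a \<delta> \<inter> ball 0 1 \<Longrightarrow> g w = 0" and w: "w \<in> ball 0 1"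
  shows "g w = 0"
proof (rule analytic_continuation_open[of "ball a \<delta> \<inter> ball 0 1" "ball 0 1" g "\<lambda>_. 0" w])
  show "ball a \<delta> \<inter> ball 0 1 \<noteq> {}" using a d by (metis IntI centre_in_ball empty_iff)
qed (use assms in auto)

lemma tendsto_coordinatewise:
  fixes y :: "'b \<Rightarrow> nat \<Rightarrow> complex"
  assumes "\<And>m. ((\<lambda>i. y i m) \<longlongrightarrow> l m) F"
  shows "(y \<longlongrightarrow> l) F"
proof -
  have "limitin (product_topology (\<lambda>_. euclidean) UNIV) y l F"
    unfolding limitin_componentwise using assms by (simp add: limitin_canonical_iff)
  then show ?thesis by (simp add: euclidean_product_topology limitin_canonical_iff)
qed

lemma tendsto_on_polydisc:
  assumes f: "continuous_on (polydisc n) f" and l: "l \<in> polydisc n" and y: "\<And>i. y i \<in> polydisc n"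
    and lim: "\<And>m. m < n \<Longrightarrow> (\<lambda>i. y i m) \<longlonglongrightarrow> l m"
  shows "(\<lambda>i. f (y i)) \<longlonglongrightarrow> f l"
proof (rule continuous_on_tendsto_compose[OF f _ l])
  show "y \<longlonglongrightarrow> l"
  proof (rule tendsto_coordinatewise)
    fix m
    have "y i m = l m" if "\<not> m < n" for i
      using y[of i] l that by (auto simp: polydisc_def PiE_iff extensional_def)
    then show "(\<lambda>i. y i m) \<longlonglongrightarrow> l m" using lim by (cases "m < n") auto
  qed
qed (use y in auto)

text \<open>Hurwitz's theorem asks for locally uniform limits, while continuity on the polydisc is
  exploited through sequences. If uniformity failed, compactness would yield a convergent sequence
  of bad points along a subsequence, against \<open>conv\<close>.\<close>

lemma uniform_limit_if_continuous_convergence: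
  fixes G :: "nat \<Rightarrow> complex \<Rightarrow> complex"
  assumes K: "compact K" and g: "continuous_on K g"
    and conv: "\<And>s w l. strict_mono s \<Longrightarrow> (\<And>i. w i \<in> K) \<Longrightarrow> l \<in> K \<Longrightarrow> w \<longlonglongrightarrow> l \<Longrightarrow>
      (\<lambda>i. G (s i) (w i)) \<longlonglongrightarrow> g l"
  shows "uniform_limit K G g sequentially"
  unfolding uniform_limit_iff
proof (intro allI impI, rule ccontr)
  fix e :: real assume e: "0 < e"
  assume neg: "\<not> (\<forall>\<^sub>F i in sequentially. \<forall>x\<in>K. dist (G i x) (g x) < e)"
  obtain s :: "nat \<Rightarrow> nat" where s: "strict_mono s" "\<And>i. \<not> (\<forall>x\<in>K. dist (G (s i) x) (g x) < e)"
    using not_eventually_sequentiallyD[OF neg] by blast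
  then have "\<forall>i. \<exists>x. x \<in> K \<and> e \<le> dist (G (s i) x) (g x)" by (meson not_less)
  then obtain w where w: "\<And>i. w i \<in> K" "\<And>i. e \<le> dist (G (s i) (w i)) (g (w i))" by metis
  obtain l t where l: "l \<in> K" and t: "strict_mono t" "(w \<circ> t) \<longlonglongrightarrow> l"
    using K w(1) unfolding compact_def by blast
  have "(\<lambda>i. G (s (t i)) (w (t i))) \<longlonglongrightarrow> g l"
    using conv[OF strict_mono_o[OF s(1) t(1)], of "w \<circ> t" l] t(2) w(1) l by (simp add: o_def)
  moreover have "(\<lambda>i. g (w (t i))) \<longlonglongrightarrow> g l"
    using continuous_on_tendsto_compose[OF g t(2) l] w(1) by simp
  ultimately have "(\<lambda>i. dist (G (s (t i)) (w (t i))) (g (w (t i)))) \<longlonglongrightarrow> dist (g l) (g l)"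
    by (rule tendsto_dist)
  then have "e \<le> dist (g l) (g l)"
    by (rule LIMSEQ_le_const) (use w(2) in auto)
  then show False using e by simp
qed

lemma Hurwitz_zeros_persist:
  assumes G: "\<And>i. G i holomorphic_on ball 0 1" and g: "g holomorphic_on ball 0 1"
    and ul: "\<And>K. compact K \<Longrightarrow> K \<subseteq> ball 0 1 \<Longrightarrow> uniform_limit K G g sequentially"
    and b: "b \<in> ball 0 1" "g b = 0" and c: "c \<in> ball 0 1" "g c \<noteq> 0" and d: "0 < \<delta>"
  shows "\<forall>\<^sub>F i in sequentially. \<exists>w\<in>ball b \<delta> \<inter> ball 0 1. G i w = 0"
proof (rule ccontr)
  let ?S = "ball b \<delta> \<inter> ball 0 1"
  assume neg: "\<not> (\<forall>\<^sub>F i in sequentially. \<exists>w\<in>?S. G i w = 0)"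
  obtain s :: "nat \<Rightarrow> nat" where s: "strict_mono s" "\<And>i. \<not> (\<exists>w\<in>?S. G (s i) w = 0)"
    using not_eventually_sequentiallyD[OF neg] by blast
  have "g b \<noteq> 0"
  proof (rule Hurwitz_no_zeros[of ?S "\<lambda>i. G (s i)" g b])
    show "connected ?S" by (intro convex_connected convex_Int convex_ball)
    show "G (s i) holomorphic_on ?S" for i by (rule holomorphic_on_subset[OF G]) auto
    show "g holomorphic_on ?S" by (rule holomorphic_on_subset[OF g]) auto
    show "uniform_limit K (\<lambda>i. G (s i)) g sequentially" if "compact K" "K \<subseteq> ?S" for K
      using filterlim_compose[OF ul[of K] filterlim_subseq[OF s(1)]] that by (simp add: o_def)
    \<comment> \<open>A constant could only be the value 0 taken at \<open>b\<close>; the identity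
      theorem would spread it to \<open>c\<close>.\<close>
    show "\<not> g constant_on ?S"
    proof
      assume "g constant_on ?S"
      then obtain y where y: "\<And>w. w \<in> ?S \<Longrightarrow> g w = y" unfolding constant_on_def by blast
      have "y = 0" using y[of b] b d by simp
      then show False using holomorphic_eq_0_on_disc[OF g b(1) d] y c by blast
    qed
  qed (use s b d in auto)
  then show False using b by simp
qed

lemma fun_upd_in_polydisc: "y \<in> polydisc n \<Longrightarrow> k < n \<Longrightarrow> w \<in> ball 0 1 \<Longrightarrow> y(k := w) \<in> polydisc n"
  by (auto simp: polydisc_def PiE_iff extensional_def)

lemma polydisc_coord: "y \<in> polydisc n \<Longrightarrow> k < n \<Longrightarrow> y k \<in> ball 0 1"
  by (auto simp: polydisc_def PiE_iff)

lemma slice_continuous: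
  assumes f: "analytic_polydisc n f" and y: "y \<in> polydisc n" and k: "k < n"
  shows "continuous_on (ball 0 1) (\<lambda>w. f (y(k := w)))"
  using f y k holomorphic_on_imp_continuous_on unfolding analytic_polydisc_def by blast

text \<open>Base points and dilation factors both vary, to cover two uses: dilates of one fixed
  slice, and undilated neighbouring slices with all \<open>r i = 1\<close>.\<close>

lemma Hurwitz_polydisc:
  assumes f: "analytic_polydisc n f" and k: "k < n"
    and y: "\<And>i. y i \<in> polydisc n" "l \<in> polydisc n" and lim: "\<And>m. m < n \<Longrightarrow> (\<lambda>i. y i m) \<longlonglongrightarrow> l m"
    and r: "r \<longlonglongrightarrow> 1" "\<And>i. 0 \<le> r i" "\<And>i. r i \<le> 1"
    and b: "b \<in> ball 0 1" "f (l(k := b)) = 0" and c: "c \<in> ball 0 1" "f (l(k := c)) \<noteq> 0" and d: "0 < \<delta>"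
  shows "\<forall>\<^sub>F i in sequentially. \<exists>w\<in>ball b \<delta> \<inter> ball 0 1. f ((y i)(k := of_real (r i) * w)) = 0"
proof (rule Hurwitz_zeros_persist[where g="\<lambda>w. f (l(k := w))"])
  have fh: "(\<lambda>w. f (z(k := w))) holomorphic_on ball 0 1" if "z \<in> polydisc n" for z
    using f k that by (auto simp: analytic_polydisc_def)
  have rb: "of_real (r i) * w \<in> ball 0 1" if "w \<in> ball 0 1" for i and w :: complex
  proof -
    have "r i * norm w \<le> norm w" by (rule mult_left_le_one_le) (use r in auto)
    then show ?thesis using that r by (simp add: norm_mult)
  qed
  show "(\<lambda>w. f ((y i)(k := of_real (r i) * w))) holomorphic_on ball 0 1" for i
  proof -
    have "(\<lambda>w. of_real (r i) * w) ` ball 0 1 \<subseteq> ball (0::complex) 1" using rb by blast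
    then show ?thesis
      using holomorphic_on_compose_gen[OF _ fh[OF y(1)], of "\<lambda>w. of_real (r i) * w" "ball 0 1" i]
      by (simp add: o_def holomorphic_intros)
  qed
  show "(\<lambda>w. f (l(k := w))) holomorphic_on ball 0 1" by (rule fh[OF y(2)])
  show "uniform_limit K (\<lambda>i w. f ((y i)(k := of_real (r i) * w))) (\<lambda>w. f (l(k := w))) sequentially"
    if K: "compact K" "K \<subseteq> ball 0 1" for K
  proof (rule uniform_limit_if_continuous_convergence[OF K(1)])
    show "continuous_on K (\<lambda>w. f (l(k := w)))"
      using slice_continuous[OF f y(2) k] K(2) continuous_on_subset by blast
    fix s :: "nat \<Rightarrow> nat" and w x
    assume s: "strict_mono s" and w: "\<And>i. w i \<in> K" "x \<in> K" "w \<longlonglongrightarrow> x"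
    show "(\<lambda>i. f ((y (s i))(k := of_real (r (s i)) * w i))) \<longlonglongrightarrow> f (l(k := x))"
    proof (rule tendsto_on_polydisc[where f=f])
      show "continuous_on (polydisc n) f" using f by (simp add: analytic_polydisc_def)
      show "l(k := x) \<in> polydisc n" using fun_upd_in_polydisc y k w K by blast
      show "(y (s i))(k := of_real (r (s i)) * w i) \<in> polydisc n" for i
        using fun_upd_in_polydisc[OF y(1) k rb] w K by blast
      show "(\<lambda>i. ((y (s i))(k := of_real (r (s i)) * w i)) m) \<longlonglongrightarrow> (l(k := x)) m" if "m < n" for m
      proof (cases "m = k")
        case True
        have "(\<lambda>i. of_real (r (s i)) * w i) \<longlonglongrightarrow> of_real 1 * x"
          by (intro tendsto_mult tendsto_of_real w(3) LIMSEQ_subseq_LIMSEQ[OF r(1) s, unfolded o_def])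
        then show ?thesis using True by simp
      next
        case False
        then show ?thesis using LIMSEQ_subseq_LIMSEQ[OF lim[OF that] s] by (simp add: o_def)
      qed
    qed
  qed
qed (use b c d in auto)

section \<open>Zero sets and nonvanishing sets in the polydisc\<close>

lemma polydisc_box_neighbourhood:
  assumes f: "continuous_on (polydisc n) f" and c: "c \<in> polydisc n" "f c \<noteq> (0::complex)"
  obtains \<delta> where "0 < \<delta>"
    "\<And>z. z \<in> polydisc n \<Longrightarrow> (\<And>m. m < n \<Longrightarrow> norm (z m - c m) < \<delta>) \<Longrightarrow> f z \<noteq> 0"
proof (rule ccontr)
  assume "\<not> thesis"
  then have "\<forall>i. \<exists>z\<in>polydisc n. (\<forall>m<n. norm (z m - c m) < inverse (real (Suc i))) \<and> f z = 0"
    using that by (metis inverse_positive_iff_positive of_nat_0_less_iff zero_less_Suc)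
  then obtain z where z: "\<And>i. z i \<in> polydisc n" "\<And>i m. m < n \<Longrightarrow> norm (z i m - c m) < inverse (real (Suc i))"
    "\<And>i. f (z i) = 0" by metis
  have "(\<lambda>i. f (z i)) \<longlonglongrightarrow> f c"
  proof (rule tendsto_on_polydisc[OF f c(1) z(1)])
    show "(\<lambda>i. z i m) \<longlonglongrightarrow> c m" if "m < n" for m
      by (rule LIM_zero_cancel, rule Lim_null_comparison[OF _ LIMSEQ_inverse_real_of_nat])
         (intro always_eventually allI less_imp_le z(2) that)
  qed
  then have "f c = 0" using z(3) by (simp add: LIMSEQ_const_iff)
  then show False using c by simp
qed

text \<open>The identity theorem one variable at a time: if f vanished on a whole box about
  \<open>a\<close>, the constraint could be dropped for one coordinate after another. In the
  induction \<open>A\<close> is the set of coordinates already released.\<close>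

lemma analytic_polydisc_nonzero_dense:
  assumes f: "analytic_polydisc n f" and nz: "\<exists>z\<in>polydisc n. f z \<noteq> 0"
    and a: "a \<in> polydisc n" and d: "0 < \<delta>"
  obtains c where "c \<in> polydisc n" "\<And>m. m < n \<Longrightarrow> norm (c m - a m) < \<delta>" "f c \<noteq> 0"
proof (rule ccontr)
  assume "\<not> thesis"
  then have loc: "f c = 0" if "c \<in> polydisc n" "\<And>m. m < n \<Longrightarrow> norm (c m - a m) < \<delta>" for c
    using \<open>\<And>c. \<lbrakk>c \<in> polydisc n; \<And>m. m < n \<Longrightarrow> norm (c m - a m) < \<delta>; f c \<noteq> 0\<rbrakk> \<Longrightarrow> thesis\<close> that by blast
  have "f z = 0" if "finite A" "A \<subseteq> {..<n}" "z \<in> polydisc n" "\<And>m. m < n \<Longrightarrow> m \<notin> A \<Longrightarrow> norm (z m - a m) < \<delta>" for A z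
    using that
  proof (induction A arbitrary: z)
    case empty
    then show ?case using loc by auto
  next
    case (insert k A)
    have k: "k < n" using insert.prems by auto
    have h: "(\<lambda>w. f (z(k := w))) holomorphic_on ball 0 1"
      using f k insert.prems by (auto simp: analytic_polydisc_def)
    have "f (z(k := z k)) = 0"
    proof (rule holomorphic_eq_0_on_disc[OF h polydisc_coord[OF a k] d])
      fix w assume w: "w \<in> ball (a k) \<delta> \<inter> ball 0 1"
      show "f (z(k := w)) = 0"
      proof (rule insert.IH)
        show "z(k := w) \<in> polydisc n" using fun_upd_in_polydisc insert.prems k w by blast
        show "norm ((z(k := w)) m - a m) < \<delta>" if "m < n" "m \<notin> A" for m
          using that w insert.prems(3)[of m] by (cases "m = k") (auto simp: dist_norm norm_minus_commute)
      qed (use insert.prems in auto)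
    qed (use polydisc_coord insert.prems k in auto)
    then show ?case by simp
  qed
  from this[of "{..<n}"] nz show False by auto
qed

text \<open>A finite intersection of dense open sets is dense and open; the radius \<epsilon>
  carries the openness through the induction.\<close>

lemma analytic_polydisc_common_nonzero:
  assumes J: "finite J" and f: "\<And>j. j \<in> J \<Longrightarrow> analytic_polydisc n (f j)"
    and nz: "\<And>j. j \<in> J \<Longrightarrow> \<exists>z\<in>polydisc n. f j z \<noteq> 0"
    and a: "a \<in> polydisc n" and d: "0 < \<delta>"
  shows "\<exists>c\<in>polydisc n. (\<forall>m<n. norm (c m - a m) < \<delta>) \<and>
      (\<exists>\<epsilon>>0. \<forall>z\<in>polydisc n. (\<forall>m<n. norm (z m - c m) < \<epsilon>) \<longrightarrow> (\<forall>j\<in>J. f j z \<noteq> 0))"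
  using J f nz
proof induction
  case empty
  then show ?case using a d by (intro bexI[of _ a]) (auto intro: exI[of _ 1])
next
  case (insert i J)
  have "\<exists>c\<in>polydisc n. (\<forall>m<n. norm (c m - a m) < \<delta>) \<and>
      (\<exists>\<epsilon>>0. \<forall>z\<in>polydisc n. (\<forall>m<n. norm (z m - c m) < \<epsilon>) \<longrightarrow> (\<forall>j\<in>J. f j z \<noteq> 0))"
    by (rule insert.IH) (use insert.prems in auto)
  then obtain c e where c: "c \<in> polydisc n" "\<And>m. m < n \<Longrightarrow> norm (c m - a m) < \<delta>" "0 < e"
    and e: "\<And>z. z \<in> polydisc n \<Longrightarrow> (\<And>m. m < n \<Longrightarrow> norm (z m - c m) < e) \<Longrightarrow> \<forall>j\<in>J. f j z \<noteq> 0"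
    by blast
  \<comment> \<open>The box of radius D about \<open>c\<close> stays in the \<delta>-box of
    \<open>a\<close> and in the box where the earlier functions are nonzero. The centre then moves
    by less than D/2 and keeps a radius of at most D/2.\<close>
  define D where "D = Min (insert e ((\<lambda>m. \<delta> - norm (c m - a m)) ` {..<n}))"
  have D: "0 < D" "D \<le> e" "\<And>m. m < n \<Longrightarrow> D \<le> \<delta> - norm (c m - a m)"
  proof -
    let ?X = "insert e ((\<lambda>m. \<delta> - norm (c m - a m)) ` {..<n})"
    have X: "finite ?X" "?X \<noteq> {}" by simp_all
    show "0 < D" unfolding D_def Min_gr_iff[OF X] using c by auto
    show "D \<le> e" unfolding D_def by (rule Min_le[OF X(1)]) simp
    show "D \<le> \<delta> - norm (c m - a m)" if "m < n" for m
      unfolding D_def by (rule Min_le[OF X(1)]) (use that in simp)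
  qed
  obtain c' where c': "c' \<in> polydisc n" "\<And>m. m < n \<Longrightarrow> norm (c' m - c m) < D / 2" "f i c' \<noteq> 0"
    using analytic_polydisc_nonzero_dense[of n "f i" c "D / 2"] insert.prems[of i] c(1) D(1) by auto
  obtain e' where e': "0 < e'"
    "\<And>z. z \<in> polydisc n \<Longrightarrow> (\<And>m. m < n \<Longrightarrow> norm (z m - c' m) < e') \<Longrightarrow> f i z \<noteq> 0"
    using polydisc_box_neighbourhood[of n "f i" c'] c' insert.prems(1)[of i] by (auto simp: analytic_polydisc_def)
  show ?case
  proof (intro bexI[of _ c'] conjI allI impI exI[of _ "min e' (D / 2)"] ballI)
    show "norm (c' m - a m) < \<delta>" if "m < n" for m
      using norm_triangle_ineq[of "c' m - c m" "c m - a m"] c'(2)[OF that] D(1) D(3)[OF that] by simp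
    show "f j z \<noteq> 0" if z: "z \<in> polydisc n" "\<forall>m<n. norm (z m - c' m) < min e' (D / 2)" and j: "j \<in> insert i J" for z j
    proof (cases "j = i")
      case True
      then show ?thesis using e'(2)[OF z(1)] z(2) by auto
    next
      case False
      have "norm (z m - c m) < e" if "m < n" for m
        using norm_triangle_ineq[of "z m - c' m" "c' m - c m"] c'(2)[OF that] z(2) D(2) that by fastforce
      then show ?thesis using e[OF z(1)] j False by blast
    qed
  qed (use c' e' D in auto)
qed

text \<open>\<open>a\<close> is joined to \<open>z\<close> by changing one coordinate at a time; in
  the induction \<open>A\<close> contains the coordinates in which the two may differ.\<close>

lemma zero_on_lines_imp_zero:
  fixes f :: "(nat \<Rightarrow> complex) \<Rightarrow> 'a::zero"
  assumes a: "a \<in> polydisc n" "f a = 0"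
    and lines: "\<And>y k w. y \<in> polydisc n \<Longrightarrow> f y = 0 \<Longrightarrow> k < n \<Longrightarrow> w \<in> ball 0 1 \<Longrightarrow> f (y(k := w)) = 0"
    and z: "z \<in> polydisc n"
  shows "f z = 0"
proof -
  have "f z = 0" if "finite A" "A \<subseteq> {..<n}" "z \<in> polydisc n" "\<And>m. m < n \<Longrightarrow> m \<notin> A \<Longrightarrow> z m = a m" for A z
    using that
  proof (induction A arbitrary: z)
    case empty
    then have "z = a" using a by (auto simp: polydisc_def PiE_iff extensional_def fun_eq_iff) (metis not_less)
    then show ?case using a by simp
  next
    case (insert k A)
    have k: "k < n" using insert.prems by auto
    have p: "z(k := a k) \<in> polydisc n" using fun_upd_in_polydisc polydisc_coord a k insert.prems by blast
    have "f (z(k := a k)) = 0" by (rule insert.IH[OF _ p]) (use insert.prems in auto)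
    from lines[OF p this k polydisc_coord[OF insert.prems(2) k]] show ?case by simp
  qed
  from this[of "{..<n}"] z show ?thesis by auto
qed

text \<open>On the disc f has some holomorphic logarithm h. Values of g - h differ by multiples of 2
  pi i, so this continuous function is constant.\<close>

lemma continuous_log_is_holomorphic:
  fixes g :: "complex \<Rightarrow> complex"
  assumes g: "continuous_on (ball 0 1) g" and f: "f holomorphic_on ball 0 1"
    and eq: "\<And>w. w \<in> ball 0 1 \<Longrightarrow> exp (g w) = f w"
  shows "g holomorphic_on ball 0 1"
proof -
  obtain h where h: "h holomorphic_on ball 0 1" "\<And>w. w \<in> ball 0 1 \<Longrightarrow> f w = exp (h w)"
    using contractible_imp_holomorphic_log[OF f convex_imp_contractible[OF convex_ball]] eq by (metis exp_not_eq_zero)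
  have "(\<lambda>w. g w - h w) constant_on ball 0 1"
  proof (rule continuous_discrete_range_constant)
    show "continuous_on (ball 0 1) (\<lambda>w. g w - h w)"
      by (intro continuous_intros g holomorphic_on_imp_continuous_on h)
    fix x :: complex assume x: "x \<in> ball 0 1"
    show "\<exists>e>0. \<forall>y. y \<in> ball 0 1 \<and> g y - h y \<noteq> g x - h x \<longrightarrow> e \<le> norm (g y - h y - (g x - h x))"
    proof (intro exI[of _ 1] conjI allI impI)
      fix y assume y: "y \<in> ball 0 1 \<and> g y - h y \<noteq> g x - h x"
      have "exp (g y - h y) = exp (g x - h x)" using eq h(2) x y by (simp add: exp_diff)
      then obtain k :: int where k: "g y - h y = g x - h x + (of_int (2 * k) * pi) * \<i>"
        unfolding exp_eq by auto
      then have "k \<noteq> 0" using y by auto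
      then have "1 * 1 \<le> \<bar>2 * real_of_int k\<bar> * pi"
        using pi_gt3 by (intro mult_mono) auto
      moreover have "norm (g y - h y - (g x - h x)) = \<bar>2 * real_of_int k\<bar> * pi"
        unfolding k by (simp add: norm_mult)
      ultimately show "1 \<le> norm (g y - h y - (g x - h x))" by simp
    qed simp
  qed simp
  then obtain c where "\<And>w. w \<in> ball 0 1 \<Longrightarrow> g w - h w = c" unfolding constant_on_def by blast
  then have "\<And>w. w \<in> ball 0 1 \<Longrightarrow> h w + c = g w" by (metis add.commute diff_add_cancel)
  moreover have "(\<lambda>w. h w + c) holomorphic_on ball 0 1" by (intro holomorphic_intros h)
  ultimately show ?thesis by (rule holomorphic_transform[rotated])
qed

text \<open>The theorem on continuous logarithms needs a normed space; bounded sequences provide one in which all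
  polydiscs embed as convex sets.\<close>

lemma polydisc_continuous_log:
  assumes f: "continuous_on (polydisc n) f" and nz: "\<And>z. z \<in> polydisc n \<Longrightarrow> f z \<noteq> (0::complex)"
  obtains L where "continuous_on (polydisc n) L" "\<And>z. z \<in> polydisc n \<Longrightarrow> exp (L z) = f z"
proof -
  define e where "e c k = Bcontfun (\<lambda>m::nat. if m = k then c else 0 :: complex)" for c k
  have ap: "apply_bcontfun (e c k) m = (if m = k then c else 0)" for c k m
  proof -
    have "finite (range (\<lambda>m::nat. if m = k then c else 0))" 
      by (rule finite_subset[of _ "{c, 0}"]) auto
    then have "(\<lambda>m::nat. if m = k then c else 0) \<in> bcontfun"
      by (simp add: bcontfun_def finite_imp_bounded)
    then show ?thesis by (simp add: e_def Bcontfun_inverse)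
  qed
  define S :: "(nat \<Rightarrow>\<^sub>C complex) set" where "S = {x. \<forall>k<n. apply_bcontfun x k \<in> ball 0 1}"
  \<comment> \<open>\<open>E\<close> pads with zeros and \<open>R\<close> restricts back. Scalar
    multiplication in the sequence space is by reals, hence the split into real and imaginary
    parts.\<close>
  define E where "E z = (\<Sum>k<n. Re (z k) *\<^sub>R e 1 k + Im (z k) *\<^sub>R e \<i> k)" for z :: "nat \<Rightarrow> complex"
  define R where "R x = (\<lambda>k\<in>{..<n}. apply_bcontfun x k)" for x :: "nat \<Rightarrow>\<^sub>C complex"
  have apS: "apply_bcontfun (\<Sum>k\<in>A. F k) m = (\<Sum>k\<in>A. apply_bcontfun (F k) m)"
    for A m and F :: "nat \<Rightarrow> nat \<Rightarrow>\<^sub>C complex"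
    by (induction A rule: infinite_finite_induct) auto
  have Ez: "apply_bcontfun (E z) m = (if m < n then z m else 0)" for z m
  proof -
    have "apply_bcontfun (E z) m = (\<Sum>k<n. if k = m then z m else 0)"
      unfolding E_def apS by (intro sum.cong) (auto simp: ap complex_eq_iff)
    then show ?thesis by simp
  qed
  have "convex S"
  proof (rule convexI)
    fix x y and u v :: real assume "x \<in> S" "y \<in> S" "0 \<le> u" "0 \<le> v" "u + v = 1"
    then show "u *\<^sub>R x + v *\<^sub>R y \<in> S"
      using convexD[OF convex_ball, of _ "0::complex" 1 _ u v] by (auto simp: S_def)
  qed
  have Rc: "continuous_on S R"
  proof (rule continuous_on_coordinatewise_then_product)
    have "continuous_on S (\<lambda>x. apply_bcontfun x i)" for i
      unfolding continuous_on_iff by (meson dist_bounded le_less_trans)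
    then show "continuous_on S (\<lambda>x. R x i)" for i by (cases "i < n") (auto simp: R_def)
  qed
  have RS: "R x \<in> polydisc n" if "x \<in> S" for x
    using that by (auto simp: R_def S_def polydisc_def)
  have "continuous_on S (\<lambda>x. f (R x))"
    by (rule continuous_on_compose2[OF f Rc]) (use RS in auto)
  then obtain g where g: "continuous_on S g" "\<And>x. x \<in> S \<Longrightarrow> f (R x) = exp (g x)"
    using continuous_logarithm_on_contractible[OF _ convex_imp_contractible[OF \<open>convex S\<close>], of "\<lambda>x. f (R x)"] nz RS
    by metis
  have ES: "E z \<in> S" and RE: "R (E z) = z" if z: "z \<in> polydisc n" for z
    using z by (auto simp: S_def R_def Ez polydisc_def PiE_iff extensional_def)
  have "continuous_on (polydisc n) E"
    unfolding E_def
    by (intro continuous_intros continuous_on_subset[OF continuous_on_product_coordinates]) auto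
  then have "continuous_on (polydisc n) (\<lambda>z. g (E z))"
    by (rule continuous_on_compose2[OF g(1)]) (use ES in auto)
  then show thesis
    using that g(2) ES RE by metis
qed

lemma analytic_polydisc_log:
  assumes f: "analytic_polydisc n f" and nz: "\<And>z. z \<in> polydisc n \<Longrightarrow> f z \<noteq> 0"
  obtains L where "analytic_polydisc n L" "\<And>z. z \<in> polydisc n \<Longrightarrow> exp (L z) = f z"
proof -
  obtain L where L: "continuous_on (polydisc n) L" "\<And>z. z \<in> polydisc n \<Longrightarrow> exp (L z) = f z"
    using polydisc_continuous_log[of n f] f nz by (metis analytic_polydisc_def)
  have "(\<lambda>w. L (z(k := w))) holomorphic_on ball 0 1" if z: "z \<in> polydisc n" and k: "k < n" for z k
  proof (rule continuous_log_is_holomorphic)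
    have "(\<lambda>w. z(k := w)) ` ball 0 1 \<subseteq> polydisc n" using fun_upd_in_polydisc[OF z k] by auto
    then show "continuous_on (ball 0 1) (\<lambda>w. L (z(k := w)))"
      by (rule continuous_on_compose2[OF L(1) continuous_on_fun_upd])
    show "(\<lambda>w. f (z(k := w))) holomorphic_on ball 0 1" using f z k by (auto simp: analytic_polydisc_def)
    show "exp (L (z(k := w))) = f (z(k := w))" if "w \<in> ball 0 1" for w
      using L(2) fun_upd_in_polydisc[OF z k that] by blast
  qed
  then show thesis by (intro that[of L]) (auto simp: analytic_polydisc_def L)
qed

section \<open>The inequality and its equality case\<close>

definition rad :: "nat \<Rightarrow> real" where
  "rad i = real i / real (Suc i)"

lemma rad_bounds: "0 \<le> rad i" "rad i < 1" "rad i \<le> 1"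
  by (simp_all add: rad_def)

lemma rad_tendsto: "rad \<longlonglongrightarrow> 1"
  unfolding rad_def[abs_def] using LIMSEQ_n_over_Suc_n[where 'a=real] by simp

text \<open>The product over no circles is a unit mass, so nothing is averaged.\<close>

lemma partial_mean_eq_norm_powr:
  assumes "z \<in> extensional A"
  shows "partial_mean A {} p F z = norm (F z) powr p"
proof -
  have "override_on (\<lambda>_. undefined) z A = z"
    using assms by (auto simp: override_on_def extensional_def fun_eq_iff)
  then show ?thesis
    by (simp add: partial_mean_def PiM_empty lebesgue_integral_count_space_finite)
qed

lemma space_polydisc_measure: "weighted_measure \<mu> \<Longrightarrow> space (\<Pi>\<^sub>M k\<in>{..<n}. \<mu>) = polydisc n"
  by (simp add: space_PiM space_weighted polydisc_def)

lemma AE_positive_measure_witness: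
  assumes "AE x in M. Q x" and "B \<in> sets M" and "0 < emeasure M B"
  obtains x where "x \<in> B" "Q x"
proof (rule ccontr)
  assume "\<not> thesis"
  then have "AE x in M. x \<notin> B" using assms(1) that by (auto elim: AE_mp)
  then have "emeasure M B = 0" using AE_iff_null_sets[OF assms(2)] by auto
  then show False using assms(3) by simp
qed

text \<open>The exponents \<open>p\<close> are not tied to \<open>pt\<close>; with
  \<open>p = pt\<close> the locale applies to the extremals themselves.\<close>

locale hardy_family =
  fixes \<Phi> :: "real ^ 'm \<Rightarrow> real" and \<mu> :: "complex measure" and pt p :: "'m \<Rightarrow> real" and n :: nat
    and f :: "'m \<Rightarrow> (nat \<Rightarrow> complex) \<Rightarrow> complex"
  assumes \<Phi>: "admissible \<Phi>" and \<mu>: "weighted_measure \<mu>" and pt: "\<And>j. 0 < pt j"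
    and dag: "dagger \<Phi> \<mu> pt" and p: "\<And>j. 0 < p j" and fH: "\<And>j. f j \<in> hardy_space n (p j)"
begin

sublocale PM: product_sigma_finite "\<lambda>_::nat. \<mu>"
  by (rule product_sigma_finite_weighted[OF \<mu>])

abbreviation "dil i j \<equiv> dilate n (rad i) (f j)"

lemma fan: "analytic_polydisc n (f j)"
  using fH by (auto simp: hardy_space_def)

lemma fc: "continuous_on (polydisc n) (f j)"
  using fan by (auto simp: analytic_polydisc_def)

lemma dil_slicewise: "slicewise_holomorphic {..<n} (dil i j)"
  by (rule slicewise_holomorphic_dilate[OF fan rad_bounds(1,2)])

lemma dil_tendsto: "z \<in> polydisc n \<Longrightarrow> (\<lambda>i. dil i j z) \<longlonglongrightarrow> f j z"
  by (rule dilate_tendsto[OF fc]) (auto intro: rad_tendsto rad_bounds)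

lemma phi_dil_tendsto:
  assumes "z \<in> polydisc n"
  shows "(\<lambda>i. \<Phi> (\<chi> j. norm (dil i j z) powr p j)) \<longlonglongrightarrow> phi_mod \<Phi> p f z"
  unfolding phi_mod_def
  by (intro admissible_tendsto[OF \<Phi>] tendsto_powr2 tendsto_norm dil_tendsto[OF assms] tendsto_const)
     (auto intro: less_imp_le[OF p] p)

lemma phi_mod_nonneg: "0 \<le> phi_mod \<Phi> p f z"
  unfolding phi_mod_def by (intro admissible_nonneg[OF \<Phi>]) simp

lemma phi_norm_nonneg: "0 \<le> phi_norm n \<Phi> p f"
  unfolding phi_norm_def by (intro admissible_nonneg[OF \<Phi>]) simp

text \<open>The variables may be split arbitrarily between disc and torus: \<open>B = {}\<close>
  leads to the inequality of the theorem, \<open>B = {k}\<close> is compared with it in the equality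
  case.\<close>

lemma dil_inequality:
  assumes "A \<inter> B = {}" "A \<union> B = {..<n}"
  shows "(\<integral>\<^sup>+z. ennreal (\<Phi> (\<chi> j. partial_mean A B (p j) (dil i j) z)) \<partial>(\<Pi>\<^sub>M k\<in>A. \<mu>))
      \<le> ennreal (phi_norm n \<Phi> p f)"
proof -
  have fin: "finite A" "finite B" using assms by (metis finite_Un finite_lessThan)+
  have "(\<integral>\<^sup>+z. ennreal (\<Phi> (\<chi> j. partial_mean A B (p j) (dil i j) z)) \<partial>(\<Pi>\<^sub>M k\<in>A. \<mu>))
      \<le> ennreal (\<Phi> (\<chi> j. partial_mean {} (A \<union> B) (p j) (dil i j) (\<lambda>_. undefined)))"
    using assms fin by (intro partial_mean_inequality[OF \<Phi> \<mu> pt dag dil_slicewise p]) auto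
  also have "\<dots> \<le> ennreal (phi_norm n \<Phi> p f)"
    unfolding assms phi_norm_def
    by (intro ennreal_leI admissible_mono[OF \<Phi>] hardy_integral_le fH p rad_bounds partial_mean_nonneg)
  finally show ?thesis .
qed

lemma partial_mean_dil_top:
  "z \<in> polydisc n \<Longrightarrow> partial_mean {..<n} {} (p j) (dil i j) z = norm (dil i j z) powr p j"
  by (rule partial_mean_eq_norm_powr) (auto simp: polydisc_def PiE_iff)

lemma phi_mod_measurable: "phi_mod \<Phi> p f \<in> borel_measurable (\<Pi>\<^sub>M k\<in>{..<n}. \<mu>)"
proof (rule borel_measurable_LIMSEQ_real)
  show "(\<lambda>z. \<Phi> (\<chi> j. partial_mean {..<n} {} (p j) (dil i j) z)) \<in> borel_measurable (\<Pi>\<^sub>M k\<in>{..<n}. \<mu>)" for i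
    using dil_slicewise
    by (intro admissible_measurable[OF \<Phi>] partial_mean_measurable \<mu>)
       (auto simp: partial_mean_nonneg slicewise_holomorphic_def)
  show "(\<lambda>i. \<Phi> (\<chi> j. partial_mean {..<n} {} (p j) (dil i j) z)) \<longlonglongrightarrow> phi_mod \<Phi> p f z"
    if "z \<in> space (\<Pi>\<^sub>M k\<in>{..<n}. \<mu>)" for z
    using phi_dil_tendsto[of z] that by (simp add: space_polydisc_measure[OF \<mu>] partial_mean_dil_top)
qed

text \<open>Fatou's lemma along the radii \<open>rad i\<close>; the bound for the dilates does not
  depend on \<open>i\<close>.\<close>

lemma nn_integral_phi_mod_le:
  "(\<integral>\<^sup>+z. ennreal (phi_mod \<Phi> p f z) \<partial>(\<Pi>\<^sub>M k\<in>{..<n}. \<mu>)) \<le> ennreal (phi_norm n \<Phi> p f)"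
proof -
  let ?M = "\<Pi>\<^sub>M k\<in>{..<n}. \<mu>"
  let ?u = "\<lambda>i z. ennreal (\<Phi> (\<chi> j. partial_mean {..<n} {} (p j) (dil i j) z))"
  have "(\<integral>\<^sup>+z. ennreal (phi_mod \<Phi> p f z) \<partial>?M) = (\<integral>\<^sup>+z. liminf (\<lambda>i. ?u i z) \<partial>?M)"
  proof (rule nn_integral_cong)
    fix z assume "z \<in> space ?M"
    then have z: "z \<in> polydisc n" by (simp add: space_polydisc_measure[OF \<mu>])
    have "(\<lambda>i. ?u i z) \<longlonglongrightarrow> ennreal (phi_mod \<Phi> p f z)"
      using tendsto_ennrealI[OF phi_dil_tendsto[OF z]] by (simp add: partial_mean_dil_top[OF z])
    then show "ennreal (phi_mod \<Phi> p f z) = liminf (\<lambda>i. ?u i z)"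
      by (intro lim_imp_Liminf[symmetric]) auto
  qed
  also have "\<dots> \<le> liminf (\<lambda>i. \<integral>\<^sup>+z. ?u i z \<partial>?M)"
    by (intro nn_integral_liminf partial_mean_phi_measurable[OF \<Phi> \<mu> dil_slicewise]) simp
  also have "\<dots> \<le> ennreal (phi_norm n \<Phi> p f)"
    by (intro Liminf_le always_eventually allI dil_inequality) auto
  finally show ?thesis .
qed

lemma phi_mod_integrable: "integrable (polydisc_measure \<mu> n) (phi_mod \<Phi> p f)"
  unfolding polydisc_measure_def
  using le_less_trans[OF nn_integral_phi_mod_le ennreal_less_top]
  by (intro integrableI_nonneg phi_mod_measurable AE_I2 phi_mod_nonneg) simp

lemma nn_integral_phi_mod:
  "(\<integral>\<^sup>+z. ennreal (phi_mod \<Phi> p f z) \<partial>(\<Pi>\<^sub>M k\<in>{..<n}. \<mu>)) =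
    ennreal (\<integral>z. phi_mod \<Phi> p f z \<partial>polydisc_measure \<mu> n)"
  using phi_mod_integrable unfolding polydisc_measure_def
  by (intro nn_integral_eq_integral AE_I2 phi_mod_nonneg)

lemma integral_phi_mod_le: "(\<integral>z. phi_mod \<Phi> p f z \<partial>polydisc_measure \<mu> n) \<le> phi_norm n \<Phi> p f"
  using nn_integral_phi_mod_le phi_norm_nonneg unfolding nn_integral_phi_mod by (simp add: ennreal_le_iff)

text \<open>Points at which the inequality in the coordinate \<open>k\<close> is an equality in the limit of dilates.\<close>

definition tight :: "nat \<Rightarrow> (nat \<Rightarrow> complex) \<Rightarrow> bool" where
  "tight k z \<longleftrightarrow>
     liminf (\<lambda>i. ennreal (\<Phi> (\<chi> j. partial_mean ({..<n} - {k}) {k} (p j) (dil i j) z)))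
       \<le> (\<integral>\<^sup>+w. ennreal (phi_mod \<Phi> p f (z(k := w))) \<partial>\<mu>) \<and>
     (\<integral>\<^sup>+w. ennreal (phi_mod \<Phi> p f (z(k := w))) \<partial>\<mu>) \<noteq> \<infinity>"

lemma slice_in_polydisc:
  assumes "k < n" "z \<in> space (\<Pi>\<^sub>M m\<in>{..<n} - {k}. \<mu>)" "w \<in> ball 0 1"
  shows "z(k := w) \<in> polydisc n"
  using assms by (auto simp: space_PiM space_weighted[OF \<mu>] polydisc_def PiE_iff extensional_def)

lemma partial_mean_dil_slice:
  assumes k: "k < n" and z: "z \<in> space (\<Pi>\<^sub>M m\<in>{..<n} - {k}. \<mu>)"
  shows "partial_mean (insert k ({..<n} - {k})) {} (p j) (dil i j) (z(k := w)) = norm (dil i j (z(k := w))) powr p j"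
  using z k by (intro partial_mean_eq_norm_powr) (auto simp: space_PiM PiE_iff extensional_def)

lemma dil_slice:
  assumes k: "k < n" and z: "z \<in> space (\<Pi>\<^sub>M m\<in>{..<n} - {k}. \<mu>)"
  shows "continuous_on (cball 0 1) (\<lambda>w. dil i j (z(k := w)))"
    and "continuous_on (cball 0 1) (\<lambda>w. norm (dil i j (z(k := w))) powr p j)"
    and "log_majorized (\<lambda>w. norm (dil i j (z(k := w))) powr p j) (\<lambda>w. norm (dil i j (z(k := w))) powr p j)"
    and "(\<integral>w. norm (dil i j (z(k := w))) powr p j \<partial>circle_haar) = partial_mean ({..<n} - {k}) {k} (p j) (dil i j) z"
  using partial_mean_slice[OF dil_slicewise[of i j], of k "{..<n} - {k}" "{}" "p j" z] k p
    continuous_on_compose2[OF _ continuous_on_fun_upd[of "cball 0 1" z k], of UNIV "dil i j"] dil_slicewise[of i j]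
  unfolding partial_mean_dil_slice[OF k z] by (simp_all add: slicewise_holomorphic_def)

lemma measurable_on_disc:
  fixes g :: "complex \<Rightarrow> real"
  assumes "continuous_on (ball 0 1) g"
  shows "(\<lambda>w. ennreal (g w)) \<in> borel_measurable \<mu>"
  by (subst measurable_cong_sets[OF sets_weighted[OF \<mu>] refl])
     (intro measurable_compose[OF _ measurable_ennreal] borel_measurable_continuous_on_restrict assms)

lemma phi_slice_continuous:
  assumes k: "k < n" and z: "z \<in> space (\<Pi>\<^sub>M m\<in>{..<n} - {k}. \<mu>)"
  shows "continuous_on (ball 0 1) (\<lambda>w. f j (z(k := w)))"
    and "continuous_on (ball 0 1) (\<lambda>w. phi_mod \<Phi> p f (z(k := w)))"
proof -
  have "(\<lambda>w. z(k := w)) ` ball 0 1 \<subseteq> polydisc n" using slice_in_polydisc[OF k z] by blast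
  then show c: "continuous_on (ball 0 1) (\<lambda>w. f j (z(k := w)))" for j
    by (rule continuous_on_compose2[OF fc continuous_on_fun_upd])
  show "continuous_on (ball 0 1) (\<lambda>w. phi_mod \<Phi> p f (z(k := w)))"
    unfolding phi_mod_def
    by (intro admissible_continuous_on[OF \<Phi>] continuous_on_powr' continuous_intros c) (auto simp: p)
qed

text \<open>Let C be the slice integral and L the lower limit of the mixed dilate means. Fatou's
  lemma and the one-variable inequality give C \<le> L at every z, while the integral of L is at
  most the right-hand side, which by equality is the integral of C.\<close>

lemma AE_tight:
  assumes eq: "(\<integral>z. phi_mod \<Phi> p f z \<partial>polydisc_measure \<mu> n) = phi_norm n \<Phi> p f" and k: "k < n"
  shows "AE z in (\<Pi>\<^sub>M m\<in>{..<n} - {k}. \<mu>). tight k z"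
proof -
  let ?I = "{..<n} - {k}"
  let ?M = "\<Pi>\<^sub>M m\<in>?I. \<mu>"
  let ?K = "ennreal (phi_norm n \<Phi> p f)"
  let ?A = "\<lambda>i z. ennreal (\<Phi> (\<chi> j. partial_mean ?I {k} (p j) (dil i j) z))"
  let ?C = "\<lambda>z. \<integral>\<^sup>+w. ennreal (phi_mod \<Phi> p f (z(k := w))) \<partial>\<mu>"
  have ins: "insert k ?I = {..<n}" using k by auto
  have Am: "?A i \<in> borel_measurable ?M" for i
    by (rule partial_mean_phi_measurable[OF \<Phi> \<mu> dil_slicewise]) simp
  have pm: "(\<lambda>z. ennreal (phi_mod \<Phi> p f z)) \<in> borel_measurable (\<Pi>\<^sub>M m\<in>insert k ?I. \<mu>)"
    unfolding ins by (intro measurable_compose[OF _ measurable_ennreal] phi_mod_measurable)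
  have Cm: "?C \<in> borel_measurable ?M"
  proof (rule sigma_finite_measure.borel_measurable_nn_integral[OF sigma_finite_weighted[OF \<mu>]])
    show "(\<lambda>(z, w). ennreal (phi_mod \<Phi> p f (z(k := w)))) \<in> borel_measurable (?M \<Otimes>\<^sub>M \<mu>)"
      using measurable_compose[OF measurable_add_dim[of k ?I "\<lambda>_. \<mu>"] pm] by (simp add: case_prod_beta')
  qed
  have Lm: "(\<lambda>z. liminf (\<lambda>i. ?A i z)) \<in> borel_measurable ?M"
    using Am by measurable
  have CK: "integral\<^sup>N ?M ?C = ?K"
  proof -
    have "integral\<^sup>N (\<Pi>\<^sub>M m\<in>insert k ?I. \<mu>) (\<lambda>z. ennreal (phi_mod \<Phi> p f z)) = integral\<^sup>N ?M ?C"
      by (rule PM.product_nn_integral_insert[OF _ _ pm]) auto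
    then show ?thesis using nn_integral_phi_mod eq unfolding ins by simp
  qed
  have LK: "(\<integral>\<^sup>+z. liminf (\<lambda>i. ?A i z) \<partial>?M) \<le> ?K"
  proof -
    have "(\<integral>\<^sup>+z. liminf (\<lambda>i. ?A i z) \<partial>?M) \<le> liminf (\<lambda>i. integral\<^sup>N ?M (?A i))"
      by (rule nn_integral_liminf[OF Am])
    also have "\<dots> \<le> ?K"
      using k by (intro Liminf_le always_eventually allI dil_inequality) auto
    finally show ?thesis .
  qed
  have le: "?C z \<le> liminf (\<lambda>i. ?A i z)" if z: "z \<in> space ?M" for z
  proof -
    let ?u = "\<lambda>i w. ennreal (\<Phi> (\<chi> j. norm (dil i j (z(k := w))) powr p j))"
    have "?C z = (\<integral>\<^sup>+w. liminf (\<lambda>i. ?u i w) \<partial>\<mu>)"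
    proof (rule nn_integral_cong)
      fix w assume "w \<in> space \<mu>"
      then have "z(k := w) \<in> polydisc n" by (intro slice_in_polydisc[OF k z]) (simp add: space_weighted[OF \<mu>])
      from tendsto_ennrealI[OF phi_dil_tendsto[OF this]]
      show "ennreal (phi_mod \<Phi> p f (z(k := w))) = liminf (\<lambda>i. ?u i w)"
        by (intro lim_imp_Liminf[symmetric]) auto
    qed
    also have "\<dots> \<le> liminf (\<lambda>i. integral\<^sup>N \<mu> (?u i))"
      by (intro nn_integral_liminf measurable_on_disc admissible_continuous_on[OF \<Phi>]
          continuous_on_subset[OF dil_slice(2)[OF k z] ball_subset_cball]) auto
    also have "\<dots> \<le> liminf (\<lambda>i. ?A i z)"
    proof (intro Liminf_mono always_eventually allI)
      fix i
      have "integral\<^sup>N \<mu> (?u i) \<le>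
          ennreal (\<Phi> (\<chi> j. \<integral>w. norm (dil i j (z(k := w))) powr p j \<partial>circle_haar))"
        by (rule one_variable_inequality[OF \<Phi> \<mu> pt dag continuous_on_subset[OF dil_slice(2)[OF k z] sphere_cball]
            _ _ dil_slice(3)[OF k z]]) auto
      then show "integral\<^sup>N \<mu> (?u i) \<le> ?A i z" by (simp add: dil_slice(4)[OF k z])
    qed
    finally show ?thesis .
  qed
  \<comment> \<open>Otherwise the pointwise bound \<open>le\<close> would integrate to a strict
    inequality, since the integral of \<open>?C\<close> is finite.\<close>
  have "AE z in ?M. liminf (\<lambda>i. ?A i z) \<le> ?C z"
  proof (rule ccontr)
    assume "\<not> ?thesis"
    then have "integral\<^sup>N ?M ?C < (\<integral>\<^sup>+z. liminf (\<lambda>i. ?A i z) \<partial>?M)"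
      using le CK by (intro nn_integral_less Cm Lm AE_I2) auto
    then show False using CK LK by simp
  qed
  moreover have "AE z in ?M. ?C z \<noteq> \<infinity>"
    using CK by (intro nn_integral_PInf_AE Cm) simp
  ultimately show ?thesis by eventually_elim (simp add: tight_def)
qed

text \<open>A zero at \<open>b\<close> would improve the one-variable inequality of every late
  dilate by one fixed gain in the argument \<open>l\<close>. By Fatou's lemma the improved integral
  is still at most the tight slice integral, although its integrand is strictly larger on an open
  set containing \<open>c\<close>.\<close>

lemma tight_zero_free:
  assumes k: "k < n" and z: "z \<in> space (\<Pi>\<^sub>M m\<in>{..<n} - {k}. \<mu>)" and tz: "tight k z"
    and c: "c \<in> ball 0 1" "\<And>j. f j (z(k := c)) \<noteq> 0" and b: "b \<in> ball 0 1"
  shows "f l (z(k := b)) \<noteq> 0"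
proof
  assume zero: "f l (z(k := b)) = 0"
  let ?I = "{..<n} - {k}"
  let ?A = "\<lambda>i. ennreal (\<Phi> (\<chi> j. partial_mean ?I {k} (p j) (dil i j) z))"
  \<comment> \<open>The coordinate \<open>k\<close> of \<open>z\<close> is \<open>undefined\<close>;
    setting it to 0 gives a point of the polydisc.\<close>
  define y where "y = z(k := 0)"
  have y: "y \<in> polydisc n" unfolding y_def by (rule slice_in_polydisc[OF k z]) simp
  have yz: "y(k := w) = z(k := w)" for w by (simp add: y_def)
  \<comment> \<open>The midpoint between |b| and 1: zeros of dilates within (1 - |b|)/2 of
    \<open>b\<close> lie in \<open>cball 0 \<rho>\<close>, so one function
    \<open>zero_gain \<rho>\<close> serves all large \<open>i\<close> and survives the
    limit.\<close>
  define \<rho> where "\<rho> = (1 + norm b) / 2"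
  have \<rho>: "0 \<le> \<rho>" "\<rho> < 1" using b by (auto simp: \<rho>_def)
  have ev: "\<forall>\<^sub>F i in sequentially. \<exists>w. norm w \<le> \<rho> \<and> dil i l (z(k := w)) = 0"
  proof -
    let ?y = "\<lambda>i. \<lambda>m\<in>{..<n}. of_real (rad i) * y m"
    have ynorm: "norm (y m) < 1" if "m < n" for m using polydisc_coord[OF y that] by simp
    have "\<forall>\<^sub>F i in sequentially. \<exists>w\<in>ball b ((1 - norm b) / 2) \<inter> ball 0 1.
        f l ((?y i)(k := of_real (rad i) * w)) = 0"
    proof (rule Hurwitz_polydisc[OF fan k _ y _ rad_tendsto rad_bounds(1,3) b])
      show "?y i \<in> polydisc n" for i
      proof -
        have "rad i * norm (y m) < 1" if "m < n" for m
          using mult_left_le_one_le[of "norm (y m)" "rad i"] ynorm[OF that] rad_bounds[of i] by simp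
        then show ?thesis using rad_bounds[of i] by (simp add: polydisc_def norm_mult)
      qed
      show "(\<lambda>i. ?y i m) \<longlonglongrightarrow> y m" if "m < n" for m
        using tendsto_mult[OF tendsto_of_real[OF rad_tendsto] tendsto_const[of "y m"]] that by simp
    qed (use zero c b in \<open>auto simp: yz\<close>)
    then show ?thesis
    proof eventually_elim
      case (elim i)
      then obtain w where w: "w \<in> ball b ((1 - norm b) / 2)" "w \<in> ball 0 1"
        "f l ((?y i)(k := of_real (rad i) * w)) = 0" by blast
      have "norm w \<le> norm b + norm (w - b)" using norm_triangle_ineq[of b "w - b"] by simp
      then have "norm w \<le> \<rho>" using w(1) by (simp add: \<rho>_def dist_norm norm_minus_commute field_simps)
      moreover have "dil i l (y(k := w)) = f l (\<lambda>m\<in>{..<n}. of_real (rad i) * (y(k := w)) m)"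
        by (rule dilate_on_closed) (use ynorm w(2) in \<open>auto intro: less_imp_le\<close>)
      moreover have "(\<lambda>m\<in>{..<n}. of_real (rad i) * (y(k := w)) m) = (?y i)(k := of_real (rad i) * w)"
        using k by (auto simp: fun_eq_iff)
      ultimately show ?case using w(3) by (auto simp: yz)
    qed
  qed
  define gain where "gain j w = (if j = l then zero_gain \<rho> w else 1)" for j w
  have gain: "0 < gain j w" "gain j w \<le> 1" if "w \<in> ball 0 1" for j w
    using zero_gain_bounds[OF \<rho> that] by (auto simp: gain_def)
  have gc: "continuous_on (ball 0 1) (gain j)" for j
  proof -
    have "continuous_on (ball 0 1) (zero_gain \<rho>)" unfolding zero_gain_def[abs_def] by (intro continuous_intros) auto
    then show ?thesis unfolding gain_def[abs_def] by (cases "j = l") auto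
  qed
  have gn0: "gain j w \<noteq> 0" if "w \<in> ball 0 1" for j w using gain(1)[OF that, of j] by simp
  define u where "u i w = \<Phi> (\<chi> j. (norm (dil i j (z(k := w))) / gain j w) powr p j)" for i w
  define U where "U w = \<Phi> (\<chi> j. (norm (f j (z(k := w))) / gain j w) powr p j)" for w
  have nn: "0 \<le> x / gain j w" if "0 \<le> x" "w \<in> ball 0 1" for x j w
    using that gain(1)[OF that(2), of j] by simp
  have uc: "continuous_on (ball 0 1) (u i)" for i
    unfolding u_def[abs_def]
    by (intro admissible_continuous_on[OF \<Phi>] continuous_on_powr' continuous_intros gc
        continuous_on_subset[OF dil_slice(1)[OF k z] ball_subset_cball]) (auto simp: p gn0 intro!: nn)
  have Uc: "continuous_on (ball 0 1) U"
    unfolding U_def[abs_def]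
    by (intro admissible_continuous_on[OF \<Phi>] continuous_on_powr' continuous_intros gc
        phi_slice_continuous(1)[OF k z]) (auto simp: p gn0 intro!: nn)
  have lim: "(\<lambda>i. u i w) \<longlonglongrightarrow> U w" if w: "w \<in> ball 0 1" for w
    unfolding u_def U_def using w
    by (intro admissible_tendsto[OF \<Phi>] tendsto_powr2 tendsto_divide tendsto_norm
        dil_tendsto[OF slice_in_polydisc[OF k z w]] tendsto_const)
       (auto simp: p gn0 intro!: nn always_eventually)
  have bound: "\<forall>\<^sub>F i in sequentially. (\<integral>\<^sup>+w. ennreal (u i w) \<partial>\<mu>) \<le> ?A i"
    using ev
  proof eventually_elim
    case (elim i)
    then obtain \<beta> where \<beta>: "norm \<beta> \<le> \<rho>" "dil i l (z(k := \<beta>)) = 0" by blast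
    have maj: "log_majorized (\<lambda>w. norm (dil i j (z(k := w))) powr p j) (\<lambda>w. (norm (dil i j (z(k := w))) / gain j w) powr p j)" for j
    proof (cases "j = l")
      case True
      have "(\<lambda>w. dil i j (z(k := w))) holomorphic_on ball 0 1"
        using dil_slicewise[of i j] k by (auto simp: slicewise_holomorphic_def)
      then show ?thesis
        using log_majorized_zero_gain[OF dil_slice(1)[OF k z] _ \<beta>(1) \<rho>(2) _ p, of i j j] \<beta>(2) True
        by (simp add: gain_def)
    next
      case False
      then show ?thesis using dil_slice(3)[OF k z, of i j] by (simp add: gain_def)
    qed
    show ?case
      using one_variable_inequality[OF \<Phi> \<mu> pt dag continuous_on_subset[OF dil_slice(2)[OF k z] sphere_cball] _ _ maj]
      unfolding u_def by (simp add: dil_slice(4)[OF k z])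
  qed
  have "(\<integral>\<^sup>+w. ennreal (U w) \<partial>\<mu>) = (\<integral>\<^sup>+w. liminf (\<lambda>i. ennreal (u i w)) \<partial>\<mu>)"
  proof (rule nn_integral_cong)
    fix w assume "w \<in> space \<mu>"
    then have "w \<in> ball 0 1" by (simp add: space_weighted[OF \<mu>])
    from tendsto_ennrealI[OF lim[OF this]]
    show "ennreal (U w) = liminf (\<lambda>i. ennreal (u i w))"
      by (intro lim_imp_Liminf[symmetric]) auto
  qed
  also have "\<dots> \<le> liminf (\<lambda>i. \<integral>\<^sup>+w. ennreal (u i w) \<partial>\<mu>)"
    by (intro nn_integral_liminf measurable_on_disc uc)
  also have "\<dots> \<le> liminf ?A" by (rule Liminf_mono[OF bound])
  also have "\<dots> \<le> (\<integral>\<^sup>+w. ennreal (phi_mod \<Phi> p f (z(k := w))) \<partial>\<mu>)"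
    using tz by (simp add: tight_def)
  finally have UC: "(\<integral>\<^sup>+w. ennreal (U w) \<partial>\<mu>) \<le> (\<integral>\<^sup>+w. ennreal (phi_mod \<Phi> p f (z(k := w))) \<partial>\<mu>)" .
  have le: "phi_mod \<Phi> p f (z(k := w)) \<le> U w" if w: "w \<in> ball 0 1" for w
    unfolding phi_mod_def U_def
  proof (intro admissible_mono[OF \<Phi>] powr_mono2)
    show "norm (f j (z(k := w))) \<le> norm (f j (z(k := w))) / gain j w" for j
      using gain[OF w, of j] by (simp add: le_divide_eq mult_left_le)
  qed (auto intro: less_imp_le[OF p])
  \<comment> \<open>Strict monotonicity in the argument \<open>l\<close> needs the other arguments
    positive, so no \<open>f j\<close> may vanish on \<open>V\<close>.\<close>
  define V where "V = (\<Inter>j. {w \<in> ball 0 1. f j (z(k := w)) \<noteq> 0})"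
  have less: "phi_mod \<Phi> p f (z(k := w)) < U w" if w: "w \<in> V" for w
    unfolding phi_mod_def U_def
  proof (rule admissible_strict_mono[OF \<Phi>, where k=l])
    have wb: "w \<in> ball 0 1" and nz: "\<And>j. f j (z(k := w)) \<noteq> 0" using w by (auto simp: V_def)
    show "0 < norm (f j (z(k := w))) powr p j" for j using nz by simp
    show "norm (f j (z(k := w))) powr p j \<le> (norm (f j (z(k := w))) / gain j w) powr p j" for j
      using gain[OF wb, of j] by (intro powr_mono2) (auto simp: le_divide_eq mult_left_le intro: less_imp_le[OF p])
    have "norm (f l (z(k := w))) < norm (f l (z(k := w))) / gain l w"
      using zero_gain_bounds[OF \<rho> wb] nz[of l] by (simp add: gain_def less_divide_eq)
    then show "norm (f l (z(k := w))) powr p l < (norm (f l (z(k := w))) / gain l w) powr p l"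
      by (intro powr_less_mono2 p) auto
  qed
  have "open V"
    unfolding V_def
  proof (intro open_INT ballI finite)
    show "open {w \<in> ball 0 1. f j (z(k := w)) \<noteq> 0}" for j
      using continuous_open_preimage[OF phi_slice_continuous(1)[OF k z, of j], of "- {0}"]
      by (simp add: vimage_def Int_def open_Compl)
  qed
  moreover have "V \<subseteq> ball 0 1" "V \<noteq> {}" using c by (auto simp: V_def)
  ultimately have Vm: "V \<in> sets \<mu>" "0 < emeasure \<mu> V" using weighted_open_pos[OF \<mu>] by auto
  have "\<not> (AE w in \<mu>. ennreal (U w) \<le> ennreal (phi_mod \<Phi> p f (z(k := w))))"
  proof
    assume "AE w in \<mu>. ennreal (U w) \<le> ennreal (phi_mod \<Phi> p f (z(k := w)))"
    then obtain w where w: "w \<in> V" "ennreal (U w) \<le> ennreal (phi_mod \<Phi> p f (z(k := w)))"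
      using AE_positive_measure_witness[OF _ Vm] by blast
    then show False using less[OF w(1)] phi_mod_nonneg by (simp add: ennreal_le_iff)
  qed
  then have "(\<integral>\<^sup>+w. ennreal (phi_mod \<Phi> p f (z(k := w))) \<partial>\<mu>) < (\<integral>\<^sup>+w. ennreal (U w) \<partial>\<mu>)"
    using tz le by (intro nn_integral_less measurable_on_disc Uc phi_slice_continuous(2)[OF k z] AE_I2)
      (auto simp: tight_def space_weighted[OF \<mu>] intro!: ennreal_leI)
  then show False using UC by simp
qed

text \<open>A given line need not be tight, but zero-free tight slices converge to it. If it carried
  a zero of \<open>f l\<close> without lying in the zero set, Hurwitz's theorem would put zeros on
  those slices.\<close>

lemma equality_imp_zero_free:
  assumes eq: "(\<integral>z. phi_mod \<Phi> p f z \<partial>polydisc_measure \<mu> n) = phi_norm n \<Phi> p f"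
    and nz: "\<And>j. \<exists>z\<in>polydisc n. f j z \<noteq> 0" and z: "z \<in> polydisc n"
  shows "f l z \<noteq> 0"
proof
  assume "f l z = 0"
  have lines: "f l (a(k := w)) = 0" if a: "a \<in> polydisc n" and za: "f l a = 0" and k: "k < n" and w: "w \<in> ball 0 1" for a k w
  proof (rule ccontr)
    assume ne: "f l (a(k := w)) \<noteq> 0"
    let ?M = "\<Pi>\<^sub>M m\<in>{..<n} - {k}. \<mu>"
    have ex: "\<exists>x. x \<in> space ?M \<and> (\<forall>m<n. m \<noteq> k \<longrightarrow> norm (x m - a m) < e) \<and>
        (\<forall>b\<in>ball 0 1. f l (x(k := b)) \<noteq> 0)" if e: "0 < e" for e
    proof -
      \<comment> \<open>Points where no \<open>f j\<close> vanishes are dense. A box about such a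
        \<open>c\<close> close to \<open>a\<close> has positive measure, hence contains a tight
        \<open>x\<close>, and \<open>c k\<close> is then a common nonzero point on the slice of
        \<open>x\<close>.\<close>
      obtain c d where c: "c \<in> polydisc n" "\<And>m. m < n \<Longrightarrow> norm (c m - a m) < e" and d: "0 < d"
        and cd: "\<And>z j. z \<in> polydisc n \<Longrightarrow> (\<And>m. m < n \<Longrightarrow> norm (z m - c m) < d) \<Longrightarrow> f j z \<noteq> 0"
        using analytic_polydisc_common_nonzero[of UNIV n f a e] fan nz a e by auto
      define V where "V m = ball (c m) d \<inter> ball (a m) e \<inter> ball 0 1" for m
      have V: "open (V m)" "V m \<subseteq> ball 0 1" "V m \<noteq> {}" if "m < n" for m
      proof -
        show "open (V m)" "V m \<subseteq> ball 0 1" by (auto simp: V_def)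
        have "c m \<in> V m" using polydisc_coord[OF c(1) that] c(2)[OF that] d
          by (simp add: V_def dist_norm norm_minus_commute)
        then show "V m \<noteq> {}" by blast
      qed
      let ?B = "Pi\<^sub>E ({..<n} - {k}) V"
      have Vs: "V m \<in> sets \<mu>" "0 < emeasure \<mu> (V m)" if "m \<in> {..<n} - {k}" for m
        using weighted_open_pos[OF \<mu> V] that by auto
      have "?B \<in> sets ?M" using Vs by (intro sets_PiM_I_finite) auto
      moreover have "0 < emeasure ?M ?B"
        using Vs by (subst PM.emeasure_PiM) (auto simp: zero_less_iff_neq_zero)
      ultimately obtain x where x: "x \<in> ?B" "tight k x"
        using AE_positive_measure_witness[OF AE_tight[OF eq k]] by blast
      have xs: "x \<in> space ?M" using x(1) V by (auto simp: space_PiM space_weighted[OF \<mu>] PiE_iff V_def)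
      have xm: "x m \<in> V m" if "m < n" "m \<noteq> k" for m using x(1) that by (auto simp: PiE_iff)
      have ck: "c k \<in> ball 0 1" by (rule polydisc_coord[OF c(1) k])
      have "f j (x(k := c k)) \<noteq> 0" for j
      proof (rule cd[OF slice_in_polydisc[OF k xs ck]])
        show "norm ((x(k := c k)) m - c m) < d" if "m < n" for m
          using xm[OF that] d by (cases "m = k") (auto simp: V_def dist_norm norm_minus_commute)
      qed
      then have "\<forall>b\<in>ball 0 1. f l (x(k := b)) \<noteq> 0"
        using tight_zero_free[OF k xs x(2) ck] by blast
      moreover have "\<forall>m<n. m \<noteq> k \<longrightarrow> norm (x m - a m) < e"
        using xm by (auto simp: V_def dist_norm norm_minus_commute)
      ultimately show ?thesis using xs by blast
    qed
    have "\<forall>i. \<exists>x. x \<in> space ?M \<and> (\<forall>m<n. m \<noteq> k \<longrightarrow> norm (x m - a m) < inverse (real (Suc i))) \<and>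
        (\<forall>b\<in>ball 0 1. f l (x(k := b)) \<noteq> 0)"
      by (intro allI ex) simp
    then obtain x where x: "\<And>i. x i \<in> space ?M"
      "\<And>i m. m < n \<Longrightarrow> m \<noteq> k \<Longrightarrow> norm (x i m - a m) < inverse (real (Suc i))"
      "\<And>i b. b \<in> ball 0 1 \<Longrightarrow> f l ((x i)(k := b)) \<noteq> 0"
      by metis
    have "\<forall>\<^sub>F i in sequentially. \<exists>v\<in>ball (a k) 1 \<inter> ball 0 1. f l (((x i)(k := 0))(k := of_real 1 * v)) = 0"
    \<comment> \<open>The dilation factor is 1 throughout and the radius 1 is arbitrary: any zero on
      a slice of some \<open>x i\<close> contradicts their choice.\<close>
    proof (rule Hurwitz_polydisc[OF fan k, where l="a(k := 0)" and c=w])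
      show "(x i)(k := 0) \<in> polydisc n" for i by (rule slice_in_polydisc[OF k x(1)]) simp
      show "a(k := 0) \<in> polydisc n" using fun_upd_in_polydisc[OF a k] by simp
      show "(\<lambda>i. ((x i)(k := 0)) m) \<longlonglongrightarrow> (a(k := 0)) m" if "m < n" for m
      proof (cases "m = k")
        case False
        have "(\<lambda>i. x i m) \<longlonglongrightarrow> a m"
          by (rule LIM_zero_cancel, rule Lim_null_comparison[OF _ LIMSEQ_inverse_real_of_nat])
             (intro always_eventually allI less_imp_le x(2) that False)
        then show ?thesis using False by simp
      qed simp
    qed (use polydisc_coord[OF a k] za w ne in auto)
    then obtain i v where "v \<in> ball 0 1" "f l ((x i)(k := v)) = 0"
      by (auto dest!: eventually_happens)
    then show False using x(3) by blast
  qed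
  have "f l y = 0" if "y \<in> polydisc n" for y
    by (rule zero_on_lines_imp_zero[OF z \<open>f l z = 0\<close> lines that])
  then show False using nz by blast
qed

end

section \<open>Exchanging exponents\<close>

lemma polydisc_torus_point:
  assumes "\<zeta> \<in> space (torus_haar n)" "r \<in> {0..<1}"
  shows "(\<lambda>k\<in>{..<n}. of_real r * \<zeta> k) \<in> polydisc n"
  using assms by (auto simp: torus_haar_def space_PiM PiE_iff polydisc_def norm_mult)

text \<open>All that a Hardy norm sees is \<open>|f|\<^sup>p\<close>, so that different exponents can be exchanged.\<close>

lemma hardy_mean_same_modulus:
  assumes eq: "\<And>z. z \<in> polydisc n \<Longrightarrow> norm (g z) powr q = norm (f z) powr p"
    and p: "0 < p" and r: "r \<in> {0..<1}"
  shows "hardy_mean n q g r = hardy_mean n p f r powr (p / q)"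
proof -
  have "(\<integral>\<zeta>. norm (g (\<lambda>k\<in>{..<n}. of_real r * \<zeta> k)) powr q \<partial>torus_haar n) =
      (\<integral>\<zeta>. norm (f (\<lambda>k\<in>{..<n}. of_real r * \<zeta> k)) powr p \<partial>torus_haar n)"
    by (intro Bochner_Integration.integral_cong refl eq polydisc_torus_point r)
  then show ?thesis using p by (simp add: hardy_mean_def powr_powr)
qed

lemma hardy_mean_nonneg: "0 \<le> hardy_mean n p f r"
  by (simp add: hardy_mean_def)

lemma hardy_norm_upper: "f \<in> hardy_space n p \<Longrightarrow> r \<in> {0..<1} \<Longrightarrow> hardy_mean n p f r \<le> hardy_norm n p f"
  unfolding hardy_norm_def by (intro cSUP_upper) (auto simp: hardy_space_def)

lemma hardy_norm_nonneg: "f \<in> hardy_space n p \<Longrightarrow> 0 \<le> hardy_norm n p f"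
  using hardy_norm_upper[of f n p 0] hardy_mean_nonneg[of n p f 0] by simp

lemma hardy_same_modulus_le:
  assumes eq: "\<And>z. z \<in> polydisc n \<Longrightarrow> norm (g z) powr q = norm (f z) powr p"
    and f: "f \<in> hardy_space n p" and g: "analytic_polydisc n g" and p: "0 < p" "0 < q"
  shows "g \<in> hardy_space n q" and "hardy_norm n q g powr q \<le> hardy_norm n p f powr p"
proof -
  have le: "hardy_mean n q g r \<le> hardy_norm n p f powr (p / q)" if r: "r \<in> {0..<1}" for r
  proof -
    have "hardy_mean n q g r = hardy_mean n p f r powr (p / q)"
      by (rule hardy_mean_same_modulus[of n g q f p]) (use eq p r in auto)
    also have "\<dots> \<le> hardy_norm n p f powr (p / q)"
      using p by (intro powr_mono2 hardy_norm_upper[OF f r] hardy_mean_nonneg) auto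
    finally show ?thesis .
  qed
  have bdd: "bdd_above (hardy_mean n q g ` {0..<1})"
    by (rule bdd_aboveI2) (rule le)
  then show gH: "g \<in> hardy_space n q"
    using g bdd by (simp add: hardy_space_def)
  have "hardy_norm n q g \<le> hardy_norm n p f powr (p / q)"
    unfolding hardy_norm_def[of n q g] by (intro cSUP_least le) auto
  then have "hardy_norm n q g powr q \<le> (hardy_norm n p f powr (p / q)) powr q"
    using p by (intro powr_mono2 hardy_norm_nonneg[OF gH]) auto
  then show "hardy_norm n q g powr q \<le> hardy_norm n p f powr p"
    using p by (simp add: powr_powr)
qed

text \<open>The relation between the moduli is symmetric, so the one-sided estimate applies in both
  directions.\<close>

lemma hardy_same_modulus:
  assumes eq: "\<And>z. z \<in> polydisc n \<Longrightarrow> norm (g z) powr q = norm (f z) powr p"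
    and f: "f \<in> hardy_space n p" and g: "analytic_polydisc n g" and p: "0 < p" "0 < q"
  shows "g \<in> hardy_space n q" and "hardy_norm n q g powr q = hardy_norm n p f powr p"
proof -
  show gH: "g \<in> hardy_space n q" by (rule hardy_same_modulus_le[OF eq f g p])
  have "analytic_polydisc n f" using f by (simp add: hardy_space_def)
  then show "hardy_norm n q g powr q = hardy_norm n p f powr p"
    using hardy_same_modulus_le(2)[OF eq f g p] hardy_same_modulus_le(2)[OF eq[symmetric] gH _ p(2,1)]
    by (intro antisym) auto
qed

lemma hardy_norm_zero:
  assumes "\<And>z. z \<in> polydisc n \<Longrightarrow> f z = 0" and "0 < p"
  shows "hardy_norm n p f = 0"
proof -
  have "hardy_mean n p f r = 0" if "r \<in> {0..<1}" for r
  proof -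
    have "(\<integral>\<zeta>. norm (f (\<lambda>k\<in>{..<n}. of_real r * \<zeta> k)) powr p \<partial>torus_haar n) = (\<integral>\<zeta>. 0 \<partial>torus_haar n)"
      using assms polydisc_torus_point[OF _ that] by (intro Bochner_Integration.integral_cong) auto
    then show ?thesis by (simp add: hardy_mean_def)
  qed
  then show ?thesis by (simp add: hardy_norm_def)
qed

lemma analytic_polydisc_scale:
  "analytic_polydisc n L \<Longrightarrow> analytic_polydisc n (\<lambda>z. c * L z)"
  unfolding analytic_polydisc_def by (auto intro!: continuous_intros holomorphic_intros)

lemma analytic_polydisc_exp:
  assumes "analytic_polydisc n L"
  shows "analytic_polydisc n (\<lambda>z. exp (L z))"
  using assms unfolding analytic_polydisc_def by (auto intro!: continuous_intros holomorphic_intros)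

text \<open>With a logarithm L of G both sides equal exp(q Re L), whichever branch is taken.\<close>

lemma power_branch_modulus:
  assumes "holomorphic_power_branch n (q / p) G h" and "0 < p" and "z \<in> polydisc n"
  shows "norm (h z) powr p = norm (G z) powr q"
proof -
  obtain L where L: "exp (L z) = G z" "h z = exp (of_real (q / p) * L z)"
    using assms unfolding holomorphic_power_branch_def by blast
  have "norm (G z) powr q = exp (q * Re (L z))" unfolding L(1)[symmetric] norm_exp_powr ..
  moreover have "norm (h z) powr p = exp (p * Re (of_real (q / p) * L z))" unfolding L(2) norm_exp_powr ..
  ultimately show ?thesis using assms by simp
qed

context hardy_family
begin

lemma phi_mod_eq_integral:
  assumes "\<And>z. z \<in> polydisc n \<Longrightarrow> phi_mod \<Phi> p f z = phi_mod \<Phi> q g z"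
  shows "(\<integral>z. phi_mod \<Phi> p f z \<partial>polydisc_measure \<mu> n) = (\<integral>z. phi_mod \<Phi> q g z \<partial>polydisc_measure \<mu> n)"
  using assms by (intro Bochner_Integration.integral_cong)
    (auto simp: polydisc_measure_def space_polydisc_measure[OF \<mu>])

text \<open>Unless one factor vanishes identically, all factors are nonzero at a common point. A
  factor that is identically 0 makes \<Phi> vanish on both sides.\<close>

lemma equality_if_product_zero:
  assumes "\<forall>z\<in>polydisc n. (\<Prod>j\<in>UNIV. f j z) = 0"
  shows "(\<integral>z. phi_mod \<Phi> p f z \<partial>polydisc_measure \<mu> n) = phi_norm n \<Phi> p f"
proof -
  obtain l where l: "\<And>z. z \<in> polydisc n \<Longrightarrow> f l z = 0"
  proof (rule ccontr)
    assume "\<not> thesis"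
    then have nz: "\<exists>z\<in>polydisc n. f j z \<noteq> 0" for j using that by blast
    have "(\<lambda>k\<in>{..<n}. 0) \<in> polydisc n" by (auto simp: polydisc_def)
    then obtain c e where "c \<in> polydisc n" "0 < e"
      "\<forall>z\<in>polydisc n. (\<forall>m<n. norm (z m - c m) < e) \<longrightarrow> (\<forall>j\<in>UNIV. f j z \<noteq> 0)"
      using analytic_polydisc_common_nonzero[of UNIV n f "\<lambda>k\<in>{..<n}. 0" 1] fan nz by auto
    then have "c \<in> polydisc n" "\<forall>j\<in>UNIV. f j c \<noteq> 0" by auto
    then have "(\<Prod>j\<in>UNIV. f j c) \<noteq> 0" by simp
    then show False using assms \<open>c \<in> polydisc n\<close> by blast
  qed
  have "phi_mod \<Phi> p f z = 0" if "z \<in> polydisc n" for z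
    unfolding phi_mod_def by (rule admissible_zero[OF \<Phi>, where k=l]) (use l that in auto)
  then have "(\<integral>z. phi_mod \<Phi> p f z \<partial>polydisc_measure \<mu> n) = (\<integral>z. 0 \<partial>polydisc_measure \<mu> n)"
    by (intro Bochner_Integration.integral_cong) (auto simp: polydisc_measure_def space_polydisc_measure[OF \<mu>])
  moreover have "phi_norm n \<Phi> p f = 0"
    unfolding phi_norm_def
    by (rule admissible_zero[OF \<Phi>, where k=l]) (use hardy_norm_zero[of n "f l" "p l"] l p in auto)
  ultimately show ?thesis by simp
qed

lemma equality_if_branch:
  assumes \<Psi>: "\<Psi> \<in> extremals \<Phi> \<mu> pt n" and br: "\<And>j. holomorphic_power_branch n (pt j / p j) (\<Psi> j) (f j)"
  shows "(\<integral>z. phi_mod \<Phi> p f z \<partial>polydisc_measure \<mu> n) = phi_norm n \<Phi> p f"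
proof -
  have md: "norm (f j z) powr p j = norm (\<Psi> j z) powr pt j" if "z \<in> polydisc n" for j z
    by (rule power_branch_modulus[OF br p that])
  have \<Psi>H: "\<Psi> j \<in> hardy_space n (pt j)" for j using \<Psi> by (simp add: extremals_def)
  have "(\<integral>z. phi_mod \<Phi> p f z \<partial>polydisc_measure \<mu> n) = (\<integral>z. phi_mod \<Phi> pt \<Psi> z \<partial>polydisc_measure \<mu> n)"
    by (rule phi_mod_eq_integral) (simp add: phi_mod_def md)
  also have "\<dots> = phi_norm n \<Phi> pt \<Psi>" using \<Psi> by (simp add: extremals_def)
  also have "\<dots> = phi_norm n \<Phi> p f"
  proof -
    have "hardy_norm n (p j) (f j) powr p j = hardy_norm n (pt j) (\<Psi> j) powr pt j" for j
      by (rule hardy_same_modulus(2)[OF md[where j=j] \<Psi>H fan pt p])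
    then show ?thesis by (simp add: phi_norm_def)
  qed
  finally show ?thesis .
qed

text \<open>Equality makes each \<open>f j\<close> zero-free, which gives it a logarithm
  \<open>L j\<close> and so a power \<open>p j / pt j\<close>. The powers of the moduli agree with
  those of \<open>f\<close>, hence so do the integrals and the norms, and the tuple of these powers
  is extremal.\<close>

lemma branch_if_equality:
  assumes eq: "(\<integral>z. phi_mod \<Phi> p f z \<partial>polydisc_measure \<mu> n) = phi_norm n \<Phi> p f"
    and nz: "\<And>j. \<exists>z\<in>polydisc n. f j z \<noteq> 0"
  shows "\<exists>\<Psi>\<in>extremals \<Phi> \<mu> pt n. \<forall>j. holomorphic_power_branch n (pt j / p j) (\<Psi> j) (f j)"
proof -
  have "\<exists>L. analytic_polydisc n L \<and> (\<forall>z\<in>polydisc n. exp (L z) = f j z)" for j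
    using analytic_polydisc_log[OF fan equality_imp_zero_free[OF eq nz]] by metis
  then obtain L where L: "\<And>j. analytic_polydisc n (L j)" "\<And>j z. z \<in> polydisc n \<Longrightarrow> exp (L j z) = f j z"
    by metis
  \<comment> \<open>The logarithm of \<open>\<Psi> j\<close> that witnesses the branch; scaling it
    by \<open>pt j / p j\<close> returns \<open>L j\<close>.\<close>
  define M where "M j z = of_real (p j / pt j) * L j z" for j z
  define \<Psi> where "\<Psi> j z = exp (M j z)" for j z
  have M: "analytic_polydisc n (M j)" for j
    unfolding M_def by (rule analytic_polydisc_scale[OF L(1)])
  have \<Psi>an: "analytic_polydisc n (\<Psi> j)" for j
    unfolding \<Psi>_def by (rule analytic_polydisc_exp[OF M])
  have br: "holomorphic_power_branch n (pt j / p j) (\<Psi> j) (f j)" for j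
    unfolding holomorphic_power_branch_def
  proof (intro exI[of _ "M j"] conjI ballI M)
    fix z assume z: "z \<in> polydisc n"
    show "exp (M j z) = \<Psi> j z" by (simp add: \<Psi>_def)
    have "of_real (pt j / p j) * M j z = L j z"
      using p[of j] pt[of j] by (simp add: M_def)
    then show "f j z = exp (of_real (pt j / p j) * M j z)" using L(2)[OF z] by simp
  qed
  have md: "norm (\<Psi> j z) powr pt j = norm (f j z) powr p j" if "z \<in> polydisc n" for j z
    by (rule power_branch_modulus[OF br p that, symmetric])
  have "\<Psi> \<in> extremals \<Phi> \<mu> pt n"
    unfolding extremals_def
  proof (intro CollectI conjI allI)
    show "\<Psi> j \<in> hardy_space n (pt j)" for j
      by (rule hardy_same_modulus(1)[OF md[where j=j] fH \<Psi>an p pt])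
    show "\<exists>z\<in>polydisc n. \<Psi> j z \<noteq> 0" for j
      using nz[of j] by (auto simp: \<Psi>_def)
    have "(\<integral>z. phi_mod \<Phi> pt \<Psi> z \<partial>polydisc_measure \<mu> n) = (\<integral>z. phi_mod \<Phi> p f z \<partial>polydisc_measure \<mu> n)"
      by (rule phi_mod_eq_integral[symmetric]) (simp add: phi_mod_def md)
    also have "\<dots> = phi_norm n \<Phi> p f" by (rule eq)
    also have "\<dots> = phi_norm n \<Phi> pt \<Psi>"
    proof -
      have "hardy_norm n (pt j) (\<Psi> j) powr pt j = hardy_norm n (p j) (f j) powr p j" for j
        by (rule hardy_same_modulus(2)[OF md[where j=j] fH \<Psi>an p pt])
      then show ?thesis by (simp add: phi_norm_def)
    qed
    finally show "(\<integral>z. phi_mod \<Phi> pt \<Psi> z \<partial>polydisc_measure \<mu> n) = phi_norm n \<Phi> pt \<Psi>" .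
  qed
  then show ?thesis using br by blast
qed

end

theorem theorem1p4:
  fixes \<Phi> :: "real ^ 'm \<Rightarrow> real" and \<mu> :: "complex measure" and pt :: "'m \<Rightarrow> real"
  assumes "admissible \<Phi>"
    and "weighted_measure \<mu>"
    and "\<And>j. 0 < pt j"
    and "dagger \<Phi> \<mu> pt"
  shows "\<forall>n\<ge>1.
    (\<forall>p f. (\<forall>j. 0 < p j \<and> f j \<in> hardy_space n (p j)) \<longrightarrow>
       integrable (polydisc_measure \<mu> n) (phi_mod \<Phi> p f) \<and>
       (\<integral>z. phi_mod \<Phi> p f z \<partial>polydisc_measure \<mu> n) \<le> phi_norm n \<Phi> p f \<and>
       ((\<integral>z. phi_mod \<Phi> p f z \<partial>polydisc_measure \<mu> n) = phi_norm n \<Phi> p f \<longleftrightarrow>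
          (\<forall>z\<in>polydisc n. (\<Prod>j\<in>UNIV. f j z) = 0) \<or>
          (\<exists>\<Psi>\<in>extremals \<Phi> \<mu> pt n.
             \<forall>j. holomorphic_power_branch n (pt j / p j) (\<Psi> j) (f j)))) \<and>
    (\<forall>\<Psi>\<in>extremals \<Phi> \<mu> pt n. \<forall>j. \<forall>z\<in>polydisc n. \<Psi> j z \<noteq> 0)"
proof (intro allI impI conjI ballI)
  fix n :: nat and p :: "'m \<Rightarrow> real" and f :: "'m \<Rightarrow> (nat \<Rightarrow> complex) \<Rightarrow> complex"
  assume "\<forall>j. 0 < p j \<and> f j \<in> hardy_space n (p j)"
  then interpret hardy_family \<Phi> \<mu> pt p n f
    using assms by unfold_locales auto
  show "integrable (polydisc_measure \<mu> n) (phi_mod \<Phi> p f)"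
    by (rule phi_mod_integrable)
  show "(\<integral>z. phi_mod \<Phi> p f z \<partial>polydisc_measure \<mu> n) \<le> phi_norm n \<Phi> p f"
    by (rule integral_phi_mod_le)
  show "(\<integral>z. phi_mod \<Phi> p f z \<partial>polydisc_measure \<mu> n) = phi_norm n \<Phi> p f \<longleftrightarrow>
      (\<forall>z\<in>polydisc n. (\<Prod>j\<in>UNIV. f j z) = 0) \<or>
      (\<exists>\<Psi>\<in>extremals \<Phi> \<mu> pt n. \<forall>j. holomorphic_power_branch n (pt j / p j) (\<Psi> j) (f j))"
    (is "?eq \<longleftrightarrow> ?zero \<or> ?branch")
  proof
    assume ?eq
    show "?zero \<or> ?branch"
    proof (cases "\<forall>j. \<exists>z\<in>polydisc n. f j z \<noteq> 0")
      case True
      then show ?thesis using branch_if_equality[OF \<open>?eq\<close>] by blast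
    next
      case False
      then obtain l where "\<forall>z\<in>polydisc n. f l z = 0" by blast
      then have ?zero by (auto intro!: exI[of _ l])
      then show ?thesis ..
    qed
  next
    assume "?zero \<or> ?branch"
    then show ?eq using equality_if_product_zero equality_if_branch by blast
  qed
next
  fix n :: nat and \<Psi> :: "'m \<Rightarrow> (nat \<Rightarrow> complex) \<Rightarrow> complex" and j z
  \<comment> \<open>An extremal tuple is an equality case with \<open>p = pt\<close> in which no
    member vanishes identically.\<close>
  assume \<Psi>: "\<Psi> \<in> extremals \<Phi> \<mu> pt n" and z: "z \<in> polydisc n"
  then interpret hardy_family \<Phi> \<mu> pt pt n \<Psi>
    using assms by unfold_locales (auto simp: extremals_def)
  show "\<Psi> j z \<noteq> 0"
    using \<Psi> by (intro equality_imp_zero_free z) (auto simp: extremals_def)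
qed

end
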